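(* Let $\varepsilon>0$ be a constant. Consider any (possibly Las Vegas randomized) external memory priority queue, with main memory of $M$ words and disk blocks of $B$ words, supporting Insert, ExtractMin and DecreaseKey, such that Insert costs expected amortized $t_I$ I/Os, ExtractMin costs expected amortized $t_E$ I/Os and DecreaseKey costs expected amortized $t_D$ I/Os. Then, when $N \geq M^{4+\varepsilon}$, $$\max\{t_I,t_E,t_D\} = \Omega\left(\frac{1}{B}\log_{\lg N} B\right).$$ The lower bound holds also for non-comparison-based priority queues.
   Context: A priority queue maintains a set $S$ of (key, priority) pairs under: Insert$(k,p)$, which adds key $k$ with priority $p$; ExtractMin, which removes and returns a pair $(k,p)\in S$ with $p$ minimal (ties broken arbitrarily); DecreaseKey$(k,p)$, which, given that some pair $(k,p')$ is in $S$, changes the priority of $k$ to $\min(p,p')$. $N$ denotes the number of operations (and bounds the size of $S$). Model (external memory / cell probe with block cells): keys and priorities are $O(\lg N)$-bit integers; the word size is $w=\Theta(\lg N)$ bits; the disk is an unbounded array of blocks (cells) of $Bw$ bits each with integer addresses in $[2^w]$; the main memory holds $Mw$ bits (with $M\geq 2B$); arbitrary computation on main memory is free, and the cost of an operation is the number of blocks read or written (I/Os, i.e. cell probes). A Las Vegas randomized data structure always answers correctly; its costs are expectations over its random coins, amortized over the operation sequence. *)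

theory Defs
  imports "HOL-Probability.Probability"
begin

section \<open>Priority queues with DecreaseKey\<close>

datatype request =
    is_Insert: Insert nat nat   \<comment> \<open>key, priority\<close>
  | is_ExtractMin: ExtractMin
  | is_DecreaseKey: DecreaseKey nat nat   \<comment> \<open>key, priority\<close>

type_synonym answer = "(nat \<times> nat) option"

text \<open>
  Keys range over \<open>[2^kb]\<close> and priorities over \<open>[2^pb]\<close>. A key identifies at most one pair of
  the maintained set, so that ``the priority of \<open>k\<close>'' is meaningful; hence only fresh keys may be
  inserted.
\<close>

fun legal :: "nat \<Rightarrow> nat \<Rightarrow> (nat \<times> nat) set \<Rightarrow> request \<Rightarrow> bool" where
  "legal kb pb S (Insert k p) \<longleftrightarrow> k < 2 ^ kb \<and> p < 2 ^ pb \<and> k \<notin> fst ` S"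
| "legal kb pb S ExtractMin \<longleftrightarrow> S \<noteq> {}"
| "legal kb pb S (DecreaseKey k p) \<longleftrightarrow> p < 2 ^ pb \<and> k \<in> fst ` S"

text \<open>
  \<open>correct_step S q a S'\<close>: on the set \<open>S\<close>, \<open>a\<close> is a correct answer to \<open>q\<close>, and \<open>S'\<close> is the
  resulting set. For ExtractMin there may be several correct answers (ties).
\<close>

fun correct_step ::
  "(nat \<times> nat) set \<Rightarrow> request \<Rightarrow> answer \<Rightarrow> (nat \<times> nat) set \<Rightarrow> bool" where
  "correct_step S (Insert k p) a S' \<longleftrightarrow> a = None \<and> S' = insert (k, p) S"
| "correct_step S ExtractMin a S' \<longleftrightarrow>
     (\<exists>k p. a = Some (k, p) \<and> (k, p) \<in> S \<and> (\<forall>(k', p') \<in> S. p \<le> p') \<and> S' = S - {(k, p)})"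
| "correct_step S (DecreaseKey k p) a S' \<longleftrightarrow>
     a = None \<and> S' = (\<lambda>(k', p'). (k', if k' = k then min p p' else p')) ` S"

text \<open>
  A request sequence is valid if every request is legal when it is issued, no matter how the ties
  of the preceding ExtractMin requests were broken.
\<close>

fun valid_requests :: "nat \<Rightarrow> nat \<Rightarrow> (nat \<times> nat) set \<Rightarrow> request list \<Rightarrow> bool" where
  "valid_requests kb pb S [] \<longleftrightarrow> True"
| "valid_requests kb pb S (q # qs) \<longleftrightarrow>
     legal kb pb S q \<and> (\<forall>a S'. correct_step S q a S' \<longrightarrow> valid_requests kb pb S' qs)"

fun correct_answers :: "(nat \<times> nat) set \<Rightarrow> request list \<Rightarrow> answer list \<Rightarrow> bool" where
  "correct_answers S [] as \<longleftrightarrow> as = []"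
| "correct_answers S (q # qs) as \<longleftrightarrow>
     (\<exists>a as' S'. as = a # as' \<and> correct_step S q a S' \<and> correct_answers S' qs as')"

section \<open>External memory data structures\<close>

text \<open>
  The contents of the main memory and of a block are bit strings. Between two I/Os the data
  structure performs an arbitrary computation on the main memory; only the outcome is modelled,
  namely the next I/O (or the final answer) and the new contents of the main memory. After a read,
  the new contents are a function of the block that was read.
\<close>

datatype action =
    Read nat "bool list \<Rightarrow> bool list"
  | Write nat "bool list" "bool list"     \<comment> \<open>address, block, new main memory\<close>
  | Return answer "bool list"

type_synonym config = "bool list \<times> (nat \<Rightarrow> bool list)"   \<comment> \<open>main memory, disk\<close>

text \<open>
  \<open>control A i j q m\<close> is the next action when the main memory holds \<open>m\<close> and \<open>j\<close> I/Os have already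
  been made for the \<open>i\<close>-th request \<open>q\<close>. The dependence on \<open>i\<close> and \<open>j\<close> makes it possible to use
  fresh random coins in each step once \<open>A\<close> itself depends on the coins.
\<close>

record machine =
  initial :: config
  control :: "nat \<Rightarrow> nat \<Rightarrow> request \<Rightarrow> bool list \<Rightarrow> action"

fun wf_action :: "nat \<Rightarrow> nat \<Rightarrow> nat \<Rightarrow> action \<Rightarrow> bool" where
  "wf_action M B w (Read a f) \<longleftrightarrow>
     a < 2 ^ w \<and> (\<forall>b. length b = B * w \<longrightarrow> length (f b) = M * w)"
| "wf_action M B w (Write a b m) \<longleftrightarrow> a < 2 ^ w \<and> length b = B * w \<and> length m = M * w"
| "wf_action M B w (Return ans m) \<longleftrightarrow> length m = M * w"

definition wf_machine :: "nat \<Rightarrow> nat \<Rightarrow> nat \<Rightarrow> machine \<Rightarrow> bool" where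
  "wf_machine M B w A \<longleftrightarrow>
     length (fst (initial A)) = M * w \<and>
     (\<forall>a. length (snd (initial A) a) = B * w) \<and>
     (\<forall>i j q m. length m = M * w \<longrightarrow> wf_action M B w (control A i j q m))"

text \<open>
  \<open>op_run A i q j s ans s' c\<close>: in configuration \<open>s\<close>, after \<open>j\<close> I/Os for the \<open>i\<close>-th request \<open>q\<close>, the
  machine makes \<open>c\<close> further I/Os, answers \<open>ans\<close> and stops in configuration \<open>s'\<close>.
\<close>

inductive op_run ::
  "machine \<Rightarrow> nat \<Rightarrow> request \<Rightarrow> nat \<Rightarrow> config \<Rightarrow> answer \<Rightarrow> config \<Rightarrow> nat \<Rightarrow> bool"
  for A i q where
  op_return: "control A i j q m = Return ans m' \<Longrightarrow> op_run A i q j (m, D) ans (m', D) 0"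
| op_read: "control A i j q m = Read a f \<Longrightarrow> op_run A i q (Suc j) (f (D a), D) ans s' c
    \<Longrightarrow> op_run A i q j (m, D) ans s' (Suc c)"
| op_write: "control A i j q m = Write a b m' \<Longrightarrow> op_run A i q (Suc j) (m', D(a := b)) ans s' c
    \<Longrightarrow> op_run A i q j (m, D) ans s' (Suc c)"

text \<open>
  The machine processes the requests online, numbering them from \<open>i\<close> on, with \<open>c\<close> I/Os in total.
\<close>

inductive seq_run ::
  "machine \<Rightarrow> nat \<Rightarrow> config \<Rightarrow> request list \<Rightarrow> answer list \<Rightarrow> nat \<Rightarrow> bool"
  for A where
  seq_Nil: "seq_run A i s [] [] 0"
| seq_Cons: "op_run A i q 0 s ans s' c \<Longrightarrow> seq_run A (Suc i) s' qs as c'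
    \<Longrightarrow> seq_run A i s (q # qs) (ans # as) (c + c')"

lemma op_run_deterministic:
  "op_run A i q j s ans s' c \<Longrightarrow> op_run A i q j s ans2 s2 c2 \<Longrightarrow> ans2 = ans \<and> s2 = s' \<and> c2 = c"
proof (induction arbitrary: c2 rule: op_run.induct)
  case op_return
  from op_return.prems op_return.hyps show ?case by (cases rule: op_run.cases) auto
next
  case op_read
  from op_read.prems op_read.hyps op_read.IH show ?case by (cases rule: op_run.cases) auto
next
  case op_write
  from op_write.prems op_write.hyps op_write.IH show ?case by (cases rule: op_run.cases) auto
qed

lemma seq_run_deterministic:
  "seq_run A i s qs as c \<Longrightarrow> seq_run A i s qs as2 c2 \<Longrightarrow> as2 = as \<and> c2 = c"
proof (induction arbitrary: as2 c2 rule: seq_run.induct)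
  case seq_Nil
  then show ?case by (cases rule: seq_run.cases) auto
next
  case (seq_Cons i q s ans s' c qs as c')
  from seq_Cons.prems show ?case
    by (cases rule: seq_run.cases) (use seq_Cons op_run_deterministic in blast)+
qed

text \<open>
  The infimum ranges over at most one value; it is \<open>\<infinity>\<close> if the machine does not terminate, i.e. if
  it makes infinitely many I/Os.
\<close>

definition io_cost :: "machine \<Rightarrow> request list \<Rightarrow> ennreal" where
  "io_cost A qs = (INF c \<in> {c. \<exists>as. seq_run A 0 (initial A) qs as c}. of_nat c)"

section \<open>Las Vegas data structures and their amortized costs\<close>

definition coin_space :: "(nat \<Rightarrow> bool) measure" where
  "coin_space = Pi\<^sub>M UNIV (\<lambda>_. measure_pmf (bernoulli_pmf (1 / 2)))"

definition las_vegas_pq ::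
  "nat \<Rightarrow> nat \<Rightarrow> nat \<Rightarrow> nat \<Rightarrow> nat \<Rightarrow> nat \<Rightarrow> ((nat \<Rightarrow> bool) \<Rightarrow> machine) \<Rightarrow> bool" where
  "las_vegas_pq N M B w kb pb A \<longleftrightarrow>
     (\<forall>r. wf_machine M B w (A r)) \<and>
     (\<forall>qs. length qs = N \<and> valid_requests kb pb {} qs \<longrightarrow>
        (\<lambda>r. io_cost (A r) qs) \<in> borel_measurable coin_space \<and>
        (\<forall>r as c. seq_run (A r) 0 (initial (A r)) qs as c \<longrightarrow> correct_answers {} qs as))"

definition num_insert :: "request list \<Rightarrow> nat" where
  "num_insert qs = length (filter is_Insert qs)"

definition num_extract :: "request list \<Rightarrow> nat" where
  "num_extract qs = length (filter is_ExtractMin qs)"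

definition num_decrease :: "request list \<Rightarrow> nat" where
  "num_decrease qs = length (filter is_DecreaseKey qs)"

definition expected_amortized ::
  "nat \<Rightarrow> nat \<Rightarrow> nat \<Rightarrow> ((nat \<Rightarrow> bool) \<Rightarrow> machine) \<Rightarrow> real \<Rightarrow> real \<Rightarrow> real \<Rightarrow> bool" where
  "expected_amortized N kb pb A tI tE tD \<longleftrightarrow>
     0 \<le> tI \<and> 0 \<le> tE \<and> 0 \<le> tD \<and>
     (\<forall>qs. length qs = N \<and> valid_requests kb pb {} qs \<longrightarrow>
        (\<integral>\<^sup>+ r. io_cost (A r) qs \<partial>coin_space)
          \<le> ennreal (real (num_insert qs) * tI + real (num_extract qs) * tE
                       + real (num_decrease qs) * tD))"

end

theory Submission
  imports Defs "HOL-Real_Asymp.Real_Asymp"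
begin

text \<open>
  Fixing good coins makes the data structure deterministic, with small average cost over a finite set
  of request sequences. If \<open>B\<close> is polylogarithmic in \<open>N\<close>, the bound is \<open>\<Omega>(1 / B)\<close> and follows by
  counting: sorting \<open>N / 2\<close> random priorities forces the data structure to read them back.

  For larger \<open>B\<close>, insert a universe of keys with a high priority and traverse a tree of
  polylogarithmic fan-out in depth-first order. On entering a node, lower a random set \<open>Z\<close> of keys to
  the priority of its level; at a leaf, delete a random key; on leaving the node, extract \<open>|Z|\<close>
  minima. All keys are distinct, so the deletions never hit \<open>Z\<close> and every answer is known in advance;
  the cost comes from certifying this. Consider a child with \<open>m\<close> leaves of a node with set \<open>Z\<close>,
  let \<open>D\<close> be the set deleted below the child, and suppose that, after the child, few cells last
  written during the child are read, while few I/Os are made during the child. Fix popular addresses of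
  the I/Os during the child, and popular contents of those cells before it. Two runs with the same
  label \<open>\<rho>\<close> (memory after the child, and the recorded reads of its cells) can then be exchanged, so
  \<open>Z\<close> must avoid the union of all \<open>D\<close> that share the label. As there are at most \<open>2^(m + m lg B / 8)\<close> labels,
  such a union typically leaves any given small set \<open>W\<close> by a fraction \<open>\<Omega>(B^(-1/4))\<close> of the
  universe. Choosing one \<open>D\<close> after the other, each good for many of the remaining \<open>Z\<close>, one obtains
  many sets \<open>Z\<close> that avoid a constant fraction of the universe, which is impossible.
  So \<open>\<Omega>(m lg B / (B w))\<close> reads are charged to each child. A read is determined by the request that
  last wrote the cell and the request that reads it, hence charged at most once, and summing over the
  \<open>\<Omega>(lg N / lg lg N)\<close> levels with \<open>m \<ge> M w\<close> gives the bound.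
\<close>

section \<open>Avoiding unions of random sets\<close>

text \<open>The condition on \<open>M\<close> enters as \<open>M ^ 4 \<le> N\<close>, and the
  exponents fit as follows. With all other keys frozen, the keys \<open>D\<close> and
  \<open>Z\<close> of one child are counted in a product space; distinct ones form a constant
  fraction of it only if the square of their number is below the size of the universe. Hence
  \<open>\<beta> ^ H\<close> is about \<open>N powr (2/5)\<close>, and many such trees stand side by
  side. As \<open>M * w \<le> N powr (3/10)\<close>, a constant fraction of the levels has children
  with \<open>m \<ge> M * w\<close> leaves. The fan-out is \<open>\<nu> ^ 4\<close>, with
  \<open>\<nu>\<close> about \<open>2 * lg N\<close>, and \<open>Z\<close> has
  \<open>\<nu> ^ 3 * m\<close> elements: more than the information in the fixed cell contents, which
  is of order \<open>\<nu> ^ 2 * m\<close>, and yet only a fraction \<open>1 / \<nu>\<close> of the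
  leaves of the node, so that all levels together at most double the length. Reads of cells written
  by a child are charged once, but the I/Os inside a child recur on every level. Their threshold is
  therefore larger by a factor of order \<open>w\<close>, which pays for the at most
  \<open>lg N\<close> levels.\<close>

lemma pigeonhole_fibre:
  fixes K :: real
  assumes "finite A" and "finite (f ` A)" and "card (f ` A) \<le> K" and "A \<noteq> {}"
  obtains y where "y \<in> f ` A" and "card A / K \<le> card {x \<in> A. f x = y}"
proof -
  have c0: "card (f ` A) > 0" using assms by (simp add: card_gt_0_iff)
  obtain y where y: "y \<in> f ` A" "card A \<le> card (f -` {y} \<inter> A) * card (f ` A)"
    using pigeonhole_card[of f A "f ` A"] assms c0 by auto
  have "f -` {y} \<inter> A = {x \<in> A. f x = y}" by auto
  then have "real (card A) \<le> card {x \<in> A. f x = y} * real (card (f ` A))"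
    using y(2) by (metis of_nat_le_iff of_nat_mult)
  also have "\<dots> \<le> card {x \<in> A. f x = y} * K" using assms(3) by (intro mult_left_mono) auto
  finally have "card A / K \<le> card {x \<in> A. f x = y}"
    using c0 assms(3) by (simp add: divide_le_eq)
  with y(1) show ?thesis using that by blast
qed

text \<open>A union bound over the set of \<open>h\<close> coordinates sent into \<open>X\<close>; a
  set of \<open>2 * h\<close> elements has \<open>4 ^ h\<close> subsets in all.\<close>

lemma card_functions_hitting:
  assumes "finite I" and "finite U" and "X \<subseteq> U" and "card I = 2 * h"
  shows "card {D \<in> I \<rightarrow>\<^sub>E U. h \<le> card {i \<in> I. D i \<in> X}} \<le> 4 ^ h * card X ^ h * card U ^ h"
proof -
  let ?\<K> = "{K. K \<subseteq> I \<and> card K = h}"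
  let ?F = "\<lambda>K. Pi\<^sub>E I (\<lambda>i. if i \<in> K then X else U)"
  have finX: "finite X" using assms finite_subset by blast
  have fin\<K>: "finite ?\<K>" using assms(1) by simp
  have sub: "{D \<in> I \<rightarrow>\<^sub>E U. h \<le> card {i \<in> I. D i \<in> X}} \<subseteq> (\<Union>K \<in> ?\<K>. ?F K)"
  proof
    fix D assume D: "D \<in> {D \<in> I \<rightarrow>\<^sub>E U. h \<le> card {i \<in> I. D i \<in> X}}"
    then obtain K where K: "K \<subseteq> {i \<in> I. D i \<in> X}" "card K = h"
      by (auto elim: obtain_subset_with_card_n)
    then have "D \<in> ?F K" using D by (auto simp: PiE_def Pi_def)
    with K show "D \<in> (\<Union>K \<in> ?\<K>. ?F K)" by auto
  qed
  have cF: "card (?F K) = card X ^ h * card U ^ h" if "K \<in> ?\<K>" for K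
  proof -
    have "card (?F K) = (\<Prod>i\<in>I. if i \<in> K then card X else card U)"
      using assms(1) by (auto simp: card_PiE intro!: prod.cong)
    also have "\<dots> = (\<Prod>i\<in>K. card X) * (\<Prod>i\<in>I - K. card U)"
      using that assms(1) by (subst prod.If_cases) (auto simp: Int_absorb1 Diff_eq)
    also have "card (I - K) = h"
      using that assms by (auto simp: card_Diff_subset finite_subset)
    then have "(\<Prod>i\<in>K. card X) * (\<Prod>i\<in>I - K. card U) = card X ^ h * card U ^ h"
      using that by simp
    finally show ?thesis .
  qed
  have "card ?\<K> \<le> card (Pow I)"
    using assms(1) by (intro card_mono) auto
  then have c\<K>: "card ?\<K> \<le> 4 ^ h"
    using assms by (simp add: card_Pow power_mult)
  have "card {D \<in> I \<rightarrow>\<^sub>E U. h \<le> card {i \<in> I. D i \<in> X}} \<le> card (\<Union>K \<in> ?\<K>. ?F K)"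
    using sub fin\<K> assms finX by (intro card_mono) (auto intro!: finite_PiE)
  also have "\<dots> \<le> (\<Sum>K \<in> ?\<K>. card (?F K))"
    using fin\<K> by (rule card_UN_le)
  also have "\<dots> = card ?\<K> * (card X ^ h * card U ^ h)" using cF by simp
  also have "\<dots> \<le> 4 ^ h * (card X ^ h * card U ^ h)" using c\<K> by (intro mult_right_mono) auto
  finally show ?thesis by (simp add: mult.assoc)
qed

text \<open>Double counting of the pairs related by \<open>P\<close>. It serves to find a single
  \<open>D\<close> that is good for a large share of the surviving \<open>Z\<close>.\<close>

lemma exists_heavy_column:
  fixes \<delta> :: real
  assumes "finite \<X>" and "finite \<Y>" and "\<Y> \<noteq> {}" and "\<X> \<noteq> {}"
    and "\<And>y. y \<in> \<Y> \<Longrightarrow> \<delta> * card \<X> \<le> card {x \<in> \<X>. P x y}"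
  obtains x where "x \<in> \<X>" and "\<delta> * card \<Y> \<le> card {y \<in> \<Y>. P x y}"
proof -
  have eq: "(\<Sum>x\<in>\<X>. card {y \<in> \<Y>. P x y}) = (\<Sum>y\<in>\<Y>. card {x \<in> \<X>. P x y})"
    using assms(1,2) by (intro sum_multicount_gen) auto
  have "(\<Sum>y\<in>\<Y>. \<delta> * card \<X>) \<le> (\<Sum>y\<in>\<Y>. real (card {x \<in> \<X>. P x y}))"
    using assms(5) by (rule sum_mono)
  also have "\<dots> = (\<Sum>x\<in>\<X>. real (card {y \<in> \<Y>. P x y}))" by (simp only: of_nat_sum[symmetric] eq)
  finally have le: "card \<X> * (\<delta> * card \<Y>) \<le> (\<Sum>x\<in>\<X>. real (card {y \<in> \<Y>. P x y}))"
    by (simp add: mult_ac)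
  have "\<exists>x\<in>\<X>. \<delta> * card \<Y> \<le> card {y \<in> \<Y>. P x y}"
  proof (rule ccontr)
    assume "\<not> (\<exists>x\<in>\<X>. \<delta> * card \<Y> \<le> card {y \<in> \<Y>. P x y})"
    then have "(\<Sum>x\<in>\<X>. real (card {y \<in> \<Y>. P x y})) < (\<Sum>x\<in>\<X>. \<delta> * card \<Y>)"
      using assms(1,4) by (intro sum_strict_mono) auto
    with le show False by simp
  qed
  then show ?thesis using that by blast
qed

text \<open>
  Few \<open>D\<close> have half of their values in \<open>W\<close>, and few have half of them in one of the at most \<open>R\<close> sets
  \<open>V r - W\<close> of density below \<open>1 / (64 s)\<close>. So every round finds a \<open>D\<close>, good for many of the remaining
  \<open>Z\<close>, whose label \<open>r\<close> has a set \<open>V r\<close> that enlarges \<open>W\<close> by the fraction \<open>1 / (64 s)\<close>.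
\<close>

lemma avoided_set_growth:
  fixes U :: "'u set" and I :: "'i set" and J :: "'j set" and R Y \<epsilon> :: real
    and \<rho> :: "('i \<Rightarrow> 'u) \<Rightarrow> ('j \<Rightarrow> 'u) \<Rightarrow> 'r"
  assumes fin: "finite U" "finite I" "finite J" and U: "U \<noteq> {}" and I: "card I = 2 * h"
    and \<Z>: "\<Z> \<subseteq> J \<rightarrow>\<^sub>E U"
    and G: "\<And>Z. Z \<in> \<Z> \<Longrightarrow> G Z \<subseteq> I \<rightarrow>\<^sub>E U"
    and big: "\<And>Z. Z \<in> \<Z> \<Longrightarrow> \<epsilon> * card U ^ (2 * h) \<le> card (G Z)"
    and cross: "\<And>Z Z' D D'. Z \<in> \<Z> \<Longrightarrow> Z' \<in> \<Z> \<Longrightarrow> D \<in> G Z \<Longrightarrow> D' \<in> G Z' \<Longrightarrow> \<rho> D Z = \<rho> D' Z' \<Longrightarrow>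
                  D' ` I \<inter> Z ` J = {}"
    and R: "card {\<rho> D Z |D Z. Z \<in> \<Z> \<and> D \<in> G Z} \<le> R"
    and Y: "\<And>D. card {\<rho> D Z |Z. Z \<in> \<Z> \<and> D \<in> G Z} \<le> Y" "1 \<le> Y"
    and \<epsilon>: "0 < \<epsilon>" "\<epsilon> \<le> 1" and s: "0 < s"
    and small: "(1/16) ^ h + R * (1 / (16 * real s)) ^ h \<le> \<epsilon> / 2"
  shows "\<exists>W \<Z>'. W \<subseteq> U \<and> \<Z>' \<subseteq> \<Z> \<and> (\<forall>Z\<in>\<Z>'. Z ` J \<inter> W = {}) \<and> card U / 64 \<le> card W \<and>
           (\<epsilon> / (2 * Y)) ^ s * card \<Z> \<le> card \<Z>'"
proof -
  \<comment> \<open>The gains of \<open>s\<close> rounds add up to the fraction \<open>1/64\<close>,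
    and \<open>4 * \<theta>\<close> is the base \<open>1 / (16 * s)\<close> in
    \<open>small\<close>.\<close>
  define \<theta> where "\<theta> = 1 / (64 * real s)"
  have fin\<Z>: "finite \<Z>" using \<Z> fin by (meson finite_PiE finite_subset)
  have finD: "finite (I \<rightarrow>\<^sub>E U)" using fin by (simp add: finite_PiE)
  have finG: "finite (G Z)" if "Z \<in> \<Z>" for Z using G[OF that] finD finite_subset by blast
  define Rs where "Rs = {\<rho> D Z |D Z. Z \<in> \<Z> \<and> D \<in> G Z}"
  have "Rs = (\<lambda>(Z, D). \<rho> D Z) ` (SIGMA Z:\<Z>. G Z)" by (force simp: Rs_def)
  then have finRs: "finite Rs" using fin\<Z> finG by simp
  \<comment> \<open>By \<open>cross\<close>, a \<open>Z\<close> that has some pair labelled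
    \<open>r\<close> avoids all of \<open>V r\<close> and not only its own \<open>D\<close>; this
    makes \<open>W\<close> grow.\<close>
  define V where "V = (\<lambda>r. \<Union>{D ` I |D. \<exists>Z\<in>\<Z>. D \<in> G Z \<and> \<rho> D Z = r})"
  have VU: "V r \<subseteq> U" for r unfolding V_def using G by (blast dest: PiE_mem)
  \<comment> \<open>If \<open>D\<close> is not bad and occurs with label \<open>r\<close>, all its
    \<open>2 * h\<close> values lie in \<open>V r\<close>, but fewer than \<open>h\<close> in
    \<open>W\<close>. The remaining ones lie in \<open>V r - W\<close>, which therefore cannot be
    thin.\<close>
  define Bad where "Bad = (\<lambda>W. {D \<in> I \<rightarrow>\<^sub>E U. h \<le> card {i \<in> I. D i \<in> W}} \<union>
    (\<Union>r \<in> {r \<in> Rs. card (V r - W) < \<theta> * card U}. {D \<in> I \<rightarrow>\<^sub>E U. h \<le> card {i \<in> I. D i \<in> V r - W}}))"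
  \<comment> \<open>The factor \<open>4 * x\<close> explains both bases in \<open>small\<close>:
    \<open>W\<close> has density below \<open>1/64\<close>, and each thin set has density below
    \<open>\<theta>\<close>.\<close>
  have c: "(4::real) ^ h * (x * real (card U)) ^ h * real (card U) ^ h = (4 * x) ^ h * real (card U) ^ (2 * h)" for x
    by (simp add: power_mult_distrib power_mult power2_eq_square)
  have badle: "card (Bad W) \<le> \<epsilon> / 2 * card U ^ (2 * h)" if W: "W \<subseteq> U" "card W < card U / 64" for W
  proof -
    have 1: "real (card {D \<in> I \<rightarrow>\<^sub>E U. h \<le> card {i \<in> I. D i \<in> X}}) \<le> (4 * x) ^ h * card U ^ (2 * h)"
      if "X \<subseteq> U" "card X \<le> x * card U" for X and x :: real
    proof -
      have "real (card {D \<in> I \<rightarrow>\<^sub>E U. h \<le> card {i \<in> I. D i \<in> X}}) \<le> real (4 ^ h * card X ^ h * card U ^ h)"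
        using card_functions_hitting[OF fin(2,1) that(1) I] by linarith
      also have "\<dots> \<le> 4 ^ h * (x * card U) ^ h * card U ^ h"
        using that by (auto intro!: mult_right_mono mult_left_mono power_mono)
      also have "\<dots> = (4 * x) ^ h * card U ^ (2 * h)" using c[of x] by simp
      finally show ?thesis .
    qed
    define Rs' where "Rs' = {r \<in> Rs. card (V r - W) < \<theta> * card U}"
    define hit where "hit = (\<lambda>X. {D \<in> I \<rightarrow>\<^sub>E U. h \<le> card {i \<in> I. D i \<in> X}})"
    have "card (Bad W) \<le> card (hit W) + card (\<Union>r \<in> Rs'. hit (V r - W))"
      unfolding Bad_def hit_def Rs'_def by (rule card_Un_le)
    also have "card (\<Union>r \<in> Rs'. hit (V r - W)) \<le> (\<Sum>r \<in> Rs'. card (hit (V r - W)))"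
      using finRs by (intro card_UN_le) (simp add: Rs'_def)
    finally have "real (card (Bad W)) \<le> card (hit W) + (\<Sum>r \<in> Rs'. real (card (hit (V r - W))))"
      by (simp only: of_nat_sum[symmetric] of_nat_add[symmetric] of_nat_le_iff)
    also have "(\<Sum>r \<in> Rs'. real (card (hit (V r - W)))) \<le> (\<Sum>r \<in> Rs'. (4 * \<theta>) ^ h * card U ^ (2 * h))"
      using VU unfolding hit_def Rs'_def by (intro sum_mono 1) (auto dest: less_imp_le)
    also have "(\<Sum>r \<in> Rs'. (4 * \<theta>) ^ h * card U ^ (2 * h)) \<le> R * ((4 * \<theta>) ^ h * card U ^ (2 * h))"
    proof -
      have "card Rs' \<le> card Rs" using finRs by (intro card_mono) (auto simp: Rs'_def)
      then have "real (card Rs') \<le> R" using R Rs_def by simp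
      then show ?thesis by (simp add: \<theta>_def mult_right_mono)
    qed
    also have "real (card (hit W)) \<le> (4 * (1/64)) ^ h * card U ^ (2 * h)"
      unfolding hit_def using W by (intro 1) auto
    finally have "real (card (Bad W)) \<le> ((1/16) ^ h + R * (1 / (16 * real s)) ^ h) * card U ^ (2 * h)"
      by (simp add: \<theta>_def algebra_simps)
    also have "\<dots> \<le> \<epsilon> / 2 * card U ^ (2 * h)" using small by (intro mult_right_mono) auto
    finally show ?thesis .
  qed
  have finBad: "finite (Bad W)" for W using finD by (rule finite_subset[rotated]) (auto simp: Bad_def)
  \<comment> \<open>After \<open>t\<close> rounds \<open>W\<close> has reached
    \<open>t * \<theta>\<close>, or else it has already met the target and is left unchanged from
    then on.\<close>
  have step: "\<exists>W \<Z>'. W \<subseteq> U \<and> \<Z>' \<subseteq> \<Z> \<and> (\<forall>Z\<in>\<Z>'. Z ` J \<inter> W = {}) \<and>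
      (card U / 64 \<le> card W \<or> t * \<theta> * card U \<le> card W) \<and>
      (\<epsilon> / (2 * Y)) ^ t * card \<Z> \<le> card \<Z>'" for t
  proof (induction t)
    case 0
    show ?case by (intro exI[of _ "{}"] exI[of _ \<Z>]) auto
  next
    case (Suc t)
    from Suc.IH obtain W \<Z>' where W: "W \<subseteq> U" "\<Z>' \<subseteq> \<Z>" "\<forall>Z\<in>\<Z>'. Z ` J \<inter> W = {}"
      "card U / 64 \<le> card W \<or> t * \<theta> * card U \<le> card W" "(\<epsilon> / (2 * Y)) ^ t * card \<Z> \<le> card \<Z>'"
      by (elim exE conjE) (rule that)
    have finW: "finite W" using W fin finite_subset by blast
    have fin\<Z>': "finite \<Z>'" using W fin\<Z> finite_subset by blast
    have fac: "\<epsilon> / (2 * Y) \<le> 1" "0 < \<epsilon> / (2 * Y)" using \<epsilon> Y by auto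
    consider "card U / 64 \<le> card W" | "\<Z>' = {}" "card W < card U / 64" | "\<Z>' \<noteq> {}" "card W < card U / 64" by linarith
    then show ?case
    proof cases
      case 1
      have "(\<epsilon> / (2 * Y)) ^ Suc t * card \<Z> \<le> (\<epsilon> / (2 * Y)) ^ t * card \<Z>"
        using fac by (intro mult_right_mono power_decreasing) auto
      with W 1 show ?thesis by (intro exI[of _ W] exI[of _ \<Z>']) linarith
    next
      \<comment> \<open>Without survivors the lower bound on their number forces \<open>\<Z>\<close>
        to be empty, so \<open>W = U\<close> qualifies vacuously.\<close>
      case 2
      then have "(\<epsilon> / (2 * Y)) ^ t * card \<Z> \<le> 0" using W by simp
      moreover have "0 < (\<epsilon> / (2 * Y)) ^ t" using fac by (intro zero_less_power) auto
      ultimately have "card \<Z> = 0" by (simp add: mult_le_0_iff)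
      then show ?thesis by (intro exI[of _ U] exI[of _ "{}"]) auto
    next
      case 3
      have ne: "I \<rightarrow>\<^sub>E U \<noteq> {}" using U by (auto simp: PiE_eq_empty_iff)
      \<comment> \<open>Removing the bad \<open>D\<close> costs each surviving \<open>Z\<close> at
        most half of its guaranteed share \<open>\<epsilon>\<close>.\<close>
      have "\<epsilon> / 2 * card (I \<rightarrow>\<^sub>E U) \<le> card {D \<in> I \<rightarrow>\<^sub>E U. D \<in> G Z - Bad W}" if Z: "Z \<in> \<Z>'" for Z
      proof -
        have ZZ: "Z \<in> \<Z>" using Z W by auto
        have "card (G Z) - card (Bad W) \<le> card (G Z - Bad W)"
          using finBad by (rule diff_card_le_card_Diff)
        moreover have "{D \<in> I \<rightarrow>\<^sub>E U. D \<in> G Z - Bad W} = G Z - Bad W" using G[OF ZZ] by auto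
        moreover have "card (I \<rightarrow>\<^sub>E U) = card U ^ (2 * h)" using fin I by (simp add: card_PiE)
        ultimately show ?thesis using big[OF ZZ] badle[OF W(1) 3(2)] by simp
      qed
      then obtain D where D: "\<epsilon> / 2 * card \<Z>' \<le> card {Z \<in> \<Z>'. D \<in> G Z - Bad W}"
        by (rule exists_heavy_column[OF finD fin\<Z>' 3(1) ne])
      define A where "A = {Z \<in> \<Z>'. D \<in> G Z - Bad W}"
      have "0 < \<epsilon> / 2 * card \<Z>'" using 3 \<epsilon> fin\<Z>' by (simp add: card_gt_0_iff)
      then have "0 < real (card A)" using D by (simp add: A_def)
      then have A0: "A \<noteq> {}" "finite A" by (auto simp: card_gt_0_iff)
      \<comment> \<open>Once \<open>D\<close> is fixed at most \<open>Y\<close> labels are possible,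
        so keeping the \<open>Z\<close> with the most frequent label costs \<open>1 / Y\<close>
        instead of \<open>1 / R\<close>.\<close>
      have "finite {\<rho> D Z |Z. Z \<in> \<Z> \<and> D \<in> G Z}" using fin\<Z> by simp
      moreover have "\<rho> D ` A \<subseteq> {\<rho> D Z |Z. Z \<in> \<Z> \<and> D \<in> G Z}" using W by (auto simp: A_def)
      ultimately have "card (\<rho> D ` A) \<le> card {\<rho> D Z |Z. Z \<in> \<Z> \<and> D \<in> G Z}" by (rule card_mono)
      then have "card (\<rho> D ` A) \<le> Y" using Y(1)[of D] by linarith
      from pigeonhole_fibre[OF A0(2) _ this A0(1)] A0(2)
      obtain r where r: "r \<in> \<rho> D ` A" "card A / Y \<le> card {Z \<in> A. \<rho> D Z = r}" by auto
      define \<Z>'' where "\<Z>'' = {Z \<in> A. \<rho> D Z = r}"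
      obtain Z0 where Z0: "Z0 \<in> A" "\<rho> D Z0 = r" using r by auto
      have Z0': "Z0 \<in> \<Z>" "D \<in> G Z0" "D \<notin> Bad W" using Z0 W by (auto simp: A_def)
      have DU: "D \<in> I \<rightarrow>\<^sub>E U" using G Z0' by blast
      have rRs: "r \<in> Rs" using Z0 Z0' by (auto simp: Rs_def)
      have DV: "D ` I \<subseteq> V r" using Z0 Z0' by (auto simp: V_def)
      have Vbig: "\<theta> * card U \<le> card (V r - W)"
      proof (rule ccontr)
        assume "\<not> ?thesis"
        then have "r \<in> {r \<in> Rs. card (V r - W) < \<theta> * card U}" using rRs by simp
        then have "\<not> h \<le> card {i \<in> I. D i \<in> V r - W}" "\<not> h \<le> card {i \<in> I. D i \<in> W}"
          using Z0'(3) DU unfolding Bad_def by blast+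
        moreover have "I = {i \<in> I. D i \<in> V r - W} \<union> {i \<in> I. D i \<in> W}" using DV by auto
        then have "card I \<le> card {i \<in> I. D i \<in> V r - W} + card {i \<in> I. D i \<in> W}"
          by (metis card_Un_le)
        ultimately show False using I by linarith
      qed
      have avoid: "Z ` J \<inter> V r = {}" if "Z \<in> \<Z>''" for Z
      proof -
        have "Z \<in> \<Z>" "D \<in> G Z" "\<rho> D Z = r" using that W by (auto simp: \<Z>''_def A_def)
        then show ?thesis using cross[of Z _ D] unfolding V_def by blast
      qed
      have "card (W \<union> V r) = card W + card (V r - W)"
        using finW finite_subset[OF VU fin(1), of r] by (subst Un_Diff_cancel[symmetric], subst card_Un_disjoint) auto
      then have grow: "card U / 64 \<le> card (W \<union> V r) \<or> Suc t * \<theta> * card U \<le> card (W \<union> V r)"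
        using W(4) Vbig by (auto simp: algebra_simps)
      have "(\<epsilon> / (2 * Y)) ^ Suc t * card \<Z> \<le> \<epsilon> / (2 * Y) * card \<Z>'"
        using W(5) fac by (simp add: mult.assoc mult_left_mono del: times_divide_eq_left)
      also have "\<dots> \<le> card A / Y" using D Y(2) by (simp add: A_def field_simps)
      also have "\<dots> \<le> card \<Z>''" using r by (simp add: \<Z>''_def)
      finally have "(\<epsilon> / (2 * Y)) ^ Suc t * card \<Z> \<le> card \<Z>''" .
      moreover have sub: "\<Z>'' \<subseteq> \<Z>'" by (auto simp: \<Z>''_def A_def)
      then have "\<Z>'' \<subseteq> \<Z>" using W(2) by blast
      moreover have "\<forall>Z\<in>\<Z>''. Z ` J \<inter> (W \<union> V r) = {}" using sub W(3) avoid by blast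
      ultimately show ?thesis
        using grow W(1) VU[of r] by (intro exI[of _ "W \<union> V r"] exI[of _ \<Z>'']) auto
    qed
  qed
  have "s * \<theta> = 1 / 64" using s by (simp add: \<theta>_def)
  then have "s * \<theta> * card U = card U / 64" by simp
  with step[of s] show ?thesis by auto
qed

text \<open>Popular values of \<open>q\<close> and \<open>\<gamma>\<close> are fixed first;
  \<open>\<gamma>\<close> takes the value of \<open>q\<close> as an argument because the addresses
  decide which contents are recorded. The growth lemma then leaves many \<open>Z\<close> that avoid
  \<open>W\<close>, whereas only a fraction \<open>(63/64) ^ card J\<close> of all \<open>Z\<close>
  can do so. The large number \<open>C\<close> is paid once, while \<open>X\<close> and
  \<open>Y\<close> are paid in each of the \<open>s\<close> rounds.\<close>

lemma transcript_labels_contradiction: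
  fixes U :: "'u set" and I :: "'i set" and J :: "'j set" and R X Y C :: real
    and q :: "('i \<Rightarrow> 'u) \<Rightarrow> ('j \<Rightarrow> 'u) \<Rightarrow> 'q" and \<rho> :: "('i \<Rightarrow> 'u) \<Rightarrow> ('j \<Rightarrow> 'u) \<Rightarrow> 'r"
    and \<gamma> :: "'q \<Rightarrow> ('j \<Rightarrow> 'u) \<Rightarrow> 'c"
  assumes fin: "finite U" "finite I" "finite J" and U: "U \<noteq> {}" and I: "card I = 2 * h"
    and G: "G \<subseteq> (I \<rightarrow>\<^sub>E U) \<times> (J \<rightarrow>\<^sub>E U)"
    and big: "real (card U) ^ (2 * h) * real (card U) ^ card J / 4 \<le> card G"
    and X: "card {q D Z |D Z. (D, Z) \<in> G} \<le> X" "1 \<le> X"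
    and C: "\<And>q0. card (\<gamma> q0 ` {Z. \<exists>D. (D, Z) \<in> G \<and> q D Z = q0}) \<le> C" "1 \<le> C"
    and R: "card {\<rho> D Z |D Z. (D, Z) \<in> G} \<le> R"
    and Y: "\<And>D q0 c0. card {\<rho> D Z |Z. (D, Z) \<in> G \<and> q D Z = q0 \<and> \<gamma> q0 Z = c0} \<le> Y" "1 \<le> Y"
    and cross: "\<And>D Z D' Z'. (D, Z) \<in> G \<Longrightarrow> (D', Z') \<in> G \<Longrightarrow> q D Z = q D' Z' \<Longrightarrow>
       \<gamma> (q D Z) Z = \<gamma> (q D Z) Z' \<Longrightarrow> \<rho> D Z = \<rho> D' Z' \<Longrightarrow> D' ` I \<inter> Z ` J = {}"
    and s: "0 < s"
    and small: "(1/16) ^ h + R * (1 / (16 * real s)) ^ h \<le> 1 / (16 * X)"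
    and final: "(63/64) ^ card J < 1 / (8 * X * C) * (1 / (16 * X * Y)) ^ s"
  shows False
proof -
  define u where "u = real (card U)"
  \<comment> \<open>\<open>G\<close> has density at least \<open>1/4\<close>, and the fibre of a
    popular \<open>q0\<close> at least \<open>1 / (4 * X)\<close>; half of this is given up for the
    \<open>Z\<close> with few partners.\<close>
  define \<epsilon> where "\<epsilon> = 1 / (8 * X)"
  have u: "0 < u" using fin U by (simp add: u_def card_gt_0_iff)
  have \<epsilon>: "0 < \<epsilon>" "\<epsilon> \<le> 1" using X by (auto simp: \<epsilon>_def)
  have finI: "finite (I \<rightarrow>\<^sub>E U)" and finJ: "finite (J \<rightarrow>\<^sub>E U)" using fin by (auto intro: finite_PiE)
  have finG: "finite G" using G finI finJ by (meson finite_SigmaI finite_subset)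
  have cI: "card (I \<rightarrow>\<^sub>E U) = u ^ (2 * h)" and cJ: "card (J \<rightarrow>\<^sub>E U) = u ^ card J"
    using fin I by (auto simp: card_PiE u_def)
  have "0 < real (card G)" using big u by (smt (verit) divide_pos_pos mult_pos_pos u_def zero_less_power)
  then have Gne: "G \<noteq> {}" by auto
  have "(\<lambda>(D, Z). q D Z) ` G = {q D Z |D Z. (D, Z) \<in> G}" by auto
  with X have "card ((\<lambda>(D, Z). q D Z) ` G) \<le> X" by simp
  from pigeonhole_fibre[OF finG _ this Gne] finG
  obtain q0 where q0: "card G / X \<le> card {p \<in> G. (\<lambda>(D, Z). q D Z) p = q0}" by auto
  define G1 where "G1 = (\<lambda>Z. {D. (D, Z) \<in> G \<and> q D Z = q0})"
  have G1sub: "G1 Z \<subseteq> I \<rightarrow>\<^sub>E U" for Z using G by (auto simp: G1_def)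
  have finG1: "finite (G1 Z)" for Z using G1sub finI finite_subset by blast
  define \<Z>0 where "\<Z>0 = {Z \<in> J \<rightarrow>\<^sub>E U. \<epsilon> * u ^ (2 * h) \<le> card (G1 Z)}"
  have fin\<Z>0: "finite \<Z>0" using finJ by (simp add: \<Z>0_def)
  have "bij_betw prod.swap (SIGMA Z:(J \<rightarrow>\<^sub>E U). G1 Z) {p \<in> G. (\<lambda>(D, Z). q D Z) p = q0}"
    using G by (intro bij_betwI[where g = prod.swap]) (auto simp: G1_def)
  then have "card {p \<in> G. (\<lambda>(D, Z). q D Z) p = q0} = (\<Sum>Z\<in>J \<rightarrow>\<^sub>E U. card (G1 Z))"
    using finJ finG1 by (simp add: bij_betw_same_card[symmetric])
  \<comment> \<open>A fibre over \<open>Z\<close> has at most \<open>u ^ (2 * h)\<close> elements if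
    \<open>Z\<close> is in \<open>\<Z>0\<close>, and fewer than
    \<open>\<epsilon> * u ^ (2 * h)\<close> otherwise.\<close>
  also have "real \<dots> \<le> (\<Sum>Z\<in>J \<rightarrow>\<^sub>E U. (if Z \<in> \<Z>0 then u ^ (2 * h) else 0) + \<epsilon> * u ^ (2 * h))"
  proof (subst of_nat_sum, rule sum_mono)
    fix Z assume "Z \<in> J \<rightarrow>\<^sub>E U"
    moreover have "real (card (G1 Z)) \<le> u ^ (2 * h)"
      using card_mono[OF finI G1sub, of Z] cI by (metis of_nat_le_iff)
    moreover have "0 \<le> \<epsilon> * u ^ (2 * h)" using \<epsilon> u by simp
    ultimately show "real (card (G1 Z)) \<le> (if Z \<in> \<Z>0 then u ^ (2 * h) else 0) + \<epsilon> * u ^ (2 * h)"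
      by (auto simp: \<Z>0_def)
  qed
  also have "\<dots> = card \<Z>0 * u ^ (2 * h) + \<epsilon> * u ^ (2 * h) * u ^ card J"
    using finJ by (simp add: sum.distrib sum.If_cases cJ \<Z>0_def Int_def)
  finally have "card G / X \<le> card \<Z>0 * u ^ (2 * h) + \<epsilon> * u ^ (2 * h) * u ^ card J" using q0 by linarith
  moreover have "u ^ (2 * h) * u ^ card J / 4 / X \<le> card G / X"
    using big X by (intro divide_right_mono) (auto simp: u_def)
  moreover have "u ^ (2 * h) * u ^ card J / 4 / X = 2 * \<epsilon> * u ^ card J * u ^ (2 * h)" by (simp add: \<epsilon>_def)
  ultimately have "\<epsilon> * u ^ card J * u ^ (2 * h) \<le> card \<Z>0 * u ^ (2 * h)" by (simp add: mult_ac)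
  then have \<Z>0: "\<epsilon> * u ^ card J \<le> card \<Z>0" using u by simp
  moreover have "0 < \<epsilon> * u ^ card J" using \<epsilon> u by simp
  ultimately have \<Z>0ne: "\<Z>0 \<noteq> {}" by auto
  have G1ne: "G1 Z \<noteq> {}" if "Z \<in> \<Z>0" for Z
  proof -
    have "0 < \<epsilon> * u ^ (2 * h)" using \<epsilon> u by simp
    then show ?thesis using that by (auto simp: \<Z>0_def)
  qed
  have "\<gamma> q0 ` \<Z>0 \<subseteq> \<gamma> q0 ` {Z. \<exists>D. (D, Z) \<in> G \<and> q D Z = q0}"
    using G1ne by (fastforce simp: G1_def)
  moreover have "finite {Z. \<exists>D. (D, Z) \<in> G \<and> q D Z = q0}"
    using G by (intro finite_subset[OF _ finJ]) auto
  ultimately have "card (\<gamma> q0 ` \<Z>0) \<le> card (\<gamma> q0 ` {Z. \<exists>D. (D, Z) \<in> G \<and> q D Z = q0})"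
    by (intro card_mono finite_imageI)
  then have "card (\<gamma> q0 ` \<Z>0) \<le> C" using C(1)[of q0] by linarith
  from pigeonhole_fibre[OF fin\<Z>0 _ this \<Z>0ne] fin\<Z>0
  obtain c0 where c0: "card \<Z>0 / C \<le> card {Z \<in> \<Z>0. \<gamma> q0 Z = c0}" by auto
  define \<Z> where "\<Z> = {Z \<in> \<Z>0. \<gamma> q0 Z = c0}"
  have \<Z>big: "\<epsilon> * u ^ card J / C \<le> card \<Z>"
    using \<Z>0 c0 C(2) by (smt (verit) \<Z>_def divide_right_mono)
  have "\<exists>W \<Z>'. W \<subseteq> U \<and> \<Z>' \<subseteq> \<Z> \<and> (\<forall>Z\<in>\<Z>'. Z ` J \<inter> W = {}) \<and> card U / 64 \<le> card W \<and>
           (\<epsilon> / (2 * Y)) ^ s * card \<Z> \<le> card \<Z>'"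
  proof (rule avoided_set_growth[where G = G1 and \<rho> = \<rho> and R = R and \<epsilon> = \<epsilon> and Y = Y and s = s, OF fin U I _ G1sub])
    show "\<Z> \<subseteq> J \<rightarrow>\<^sub>E U" by (auto simp: \<Z>_def \<Z>0_def)
    show "\<epsilon> * card U ^ (2 * h) \<le> card (G1 Z)" if "Z \<in> \<Z>" for Z
      using that by (simp add: \<Z>_def \<Z>0_def u_def)
    show "D' ` I \<inter> Z ` J = {}"
      if "Z \<in> \<Z>" "Z' \<in> \<Z>" "D \<in> G1 Z" "D' \<in> G1 Z'" "\<rho> D Z = \<rho> D' Z'" for Z Z' D D'
      using that by (intro cross[of D Z D' Z']) (auto simp: \<Z>_def G1_def)
    have "{\<rho> D Z |D Z. (D, Z) \<in> G} = (\<lambda>(D, Z). \<rho> D Z) ` G" by auto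
    then have "finite {\<rho> D Z |D Z. (D, Z) \<in> G}" using finG by simp
    moreover have "{\<rho> D Z |D Z. Z \<in> \<Z> \<and> D \<in> G1 Z} \<subseteq> {\<rho> D Z |D Z. (D, Z) \<in> G}"
      by (auto simp: G1_def)
    ultimately have "card {\<rho> D Z |D Z. Z \<in> \<Z> \<and> D \<in> G1 Z} \<le> card {\<rho> D Z |D Z. (D, Z) \<in> G}"
      by (rule card_mono)
    then show "card {\<rho> D Z |D Z. Z \<in> \<Z> \<and> D \<in> G1 Z} \<le> R" using R by linarith
    show "card {\<rho> D Z |Z. Z \<in> \<Z> \<and> D \<in> G1 Z} \<le> Y" for D
    proof -
      have "finite {Z. (D, Z) \<in> G \<and> q D Z = q0 \<and> \<gamma> q0 Z = c0}"
        using G by (intro finite_subset[OF _ finJ]) auto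
      then have "finite {\<rho> D Z |Z. (D, Z) \<in> G \<and> q D Z = q0 \<and> \<gamma> q0 Z = c0}" by simp
      moreover have "{\<rho> D Z |Z. Z \<in> \<Z> \<and> D \<in> G1 Z} \<subseteq> {\<rho> D Z |Z. (D, Z) \<in> G \<and> q D Z = q0 \<and> \<gamma> q0 Z = c0}"
        by (auto simp: G1_def \<Z>_def)
      ultimately have "card {\<rho> D Z |Z. Z \<in> \<Z> \<and> D \<in> G1 Z} \<le> card {\<rho> D Z |Z. (D, Z) \<in> G \<and> q D Z = q0 \<and> \<gamma> q0 Z = c0}"
        by (rule card_mono)
      then show ?thesis using Y(1)[of D q0 c0] by linarith
    qed
    show "(1/16) ^ h + R * (1 / (16 * real s)) ^ h \<le> \<epsilon> / 2" using small by (simp add: \<epsilon>_def)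
  qed (use Y(2) \<epsilon> s in auto)
  then obtain W \<Z>' where W: "W \<subseteq> U" "\<Z>' \<subseteq> \<Z>" "\<forall>Z\<in>\<Z>'. Z ` J \<inter> W = {}" "card U / 64 \<le> card W"
      "(\<epsilon> / (2 * Y)) ^ s * card \<Z> \<le> card \<Z>'" by (elim exE conjE) (rule that)
  have "\<Z>' \<subseteq> J \<rightarrow>\<^sub>E (U - W)"
  proof
    fix Z assume Z: "Z \<in> \<Z>'"
    then have "Z \<in> J \<rightarrow>\<^sub>E U" using W(2) by (auto simp: \<Z>_def \<Z>0_def)
    moreover have "Z ` J \<inter> W = {}" using Z W(3) by blast
    ultimately show "Z \<in> J \<rightarrow>\<^sub>E (U - W)" by (auto simp: PiE_iff disjoint_iff)
  qed
  then have "card \<Z>' \<le> card (J \<rightarrow>\<^sub>E (U - W))" using fin by (intro card_mono finite_PiE) auto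
  also have "\<dots> = card (U - W) ^ card J" using fin by (simp add: card_PiE)
  finally have "real (card \<Z>') \<le> real (card (U - W)) ^ card J" by (metis of_nat_le_iff of_nat_power)
  also have "real (card (U - W)) \<le> 63 / 64 * u"
    using W(1,4) fin by (simp add: u_def card_Diff_subset finite_subset card_mono of_nat_diff)
  then have "real (card (U - W)) ^ card J \<le> (63 / 64 * u) ^ card J" by (intro power_mono) auto
  also have "(63 / 64 * u) ^ card J = (63 / 64) ^ card J * u ^ card J" by (rule power_mult_distrib)
  finally have up: "real (card \<Z>') \<le> (63 / 64) ^ card J * u ^ card J" .
  have "1 / (8 * X * C) * (1 / (16 * X * Y)) ^ s * u ^ card J = (\<epsilon> / (2 * Y)) ^ s * (\<epsilon> * u ^ card J / C)"
    by (simp add: \<epsilon>_def mult_ac)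
  also have "\<dots> \<le> (\<epsilon> / (2 * Y)) ^ s * card \<Z>" using \<Z>big \<epsilon> Y(2) by (intro mult_left_mono) auto
  finally have "1 / (8 * X * C) * (1 / (16 * X * Y)) ^ s * u ^ card J \<le> (63 / 64) ^ card J * u ^ card J"
    using W(5) up by linarith
  moreover have "(63/64) ^ card J * u ^ card J < 1 / (8 * X * C) * (1 / (16 * X * Y)) ^ s * u ^ card J"
    using final u by (intro mult_strict_right_mono) auto
  ultimately show False by linarith
qed

section \<open>Traces of runs\<close>

type_synonym event = "nat \<times> bool \<times> nat \<times> bool list"
  \<comment> \<open>index of the request, is it a write?, address, block read or written\<close>

text \<open>Refines \<open>op_run\<close> by logging the I/Os. The tag with the index of the request
  later attributes each I/O to nodes of the tree.\<close>

inductive op_trace ::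
  "machine \<Rightarrow> nat \<Rightarrow> request \<Rightarrow> nat \<Rightarrow> config \<Rightarrow> answer \<Rightarrow> config \<Rightarrow> event list \<Rightarrow> bool"
  for A i q where
  trace_return: "control A i j q m = Return ans m' \<Longrightarrow> op_trace A i q j (m, D) ans (m', D) []"
| trace_read: "control A i j q m = Read a f \<Longrightarrow> op_trace A i q (Suc j) (f (D a), D) ans s' es
    \<Longrightarrow> op_trace A i q j (m, D) ans s' ((i, False, a, D a) # es)"
| trace_write: "control A i j q m = Write a b m' \<Longrightarrow> op_trace A i q (Suc j) (m', D(a := b)) ans s' es
    \<Longrightarrow> op_trace A i q j (m, D) ans s' ((i, True, a, b) # es)"

inductive seq_trace ::
  "machine \<Rightarrow> nat \<Rightarrow> config \<Rightarrow> request list \<Rightarrow> answer list \<Rightarrow> config \<Rightarrow> event list \<Rightarrow> bool"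
  for A where
  trace_Nil: "seq_trace A i s [] [] s []"
| trace_Cons: "op_trace A i q 0 s ans s' es \<Longrightarrow> seq_trace A (Suc i) s' qs as s'' es'
    \<Longrightarrow> seq_trace A i s (q # qs) (ans # as) s'' (es @ es')"

inductive_cases seq_trace_NilE: "seq_trace A i s [] as s' es"
inductive_cases seq_trace_ConsE: "seq_trace A i s (q # qs) as s' es"

lemma op_run_imp_op_trace:
  "op_run A i q j s ans s' c \<Longrightarrow> \<exists>es. op_trace A i q j s ans s' es \<and> length es = c"
  by (induction rule: op_run.induct) (force intro: op_trace.intros)+

lemma seq_run_imp_seq_trace:
  "seq_run A i s qs as c \<Longrightarrow> \<exists>s' es. seq_trace A i s qs as s' es \<and> length es = c"
proof (induction rule: seq_run.induct)
  case (seq_Nil i s)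
  show ?case using trace_Nil[of A i s] by fastforce
next
  case (seq_Cons i q s ans s' c qs as c')
  then obtain es where "op_trace A i q 0 s ans s' es" "length es = c"
    using op_run_imp_op_trace by blast
  with seq_Cons.IH show ?case using trace_Cons by (metis length_append)
qed

lemma op_trace_imp_op_run: "op_trace A i q j s ans s' es \<Longrightarrow> op_run A i q j s ans s' (length es)"
  by (induction rule: op_trace.induct) (auto intro: op_run.intros)

lemma seq_trace_imp_seq_run: "seq_trace A i s qs as s' es \<Longrightarrow> seq_run A i s qs as (length es)"
  by (induction rule: seq_trace.induct) (auto intro: seq_run.intros dest: op_trace_imp_op_run)

lemma op_trace_deterministic:
  "op_trace A i q j s ans s' es \<Longrightarrow> op_trace A i q j s ans2 s2 es2 \<Longrightarrow> ans2 = ans \<and> s2 = s' \<and> es2 = es"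
proof (induction arbitrary: es2 rule: op_trace.induct)
  case trace_return
  from trace_return.prems trace_return.hyps show ?case by (cases rule: op_trace.cases) auto
next
  case trace_read
  from trace_read.prems trace_read.hyps trace_read.IH show ?case by (cases rule: op_trace.cases) auto
next
  case trace_write
  from trace_write.prems trace_write.hyps trace_write.IH show ?case by (cases rule: op_trace.cases) auto
qed

lemma seq_trace_deterministic:
  "seq_trace A i s qs as s' es \<Longrightarrow> seq_trace A i s qs as2 s2 es2 \<Longrightarrow> as2 = as \<and> s2 = s' \<and> es2 = es"
proof (induction arbitrary: as2 es2 rule: seq_trace.induct)
  case trace_Nil
  then show ?case by (auto elim: seq_trace_NilE)
next
  case (trace_Cons i q s ans s' es qs as s'' es')
  from trace_Cons.prems obtain ans3 s3 es3 as3 es3' where 1: "as2 = ans3 # as3" "es2 = es3 @ es3'"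
    "op_trace A i q 0 s ans3 s3 es3" "seq_trace A (Suc i) s3 qs as3 s2 es3'"
    by (rule seq_trace_ConsE)
  have "ans3 = ans \<and> s3 = s' \<and> es3 = es" using op_trace_deterministic[OF trace_Cons.hyps(1) 1(3)] .
  moreover from this 1(4) have "as3 = as \<and> s2 = s'' \<and> es3' = es'" by (intro trace_Cons.IH) simp
  ultimately show ?case using 1 by simp
qed

lemma seq_trace_appendE:
  assumes "seq_trace A i s (qs1 @ qs2) as s'' es"
  obtains as1 as2 s' es1 es2 where "as = as1 @ as2" "es = es1 @ es2" "length as1 = length qs1"
    "seq_trace A i s qs1 as1 s' es1" "seq_trace A (i + length qs1) s' qs2 as2 s'' es2"
proof -
  have "\<exists>as1 as2 s' es1 es2. as = as1 @ as2 \<and> es = es1 @ es2 \<and> length as1 = length qs1 \<and>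
    seq_trace A i s qs1 as1 s' es1 \<and> seq_trace A (i + length qs1) s' qs2 as2 s'' es2"
    using assms
  proof (induction qs1 arbitrary: i s as es)
    case Nil
    then show ?case
      by (intro exI[of _ "[]"] exI[of _ as] exI[of _ s] exI[of _ "[]"] exI[of _ es]) (simp add: trace_Nil)
  next
    case (Cons q qs1)
    from Cons.prems have "seq_trace A i s (q # (qs1 @ qs2)) as s'' es" by simp
    then obtain ans s1 es0 as0 es0' where 1: "as = ans # as0" "es = es0 @ es0'"
      "op_trace A i q 0 s ans s1 es0" "seq_trace A (Suc i) s1 (qs1 @ qs2) as0 s'' es0'"
      by (rule seq_trace_ConsE) blast
    from Cons.IH[OF 1(4)] obtain as1 as2 s' es1 es2 where 2: "as0 = as1 @ as2" "es0' = es1 @ es2"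
      "length as1 = length qs1" "seq_trace A (Suc i) s1 qs1 as1 s' es1"
      "seq_trace A (Suc i + length qs1) s' qs2 as2 s'' es2" by blast
    have "seq_trace A i s (q # qs1) (ans # as1) s' (es0 @ es1)" using 1 2 by (intro trace_Cons)
    with 1 2 show ?case
      by (intro exI[of _ "ans # as1"] exI[of _ as2] exI[of _ s'] exI[of _ "es0 @ es1"] exI[of _ es2]) auto
  qed
  then show ?thesis using that by blast
qed

section \<open>Replaying a trace on a different disk\<close>

fun apply_writes :: "event list \<Rightarrow> (nat \<Rightarrow> bool list) \<Rightarrow> nat \<Rightarrow> bool list" where
  "apply_writes [] D = D"
| "apply_writes ((k, wr, a, b) # es) D = apply_writes es (if wr then D(a := b) else D)"

fun reads_agree :: "event list \<Rightarrow> (nat \<Rightarrow> bool list) \<Rightarrow> bool" where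
  "reads_agree [] D \<longleftrightarrow> True"
| "reads_agree ((k, wr, a, b) # es) D \<longleftrightarrow>
     (if wr then reads_agree es (D(a := b)) else D a = b \<and> reads_agree es D)"

text \<open>The reads through which information leaves \<open>W\<close>: once a cell is overwritten,
  its content no longer stems from the earlier phase, so its address is dropped.\<close>

fun recorded :: "nat set \<Rightarrow> event list \<Rightarrow> (nat \<times> bool list) list" where
  "recorded W [] = []"
| "recorded W ((k, wr, a, b) # es) =
     (if wr then recorded (W - {a}) es else if a \<in> W then (a, b) # recorded W es else recorded W es)"

definition written :: "event list \<Rightarrow> nat set" where
  "written es = {a. \<exists>k b. (k, True, a, b) \<in> set es}"

definition addresses :: "event list \<Rightarrow> nat list" where
  "addresses es = map (\<lambda>(k, wr, a, b). a) es"

text \<open>Forgets the block contents. What is left still determines \<open>written\<close> and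
  \<open>addresses\<close>, but takes far fewer values.\<close>

definition shape :: "event list \<Rightarrow> (bool \<times> nat) list" where
  "shape es = map (\<lambda>(k, wr, a, b). (wr, a)) es"

lemma apply_writes_append: "apply_writes (es @ es') D = apply_writes es' (apply_writes es D)"
  by (induction es D rule: apply_writes.induct) (auto simp: fun_upd_def fun_upd_def)

lemma reads_agree_append: "reads_agree (es @ es') D \<longleftrightarrow> reads_agree es D \<and> reads_agree es' (apply_writes es D)"
  by (induction es D rule: apply_writes.induct) (auto simp: fun_upd_def fun_upd_def)

lemma apply_writes_outside: "a \<notin> written es \<Longrightarrow> apply_writes es D a = D a"
  by (induction es D rule: apply_writes.induct) (auto simp: fun_upd_def written_def)

lemma apply_writes_inside: "a \<in> written es \<Longrightarrow> apply_writes es D a = apply_writes es D' a"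
proof (induction es arbitrary: D D')
  case Nil
  then show ?case by (simp add: written_def)
next
  case (Cons e es)
  obtain k wr a' b where e: "e = (k, wr, a', b)" by (cases e)
  show ?case
  proof (cases "a \<in> written es")
    case True
    then show ?thesis using Cons.IH by (simp add: e)
  next
    case False
    then have "wr" "a' = a" using Cons.prems by (auto simp: e written_def)
    then show ?thesis using False by (simp add: e apply_writes_outside)
  qed
qed

lemma written_shape: "written es = {a. (True, a) \<in> set (shape es)}"
  by (force simp: written_def shape_def)

lemma addresses_shape: "addresses es = map snd (shape es)"
  by (auto simp: addresses_def shape_def)

lemma length_shape: "length (shape es) = length es"
  by (simp add: shape_def)

lemma reads_agree_cong:
  "reads_agree es D \<Longrightarrow> \<forall>a \<in> set (addresses es). D' a = D a \<Longrightarrow> reads_agree es D'"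
proof (induction es arbitrary: D D')
  case (Cons e es)
  obtain k wr a b where e: "e = (k, wr, a, b)" by (cases e)
  have a: "D' a = D a" and es: "\<forall>c \<in> set (addresses es). D' c = D c"
    using Cons.prems(2) by (simp_all add: e addresses_def)
  show ?case
  proof (cases wr)
    case True
    then have "reads_agree es (D(a := b))" using Cons.prems(1) by (simp add: e)
    then have "reads_agree es (D'(a := b))" by (rule Cons.IH) (use es in simp)
    with True show ?thesis by (simp add: e)
  next
    case False
    then have "D a = b" "reads_agree es D" using Cons.prems(1) by (simp_all add: e)
    then show ?thesis using False a Cons.IH[OF _ es] by (simp add: e)
  qed
qed auto

lemma recorded_subset: "(a, b) \<in> set (recorded W es) \<Longrightarrow> a \<in> W"
  by (induction W es rule: recorded.induct) (auto simp: fun_upd_def split: if_splits)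

text \<open>A read sees a cell outside \<open>W\<close>, or a block written by the trace itself, or
  a cell of \<open>W\<close> not yet overwritten; reads of the last kind are those kept by
  \<open>recorded\<close>.\<close>

lemma reads_agree_recorded:
  "reads_agree es D \<Longrightarrow> \<forall>a. a \<notin> W \<longrightarrow> D' a = D a \<Longrightarrow>
   \<forall>(a, b) \<in> set (recorded W es). D' a = b \<Longrightarrow> reads_agree es D'"
proof (induction es arbitrary: D D' W)
  case (Cons e es)
  obtain k wr a b where e: "e = (k, wr, a, b)" by (cases e)
  show ?case
  proof (cases wr)
    case True
    then have 1: "reads_agree es (D(a := b))" using Cons.prems(1) by (simp add: e)
    have 2: "\<forall>c. c \<notin> W - {a} \<longrightarrow> (D'(a := b)) c = (D(a := b)) c" using Cons.prems(2) by simp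
    have "\<forall>(c, d) \<in> set (recorded (W - {a}) es). (D'(a := b)) c = d"
    proof (clarify)
      fix c d assume cd: "(c, d) \<in> set (recorded (W - {a}) es)"
      have "D' c = d" using cd Cons.prems(3) True by (auto simp: e)
      moreover have "c \<noteq> a" using recorded_subset[OF cd] by simp
      ultimately show "(D'(a := b)) c = d" by simp
    qed
    from Cons.IH[OF 1 2 this] True show ?thesis by (simp add: e fun_upd_def)
  next
    case False
    then have 1: "D a = b" "reads_agree es D" using Cons.prems(1) by (simp_all add: e)
    have "\<forall>(c, d) \<in> set (recorded W es). D' c = d"
      using Cons.prems(3) False by (auto simp: e split: if_splits)
    from Cons.IH[OF 1(2) Cons.prems(2) this] have "reads_agree es D'" .
    moreover have "D' a = b"
      using Cons.prems(2,3) False 1 by (cases "a \<in> W") (simp_all add: e)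
    ultimately show ?thesis using False by (simp add: e)
  qed
qed auto

lemma recordedD: "reads_agree es D \<Longrightarrow> (a, b) \<in> set (recorded W es) \<Longrightarrow> a \<in> W \<and> D a = b"
proof (induction es arbitrary: D W)
  case (Cons e es)
  obtain k wr a' b' where e: "e = (k, wr, a', b')" by (cases e)
  show ?case
    using Cons.prems Cons.IH[of "D(a' := b')" "W - {a'}"] Cons.IH[of D W]
    by (auto simp: e fun_upd_def split: if_splits)
qed auto

lemma op_trace_agree:
  "op_trace A i q j s ans s' es \<Longrightarrow> reads_agree es (snd s) \<and> snd s' = apply_writes es (snd s)"
  by (induction rule: op_trace.induct) (auto simp: fun_upd_def)

lemma seq_trace_agree:
  "seq_trace A i s qs as s' es \<Longrightarrow> reads_agree es (snd s) \<and> snd s' = apply_writes es (snd s)"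
  by (induction rule: seq_trace.induct)
    (auto simp: reads_agree_append apply_writes_append dest: op_trace_agree)

text \<open>The control depends on the disk only through the blocks it reads, so agreement of the
  reads reproduces the whole run.\<close>

lemma op_trace_simulate:
  "op_trace A i q j s ans s' es \<Longrightarrow> reads_agree es D \<Longrightarrow>
   op_trace A i q j (fst s, D) ans (fst s', apply_writes es D) es"
proof (induction arbitrary: D rule: op_trace.induct)
  case (trace_return j m ans m' D')
  then show ?case by (auto intro: op_trace.intros)
next
  case (trace_read j m a f D' ans s' es)
  then have "D a = D' a" "reads_agree es D" by auto
  with trace_read have "op_trace A i q j (m, D) ans (fst s', apply_writes es D) ((i, False, a, D a) # es)"
    by (intro op_trace.trace_read) auto
  with \<open>D a = D' a\<close> show ?case by simp
next
  case (trace_write j m a b m' D' ans s' es)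
  then have "op_trace A i q j (m, D) ans (fst s', apply_writes es (D(a := b))) ((i, True, a, b) # es)"
    by (intro op_trace.trace_write) auto
  then show ?case by simp
qed

lemma seq_trace_simulate:
  "seq_trace A i s qs as s' es \<Longrightarrow> reads_agree es D \<Longrightarrow>
   seq_trace A i (fst s, D) qs as (fst s', apply_writes es D) es"
proof (induction arbitrary: D rule: seq_trace.induct)
  case (trace_Nil i s)
  then show ?case by (auto intro: seq_trace.intros)
next
  case (trace_Cons i q s ans s' es qs as s'' es')
  then have "op_trace A i q 0 (fst s, D) ans (fst s', apply_writes es D) es"
    by (intro op_trace_simulate) (auto simp: reads_agree_append)
  moreover have "seq_trace A (Suc i) (fst s', apply_writes es D) qs as (fst s'', apply_writes es' (apply_writes es D)) es'"
    using trace_Cons by (auto simp: reads_agree_append)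
  ultimately show ?case by (auto simp: apply_writes_append intro: seq_trace.trace_Cons)
qed

text \<open>
  The rectangle property: if two runs agree on what flows between a phase and the phases around it,
  then the first phase of one run can be combined with the middle phase of the other one.
\<close>

lemma seq_trace_exchange:
  assumes run: "seq_trace A i (m, D) qs as (m1, D1) es" "seq_trace A k (m1, D1) ps bs s2 fs"
    and run': "seq_trace A i (m, D') qs' as' (m1, D1') es'" "seq_trace A k (m1, D1') ps' bs' s2' fs'"
    and shape: "shape es = shape es'"
    and agree: "\<And>a. a \<in> set (addresses es) \<Longrightarrow> D a = D' a"
    and rec: "recorded (written es) fs = recorded (written es') fs'"
  shows "\<exists>D'' s''. seq_trace A i (m, D) qs' as' (m1, D'') es' \<and> seq_trace A k (m1, D'') ps bs s'' fs"
proof -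
  let ?D = "apply_writes es' D"
  have "reads_agree es' D'" using seq_trace_agree[OF run'(1)] by simp
  \<comment> \<open>Both traces touch the same addresses because they have the same shape, and there
    the disks agree.\<close>
  then have "reads_agree es' D"
    by (rule reads_agree_cong) (use agree in \<open>simp add: addresses_shape shape\<close>)
  from seq_trace_simulate[OF run'(1) this] have 1: "seq_trace A i (m, D) qs' as' (m1, ?D) es'" by simp
  have W: "written es' = written es" by (simp add: written_shape shape)
  have D1: "D1 = apply_writes es D" and D1': "D1' = apply_writes es' D'"
    using seq_trace_agree[OF run(1)] seq_trace_agree[OF run'(1)] by auto
  have "reads_agree fs ?D"
  \<comment> \<open>The new disk differs from \<open>D1\<close> only in cells written by the middle
    phase. There the recorded reads of \<open>fs\<close> are those of \<open>fs'\<close>, which saw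
    the blocks written by \<open>es'\<close>.\<close>
  proof (rule reads_agree_recorded)
    show "reads_agree fs D1" using seq_trace_agree[OF run(2)] by simp
    show "\<forall>a. a \<notin> written es \<longrightarrow> ?D a = D1 a"
      using W by (simp add: D1 apply_writes_outside)
    show "\<forall>(a, b) \<in> set (recorded (written es) fs). ?D a = b"
    proof (clarify)
      fix a b assume that: "(a, b) \<in> set (recorded (written es) fs)"
      have "a \<in> written es' \<and> D1' a = b"
        using that seq_trace_agree[OF run'(2)] by (intro recordedD) (auto simp: rec)
      then show "?D a = b" using apply_writes_inside D1' by metis
    qed
  qed
  from seq_trace_simulate[OF run(2) this] 1 show ?thesis by auto
qed

section \<open>Memory and blocks read determine the answers\<close>

definition read_blocks :: "event list \<Rightarrow> bool list list" where
  "read_blocks es = map (\<lambda>(k, wr, a, b). b) (filter (\<lambda>(k, wr, a, b). \<not> wr) es)"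

lemma read_blocks_simps:
  "read_blocks [] = []"
  "read_blocks ((k, wr, a, b) # es) = (if wr then read_blocks es else b # read_blocks es)"
  "read_blocks (es @ es') = read_blocks es @ read_blocks es'"
  by (simp_all add: read_blocks_def)

lemma length_read_blocks: "length (read_blocks es) \<le> length es"
  by (simp add: read_blocks_def)

text \<open>The tails \<open>xs\<close> and \<open>ys\<close> stand for the blocks read by later
  requests: where the blocks of this request end is part of the conclusion, because the number of
  I/Os may depend on what is read.\<close>

lemma op_trace_from_reads:
  "op_trace A i q j s ans s1 es \<Longrightarrow> op_trace A i q j s' ans' s1' es' \<Longrightarrow> fst s = fst s' \<Longrightarrow>
   read_blocks es @ xs = read_blocks es' @ ys \<Longrightarrow> ans = ans' \<and> fst s1 = fst s1' \<and> xs = ys"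
proof (induction arbitrary: s' es' rule: op_trace.induct)
  case trace_return
  from trace_return.prems trace_return.hyps show ?case
    by (cases rule: op_trace.cases) (auto simp: read_blocks_simps)
next
  case (trace_read j m a f D ans s1 es)
  from trace_read.prems(1) show ?case
    by (cases rule: op_trace.cases)
      (use trace_read.prems trace_read.hyps trace_read.IH in \<open>auto simp: read_blocks_simps\<close>)
next
  case (trace_write j m a b m' D ans s1 es)
  from trace_write.prems(1) show ?case
    by (cases rule: op_trace.cases)
      (use trace_write.prems trace_write.hyps trace_write.IH in \<open>auto simp: read_blocks_simps\<close>)
qed

lemma seq_trace_from_reads:
  "seq_trace A i s qs as s1 es \<Longrightarrow> seq_trace A i s' qs as' s1' es' \<Longrightarrow> fst s = fst s' \<Longrightarrow>
   read_blocks es = read_blocks es' \<Longrightarrow> as = as'"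
proof (induction arbitrary: s' as' es' rule: seq_trace.induct)
  case trace_Nil
  then show ?case by (auto elim: seq_trace_NilE)
next
  case (trace_Cons i q s ans s1 es qs as s'' fs)
  from trace_Cons.prems(1) obtain ans2 s2 es2 as2 fs2 where 1: "as' = ans2 # as2" "es' = es2 @ fs2"
    "op_trace A i q 0 s' ans2 s2 es2" "seq_trace A (Suc i) s2 qs as2 s1' fs2"
    by (rule seq_trace_ConsE)
  have "ans = ans2 \<and> fst s1 = fst s2 \<and> read_blocks fs = read_blocks fs2"
    using trace_Cons.prems 1 by (intro op_trace_from_reads[OF trace_Cons.hyps(1) 1(3)]) (auto simp: read_blocks_simps)
  with trace_Cons.IH[OF 1(4)] 1 show ?case by simp
qed

lemma op_trace_tags: "op_trace A i q j s ans s' es \<Longrightarrow> (k, e) \<in> set es \<Longrightarrow> k = i"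
  by (induction rule: op_trace.induct) auto

lemma seq_trace_tags:
  "seq_trace A i s qs as s' es \<Longrightarrow> (k, e) \<in> set es \<Longrightarrow> i \<le> k \<and> k < i + length qs"
  by (induction rule: seq_trace.induct) (force dest: op_trace_tags)+

definition wf_config :: "nat \<Rightarrow> nat \<Rightarrow> nat \<Rightarrow> config \<Rightarrow> bool" where
  "wf_config M B w s \<longleftrightarrow> length (fst s) = M * w \<and> (\<forall>a. length (snd s a) = B * w)"

lemma op_trace_wf:
  "op_trace A i q j s ans s' es \<Longrightarrow> wf_machine M B w A \<Longrightarrow> wf_config M B w s \<Longrightarrow>
   wf_config M B w s' \<and> (\<forall>(k, wr, a, b) \<in> set es. a < 2 ^ w \<and> length b = B * w)"
proof (induction rule: op_trace.induct)
  case (trace_return j m ans m' D)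
  then have "wf_action M B w (Return ans m')" unfolding wf_machine_def wf_config_def by (metis fst_conv)
  then show ?case using trace_return by (auto simp: wf_config_def)
next
  case (trace_read j m a f D ans s' es)
  then have "wf_action M B w (Read a f)" unfolding wf_machine_def wf_config_def by (metis fst_conv)
  then show ?case using trace_read by (auto simp: wf_config_def)
next
  case (trace_write j m a b m' D ans s' es)
  then have "wf_action M B w (Write a b m')" unfolding wf_machine_def wf_config_def by (metis fst_conv)
  then show ?case using trace_write by (auto simp: wf_config_def)
qed

lemma seq_trace_wf:
  "seq_trace A i s qs as s' es \<Longrightarrow> wf_machine M B w A \<Longrightarrow> wf_config M B w s \<Longrightarrow>
   wf_config M B w s' \<and> (\<forall>(k, wr, a, b) \<in> set es. a < 2 ^ w \<and> length b = B * w)"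
proof (induction rule: seq_trace.induct)
  case (trace_Cons i q s ans s' es qs as s'' es')
  have "wf_config M B w s' \<and> (\<forall>(k, wr, a, b) \<in> set es. a < 2 ^ w \<and> length b = B * w)"
    using op_trace_wf[OF trace_Cons.hyps(1) trace_Cons.prems] .
  with trace_Cons.IH trace_Cons.prems show ?case unfolding set_append by blast
qed auto

lemma recorded_wf:
  "(\<forall>(k, wr, a, b) \<in> set es. a < 2 ^ w \<and> length b = n) \<Longrightarrow> (a, b) \<in> set (recorded W es) \<Longrightarrow>
   a < 2 ^ w \<and> length b = n"
  by (induction W es rule: recorded.induct) (auto simp: fun_upd_def split: if_splits)

text \<open>
  Pairs of last writer and reader: such a pair determines the tree node to which the read is charged.
\<close>

fun transfers :: "(nat \<Rightarrow> nat option) \<Rightarrow> event list \<Rightarrow> (nat option \<times> nat) list" where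
  "transfers lw [] = []"
| "transfers lw ((k, wr, a, b) # es) =
     (if wr then transfers (lw(a := Some k)) es else (lw a, k) # transfers lw es)"

fun last_writers :: "(nat \<Rightarrow> nat option) \<Rightarrow> event list \<Rightarrow> nat \<Rightarrow> nat option" where
  "last_writers lw [] = lw"
| "last_writers lw ((k, wr, a, b) # es) = last_writers (if wr then lw(a := Some k) else lw) es"

lemma transfers_append: "transfers lw (es @ es') = transfers lw es @ transfers (last_writers lw es) es'"
  by (induction lw es rule: transfers.induct) (auto simp: fun_upd_def fun_upd_def)

lemma length_transfers: "length (transfers lw es) \<le> length es"
  by (induction lw es rule: transfers.induct) (auto simp: fun_upd_def fun_upd_def)

lemma transfers_tags: "(k', k) \<in> set (transfers lw es) \<Longrightarrow> \<exists>e. (k, e) \<in> set es"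
proof (induction es arbitrary: lw)
  case (Cons e es)
  obtain k0 wr a b where e: "e = (k0, wr, a, b)" by (cases e)
  show ?case
    using Cons.prems Cons.IH[of lw] Cons.IH[of "lw(a := Some k0)"] by (auto simp: e fun_upd_def split: if_splits)
qed simp

lemma last_writers_outside:
  "\<forall>(k, e) \<in> set es. k \<notin> K \<Longrightarrow> \<forall>a. lw a \<notin> Some ` K \<Longrightarrow> last_writers lw es a \<notin> Some ` K"
proof (induction es arbitrary: lw)
  case (Cons e es)
  obtain k wr a' b where e: "e = (k, wr, a', b)" by (cases e)
  have "\<forall>c. (if wr then lw(a' := Some k) else lw) c \<notin> Some ` K"
    using Cons.prems by (auto simp: e)
  with Cons.prems show ?case unfolding e last_writers.simps by (intro Cons.IH) auto
qed auto

lemma last_writers_inside: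
  "\<forall>(k, e) \<in> set es. k \<in> K \<Longrightarrow>
   last_writers lw es a \<in> Some ` K \<longleftrightarrow> a \<in> written es \<or> lw a \<in> Some ` K"
  by (induction lw es rule: last_writers.induct) (auto simp: fun_upd_def written_def)

text \<open>The set \<open>W\<close> carried by \<open>recorded\<close> remains the set of cells
  whose last writer lies in \<open>K\<close>: a write with an index outside \<open>K\<close> removes
  the cell from both.\<close>

lemma length_recorded:
  "\<forall>(k, e) \<in> set es. k \<notin> K \<Longrightarrow> W = {a. lw a \<in> Some ` K} \<Longrightarrow>
   length (recorded W es) = length (filter (\<lambda>(k', k). k' \<in> Some ` K) (transfers lw es))"
proof (induction es arbitrary: W lw)
  case (Cons e es)
  obtain k wr a b where e: "e = (k, wr, a, b)" by (cases e)
  have k: "k \<notin> K" using Cons.prems by (auto simp: e)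
  show ?case
  proof (cases wr)
    case True
    have "length (recorded (W - {a}) es) =
        length (filter (\<lambda>(k', k). k' \<in> Some ` K) (transfers (lw(a := Some k)) es))"
      using Cons.prems k by (intro Cons.IH) auto
    then show ?thesis using True by (simp add: e)
  next
    case False
    have "length (recorded W es) = length (filter (\<lambda>(k', k). k' \<in> Some ` K) (transfers lw es))"
      using Cons.prems by (intro Cons.IH) auto
    then show ?thesis using False Cons.prems(2) by (simp add: e)
  qed
qed auto

text \<open>Expresses what one phase passes on to the next as a count in the trace of the whole run,
  where the counts of different nodes can be compared and summed.\<close>

lemma length_recorded_le_transfers:
  assumes "\<forall>(k, e) \<in> set es1. k \<notin> K" "\<forall>(k, e) \<in> set es2. k \<in> K"
    and "\<forall>(k, e) \<in> set es3. k \<notin> K \<and> k \<in> L"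
  shows "length (recorded (written es2) es3) \<le>
    length (filter (\<lambda>(k', k). k' \<in> Some ` K \<and> k \<in> L) (transfers (\<lambda>_. None) (es1 @ es2 @ es3 @ es4)))"
proof -
  let ?lw1 = "last_writers (\<lambda>_. None) es1"
  let ?lw2 = "last_writers ?lw1 es2"
  have "?lw1 a \<notin> Some ` K" for a using assms(1) by (rule last_writers_outside) auto
  then have "written es2 = {a. ?lw2 a \<in> Some ` K}"
    using last_writers_inside[OF assms(2)] by auto
  then have "length (recorded (written es2) es3) =
     length (filter (\<lambda>(k', k). k' \<in> Some ` K) (transfers ?lw2 es3))"
    using assms(3) by (intro length_recorded) auto
  also have "filter (\<lambda>(k', k). k' \<in> Some ` K) (transfers ?lw2 es3) =
     filter (\<lambda>(k', k). k' \<in> Some ` K \<and> k \<in> L) (transfers ?lw2 es3)"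
    using transfers_tags assms(3) by (intro filter_cong) fastforce+
  finally show ?thesis by (simp add: transfers_append)
qed

text \<open>In effect, a shorter list is padded to length \<open>n\<close> with one extra
  symbol.\<close>

lemma card_lists_le:
  assumes "finite A"
  shows "card {xs. set xs \<subseteq> A \<and> length xs \<le> n} \<le> (card A + 1) ^ n"
proof -
  have "(\<Sum>i\<le>n. a ^ i) \<le> (a + 1) ^ n" for a :: nat
  proof (induction n)
    case (Suc n)
    have "a * a ^ n \<le> a * (a + 1) ^ n" by (intro mult_left_mono power_mono) auto
    with Suc have "(\<Sum>i\<le>n. a ^ i) + a * a ^ n \<le> (a + 1) ^ n + a * (a + 1) ^ n" by (rule add_mono)
    then show ?case by simp
  qed simp
  with assms show ?thesis by (simp add: card_lists_length_le)
qed

section \<open>Request sequences of a tree\<close>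

text \<open>However ties are broken, the requests lead from \<open>S\<close> to the one set
  \<open>S'\<close>. Both clauses allow an arbitrary continuation, so that consecutive pieces
  compose.\<close>

definition steps_to ::
  "nat \<Rightarrow> nat \<Rightarrow> (nat \<times> nat) set \<Rightarrow> request list \<Rightarrow> (nat \<times> nat) set \<Rightarrow> bool" where
  "steps_to kb pb S qs S' \<longleftrightarrow>
     (\<forall>rest. valid_requests kb pb S' rest \<longrightarrow> valid_requests kb pb S (qs @ rest)) \<and>
     (\<forall>rest as. correct_answers S (qs @ rest) as \<longrightarrow> correct_answers S' rest (drop (length qs) as))"

lemma steps_to_Nil: "steps_to kb pb S [] S"
  by (simp add: steps_to_def)

lemma steps_to_append:
  assumes "steps_to kb pb S qs S'" and "steps_to kb pb S' qs' S''"
  shows "steps_to kb pb S (qs @ qs') S''"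
  using assms unfolding steps_to_def append_assoc length_append drop_drop[symmetric] add.commute[of "length qs"]
  by (metis add.commute drop_drop)

lemma steps_to_single:
  assumes "legal kb pb S q" and "\<And>a S''. correct_step S q a S'' \<Longrightarrow> S'' = S'"
  shows "steps_to kb pb S [q] S'"
  using assms unfolding steps_to_def by fastforce

definition lower_keys :: "nat set \<Rightarrow> nat \<Rightarrow> (nat \<times> nat) set \<Rightarrow> (nat \<times> nat) set" where
  "lower_keys K p S = (\<lambda>(k', p'). (k', if k' \<in> K then min p p' else p')) ` S"

definition remove_keys :: "nat set \<Rightarrow> (nat \<times> nat) set \<Rightarrow> (nat \<times> nat) set" where
  "remove_keys K S = {x \<in> S. fst x \<notin> K}"

lemma fst_lower_keys: "fst ` lower_keys K p S = fst ` S"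
  by (force simp: lower_keys_def image_iff)

lemma fst_remove_keys: "inj_on fst S \<Longrightarrow> fst ` remove_keys K S = fst ` S - K"
  by (auto simp: remove_keys_def)

lemma subset_fst_remove_keys:
  "inj_on fst S \<Longrightarrow> C \<subseteq> fst ` S \<Longrightarrow> K \<inter> C = {} \<Longrightarrow> C \<subseteq> fst ` remove_keys K S"
  unfolding fst_remove_keys by blast

lemma inj_on_lower_keys: "inj_on fst S \<Longrightarrow> inj_on fst (lower_keys K p S)"
  by (fastforce simp: lower_keys_def inj_on_def)

lemma inj_on_remove_keys: "inj_on fst S \<Longrightarrow> inj_on fst (remove_keys K S)"
  by (auto simp: remove_keys_def inj_on_def)

lemma steps_to_DecreaseKeys:
  "p < 2 ^ pb \<Longrightarrow> z ` set ts \<subseteq> fst ` S \<Longrightarrow>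
   steps_to kb pb S (map (\<lambda>t. DecreaseKey (z t) p) ts) (lower_keys (z ` set ts) p S)"
proof (induction ts arbitrary: S)
  case Nil
  then show ?case by (simp add: lower_keys_def steps_to_Nil case_prod_beta)
next
  case (Cons t ts)
  have 1: "steps_to kb pb S [DecreaseKey (z t) p] (lower_keys {z t} p S)"
    using Cons.prems by (intro steps_to_single) (auto simp: lower_keys_def)
  have "steps_to kb pb (lower_keys {z t} p S) (map (\<lambda>t. DecreaseKey (z t) p) ts)
    (lower_keys (z ` set ts) p (lower_keys {z t} p S))"
    using Cons.prems by (intro Cons.IH) (auto simp: fst_lower_keys)
  moreover have "lower_keys (z ` set ts) p (lower_keys {z t} p S) = lower_keys (z ` set (t # ts)) p S"
    unfolding lower_keys_def image_image by (intro image_cong) (auto split: prod.splits)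
  ultimately show ?case using steps_to_append[OF 1] by simp
qed

text \<open>All priorities are positive, so priority \<open>0\<close> makes \<open>k\<close> the
  unique minimum; the two requests simulate a deletion.\<close>

lemma steps_to_delete:
  assumes "inj_on fst S" and "\<forall>x\<in>S. 0 < snd x" and "k \<in> fst ` S"
  shows "steps_to kb pb S [DecreaseKey k 0, ExtractMin] (remove_keys {k} S)"
proof -
  have 1: "steps_to kb pb S [DecreaseKey k 0] (lower_keys {k} 0 S)"
    using assms by (intro steps_to_single) (auto simp: lower_keys_def)
  have k0: "(k, 0) \<in> lower_keys {k} 0 S" using assms(3) by (force simp: lower_keys_def)
  have only: "x = (k, 0)" if "x \<in> lower_keys {k} 0 S" "snd x = 0" for x
    using that assms(2) by (fastforce simp: lower_keys_def split: if_splits)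
  have "lower_keys {k} 0 S - {(k, 0)} = remove_keys {k} S"
    using assms(2) by (force simp: lower_keys_def remove_keys_def image_iff split: if_splits)
  moreover have "S'' = lower_keys {k} 0 S - {(k, 0)}" if step: "correct_step (lower_keys {k} 0 S) ExtractMin a S''" for a S''
  proof -
    obtain k' p' where kp: "(k', p') \<in> lower_keys {k} 0 S" "\<forall>(k'', p'') \<in> lower_keys {k} 0 S. p' \<le> p''"
      "S'' = lower_keys {k} 0 S - {(k', p')}" using step by auto
    have "p' = 0" using kp(2) k0 by auto
    then have "(k', p') = (k, 0)" using only[OF kp(1)] by simp
    then show ?thesis using kp(3) by simp
  qed
  ultimately have "S'' = remove_keys {k} S" if "correct_step (lower_keys {k} 0 S) ExtractMin a S''" for a S''
    using that by metis
  moreover have "legal kb pb (lower_keys {k} 0 S) ExtractMin" using k0 by auto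
  ultimately have "steps_to kb pb (lower_keys {k} 0 S) [ExtractMin] (remove_keys {k} S)"
    by (rule steps_to_single[rotated])
  with 1 show ?thesis using steps_to_append by fastforce
qed

lemma extract_answers_subset:
  "correct_answers S (replicate n ExtractMin @ rest) as \<Longrightarrow> set (take n as) \<subseteq> Some ` S"
proof (induction n arbitrary: S as)
  case (Suc n)
  then obtain a as' S' where 1: "as = a # as'" "correct_step S ExtractMin a S'"
    "correct_answers S' (replicate n ExtractMin @ rest) as'" by auto
  from Suc.IH[OF 1(3)] 1 show ?case by auto
qed simp

lemma low_extract_step:
  assumes "correct_step S ExtractMin a S'" and "finite S" and "card {x \<in> S. snd x \<le> l} = Suc n"
  shows "finite S' \<and> card {x \<in> S'. snd x \<le> l} = n \<and> {x \<in> S'. l < snd x} = {x \<in> S. l < snd x} \<and>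
    Some ` {x \<in> S. snd x \<le> l} = insert a (Some ` {x \<in> S'. snd x \<le> l})"
proof -
  obtain k p where kp: "a = Some (k, p)" "(k, p) \<in> S" "\<forall>(k', p') \<in> S. p \<le> p'" "S' = S - {(k, p)}"
    using assms(1) by auto
  have "{x \<in> S. snd x \<le> l} \<noteq> {}" using assms(3) by force
  then obtain x where "x \<in> S" "snd x \<le> l" by blast
  with kp(3) have pl: "p \<le> l" by force
  then have "{x \<in> S'. snd x \<le> l} = {x \<in> S. snd x \<le> l} - {(k, p)}" using kp by auto
  moreover have "(k, p) \<in> {x \<in> S. snd x \<le> l}" using kp pl by simp
  moreover have "{x \<in> S'. l < snd x} = {x \<in> S. l < snd x}" using kp pl by auto
  ultimately show ?thesis using assms kp by auto
qed

text \<open>There are exactly as many extractions as pairs of priority at most \<open>l\<close>, and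
  each removes such a pair as long as one remains. Only the order depends on the ties.\<close>

lemma low_extract_answers:
  "finite S \<Longrightarrow> card {x \<in> S. snd x \<le> l} = n \<Longrightarrow> correct_answers S (replicate n ExtractMin @ rest) as \<Longrightarrow>
   Some ` {x \<in> S. snd x \<le> l} \<subseteq> set (take n as) \<and> correct_answers {x \<in> S. l < snd x} rest (drop n as)"
proof (induction n arbitrary: S as)
  case 0
  then have *: "{x \<in> S. snd x \<le> l} = {}" by simp
  then have "{x \<in> S. l < snd x} = S" by force
  with 0 show ?case by (simp only: *) simp
next
  case (Suc n)
  then obtain a as' S' where 1: "as = a # as'" "correct_step S ExtractMin a S'"
    "correct_answers S' (replicate n ExtractMin @ rest) as'" by auto
  note 2 = low_extract_step[OF 1(2) Suc.prems(1,2)]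
  from Suc.IH[OF _ _ 1(3)] 2 1 show ?case by auto
qed

lemma low_extract_valid:
  "finite S \<Longrightarrow> card {x \<in> S. snd x \<le> l} = n \<Longrightarrow> valid_requests kb pb {x \<in> S. l < snd x} rest \<Longrightarrow>
   valid_requests kb pb S (replicate n ExtractMin @ rest)"
proof (induction n arbitrary: S)
  case 0
  then have *: "{x \<in> S. snd x \<le> l} = {}" by simp
  then have "{x \<in> S. l < snd x} = S" by force
  with 0 show ?case by simp
next
  case (Suc n)
  have "valid_requests kb pb S' (replicate n ExtractMin @ rest)" if "correct_step S ExtractMin a S'" for a S'
    using low_extract_step[OF that Suc.prems(1,2)] Suc.prems(3) by (intro Suc.IH) auto
  moreover have "S \<noteq> {}" using Suc.prems(2) by auto
  ultimately show ?case by simp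
qed

lemma steps_to_extract:
  "finite S \<Longrightarrow> card {x \<in> S. snd x \<le> l} = n \<Longrightarrow>
   steps_to kb pb S (replicate n ExtractMin) {x \<in> S. l < snd x}"
  using low_extract_valid low_extract_answers by (auto simp: steps_to_def)

text \<open>Leaves open which pairs are extracted, as exchanged runs require; hence the continuation
  has to be valid on every subset.\<close>

lemma extract_valid:
  "finite S \<Longrightarrow> n \<le> card S \<Longrightarrow> (\<And>S'. S' \<subseteq> S \<Longrightarrow> valid_requests kb pb S' rest) \<Longrightarrow>
   valid_requests kb pb S (replicate n ExtractMin @ rest)"
proof (induction n arbitrary: S)
  case (Suc n)
  have "valid_requests kb pb S' (replicate n ExtractMin @ rest)" if "correct_step S ExtractMin a S'" for a S'
  proof (rule Suc.IH)
    show "finite S'" "n \<le> card S'" using that Suc.prems by auto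
    show "valid_requests kb pb S'' rest" if "S'' \<subseteq> S'" for S''
      using that \<open>correct_step S ExtractMin a S'\<close> by (intro Suc.prems) auto
  qed
  moreover have "S \<noteq> {}" using Suc.prems(2) by auto
  ultimately show ?case by simp
qed simp

lemma steps_to_inserts:
  "distinct ks \<Longrightarrow> \<forall>k\<in>set ks. k < 2 ^ kb \<and> p k < 2 ^ pb \<and> k \<notin> fst ` S \<Longrightarrow>
   steps_to kb pb S (map (\<lambda>k. Insert k (p k)) ks) (S \<union> (\<lambda>k. (k, p k)) ` set ks)"
proof (induction ks arbitrary: S)
  case Nil
  then show ?case by (simp add: steps_to_Nil)
next
  case (Cons k ks)
  have 1: "steps_to kb pb S [Insert k (p k)] (insert (k, p k) S)"
    using Cons.prems by (intro steps_to_single) auto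
  have "steps_to kb pb (insert (k, p k) S) (map (\<lambda>k. Insert k (p k)) ks)
     (insert (k, p k) S \<union> (\<lambda>k. (k, p k)) ` set ks)"
    using Cons.prems by (intro Cons.IH) auto
  from steps_to_append[OF 1 this] show ?case by simp
qed

lemma steps_to_valid: "steps_to kb pb S qs S' \<Longrightarrow> valid_requests kb pb S qs"
  unfolding steps_to_def using valid_requests.simps(1) by (metis append_Nil2)

text \<open>Keys from \<open>u\<close> on are fresh whatever has been extracted before, so such
  insertions can pad a sequence to a prescribed length.\<close>

lemma inserts_valid:
  "u + n \<le> 2 ^ kb \<Longrightarrow> fst ` S \<subseteq> {..<u} \<Longrightarrow> valid_requests kb pb S (map (\<lambda>k. Insert k 0) [u..<u + n])"
  by (rule steps_to_valid[OF steps_to_inserts]) force+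

section \<open>The tree of requests and its slots\<close>

type_synonym slot = "nat \<times> nat \<times> nat"

locale pq_tree =
  fixes \<beta> :: nat and nz :: "nat \<Rightarrow> nat" and H F u kb pb :: nat
  assumes u_le: "u \<le> 2 ^ kb" and H_less: "Suc H < 2 ^ pb" and \<beta>_pos: "0 < \<beta>"
begin

text \<open>
  Node \<open>j\<close> of level \<open>Suc l\<close> has the children \<open>\<beta> * j, \<dots>, \<beta> * j + \<beta> - 1\<close>. Slot \<open>(0, j, 0)\<close> is the key
  deleted at leaf \<open>j\<close>, and \<open>(l, j, t)\<close> with \<open>l > 0\<close> is the \<open>t\<close>-th of the keys whose priority is
  lowered when the subtree of node \<open>j\<close> of level \<open>l\<close> is entered, and that are extracted when it is
  left.
\<close>

fun node :: "(slot \<Rightarrow> nat) \<Rightarrow> nat \<Rightarrow> nat \<Rightarrow> request list" where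
  "node \<omega> 0 j = [DecreaseKey (\<omega> (0, j, 0)) 0, ExtractMin]"
| "node \<omega> (Suc l) j =
     map (\<lambda>t. DecreaseKey (\<omega> (Suc l, j, t)) (Suc l)) [0..<nz (Suc l)] @
     concat (map (node \<omega> l) [\<beta> * j..<\<beta> * j + \<beta>]) @
     replicate (nz (Suc l)) ExtractMin"

text \<open>\<open>F\<close> trees of height \<open>H\<close> are traversed one after the other. The
  initial priority \<open>Suc H\<close> lies above every level, so that with distinct keys nothing
  outside the slots is ever extracted.\<close>

definition full :: "(slot \<Rightarrow> nat) \<Rightarrow> request list" where
  "full \<omega> = map (\<lambda>k. Insert k (Suc H)) [0..<u] @ concat (map (node \<omega> H) [0..<F])"

text \<open>Indexed by the depth \<open>d\<close> of the node, whose level is \<open>H - d\<close>: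
  the recursion climbs through the ancestors \<open>j div \<beta>\<close>, each of which has lowered
  its keys and finished its earlier children.\<close>

fun before :: "(slot \<Rightarrow> nat) \<Rightarrow> nat \<Rightarrow> nat \<Rightarrow> request list" where
  "before \<omega> 0 j = map (\<lambda>k. Insert k (Suc H)) [0..<u] @ concat (map (node \<omega> H) [0..<j])"
| "before \<omega> (Suc d) j =
     before \<omega> d (j div \<beta>) @
     map (\<lambda>t. DecreaseKey (\<omega> (H - d, j div \<beta>, t)) (H - d)) [0..<nz (H - d)] @
     concat (map (node \<omega> (H - Suc d)) [\<beta> * (j div \<beta>)..<j])"

fun after :: "(slot \<Rightarrow> nat) \<Rightarrow> nat \<Rightarrow> nat \<Rightarrow> request list" where
  "after \<omega> 0 j = concat (map (node \<omega> H) [Suc j..<F])"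
| "after \<omega> (Suc d) j =
     concat (map (node \<omega> (H - Suc d)) [Suc j..<\<beta> * (j div \<beta>) + \<beta>]) @
     replicate (nz (H - d)) ExtractMin @ after \<omega> d (j div \<beta>)"

definition width :: "nat \<Rightarrow> nat" where
  "width l = (if l = 0 then 1 else nz l)"

definition zslots :: "nat \<Rightarrow> nat \<Rightarrow> slot set" where
  "zslots l j = {(l, j, t) |t. t < nz l}"

text \<open>The slots of a subtree in closed form: \<open>j' div \<beta> ^ (l - l')\<close> is the
  ancestor of \<open>j'\<close> on level \<open>l\<close>.\<close>

definition nslots :: "nat \<Rightarrow> nat \<Rightarrow> slot set" where
  "nslots l j = {(l', j', t). l' \<le> l \<and> j' div \<beta> ^ (l - l') = j \<and> t < width l'}"

definition slots :: "slot set" where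
  "slots = (\<Union>j<F. nslots H j)"

lemma nslots_0: "nslots 0 j = {(0, j, 0)}"
  by (auto simp: nslots_def width_def)

lemma less_last_sibling: "x < \<beta> * (x div \<beta>) + \<beta>"
  using dividend_less_times_div[OF \<beta>_pos, of x] by (simp add: add.commute)

lemma nslots_Suc: "nslots (Suc l) j = zslots (Suc l) j \<union> (\<Union>i \<in> {\<beta> * j..<\<beta> * j + \<beta>}. nslots l i)"
proof -
  have child: "x div \<beta> = j \<longleftrightarrow> x \<in> {\<beta> * j..<\<beta> * j + \<beta>}" for x
    using less_last_sibling[of x] by (auto intro: div_nat_eqI)
  have "(l', j', t) \<in> nslots (Suc l) j \<longleftrightarrow>
        (l', j', t) \<in> zslots (Suc l) j \<union> (\<Union>i \<in> {\<beta> * j..<\<beta> * j + \<beta>}. nslots l i)" for l' j' t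
  proof (cases "l' = Suc l")
    case True
    then show ?thesis by (auto simp: nslots_def zslots_def width_def)
  next
    case False
    show ?thesis
    proof (cases "l' \<le> l")
      case True
      then have "j' div \<beta> ^ (Suc l - l') = j' div \<beta> ^ (l - l') div \<beta>"
        by (simp only: Suc_diff_le power_Suc2 div_mult2_eq)
      then show ?thesis using True False child by (auto simp: nslots_def zslots_def)
    qed (use False in \<open>auto simp: nslots_def zslots_def\<close>)
  qed
  then show ?thesis by (metis (no_types, lifting) prod_cases3 subsetI subset_antisym)
qed

lemma nslots_disjoint: "j \<noteq> j' \<Longrightarrow> nslots l j \<inter> nslots l j' = {}"
  by (auto simp: nslots_def)

lemma zslots_disjoint: "l < l' \<Longrightarrow> zslots l' j \<inter> nslots l i = {}"
  by (auto simp: nslots_def zslots_def)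

lemma nslots_parent: "nslots l j \<subseteq> nslots (Suc l) (j div \<beta>)"
proof -
  have "j \<in> {\<beta> * (j div \<beta>)..<\<beta> * (j div \<beta>) + \<beta>}"
    using less_last_sibling by simp
  then show ?thesis unfolding nslots_Suc by blast
qed

lemma zslots_parent: "zslots (Suc l) j \<subseteq> nslots (Suc l) j"
  by (simp add: nslots_Suc)

lemma finite_nslots: "finite (nslots l j)"
  by (induction l arbitrary: j) (auto simp: nslots_0 nslots_Suc zslots_def)

lemma finite_slots: "finite slots"
  by (simp add: slots_def finite_nslots)

text \<open>The step for a single node is a hypothesis, because in the induction over levels it is
  available only as the induction hypothesis.\<close>

lemma steps_to_concat:
  assumes node: "\<And>S j. inj_on fst S \<Longrightarrow> finite S \<Longrightarrow> \<forall>x\<in>S. l < snd x \<Longrightarrow> inj_on \<omega> (nslots l j) \<Longrightarrow>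
      \<omega> ` nslots l j \<subseteq> fst ` S \<Longrightarrow> steps_to kb pb S (node \<omega> l j) (remove_keys (\<omega> ` nslots l j) S)"
  shows "inj_on fst S \<Longrightarrow> finite S \<Longrightarrow> \<forall>x\<in>S. l < snd x \<Longrightarrow> distinct js \<Longrightarrow>
    inj_on \<omega> (\<Union>j\<in>set js. nslots l j) \<Longrightarrow> \<omega> ` (\<Union>j\<in>set js. nslots l j) \<subseteq> fst ` S \<Longrightarrow>
    steps_to kb pb S (concat (map (node \<omega> l) js)) (remove_keys (\<omega> ` (\<Union>j\<in>set js. nslots l j)) S)"
proof (induction js arbitrary: S)
  case Nil
  then show ?case by (simp add: remove_keys_def steps_to_Nil)
next
  case (Cons j js)
  let ?S = "remove_keys (\<omega> ` nslots l j) S"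
  have 1: "steps_to kb pb S (node \<omega> l j) ?S"
    using Cons.prems by (intro node) (auto simp: inj_on_Un)
  have dis: "nslots l j \<inter> (\<Union>j\<in>set js. nslots l j) = {}"
  proof -
    have "nslots l j \<inter> nslots l i = {}" if "i \<in> set js" for i
      using Cons.prems(4) that by (intro nslots_disjoint) auto
    then show ?thesis by blast
  qed
  have inj: "inj_on \<omega> (nslots l j \<union> (\<Union>j\<in>set js. nslots l j))" using Cons.prems by simp
  have K: "\<omega> ` nslots l j \<inter> \<omega> ` (\<Union>j\<in>set js. nslots l j) = {}"
    using inj_on_image_Int[OF inj, of "nslots l j" "\<Union>j\<in>set js. nslots l j"] dis by simp
  have "\<omega> ` (\<Union>j\<in>set js. nslots l j) \<subseteq> \<omega> ` (\<Union>j\<in>set (j # js). nslots l j)"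
    by (intro image_mono) auto
  then have "\<omega> ` (\<Union>j\<in>set js. nslots l j) \<subseteq> fst ` ?S"
    using Cons.prems(6) K by (intro subset_fst_remove_keys Cons.prems(1)) auto
  then have "steps_to kb pb ?S (concat (map (node \<omega> l) js)) (remove_keys (\<omega> ` (\<Union>j\<in>set js. nslots l j)) ?S)"
  proof (rule Cons.IH[rotated -1])
    show "inj_on fst ?S" using Cons.prems(1) by (rule inj_on_remove_keys)
    show "finite ?S" using Cons.prems(2) by (simp add: remove_keys_def)
    show "\<forall>x\<in>?S. l < snd x" using Cons.prems(3) unfolding remove_keys_def by blast
    show "distinct js" using Cons.prems(4) by simp
    show "inj_on \<omega> (\<Union>j\<in>set js. nslots l j)" using inj by (rule inj_on_subset) auto
  qed
  moreover have "remove_keys (\<omega> ` (\<Union>j\<in>set js. nslots l j)) ?S = remove_keys (\<omega> ` (\<Union>j\<in>set (j # js). nslots l j)) S"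
    unfolding remove_keys_def by auto
  ultimately have "steps_to kb pb ?S (concat (map (node \<omega> l) js)) (remove_keys (\<omega> ` (\<Union>j\<in>set (j # js). nslots l j)) S)"
    by simp
  from steps_to_append[OF 1 this] show ?case by simp
qed

lemma zslots_image: "\<omega> ` zslots l j = (\<lambda>t. \<omega> (l, j, t)) ` set [0..<nz l]"
  by (auto simp: zslots_def)

lemma card_zslots: "card (zslots l j) = nz l"
proof -
  have "zslots l j = (\<lambda>t. (l, j, t)) ` {..<nz l}" by (auto simp: zslots_def)
  then show ?thesis by (simp add: card_image inj_on_def)
qed

text \<open>Deletions in the children spare the lowered keys, as \<open>K\<close> and
  \<open>C\<close> are disjoint, and all other keys stay above \<open>l\<close>. Thus the
  extractions at the end of a node remove exactly \<open>K\<close>.\<close>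

lemma low_after_lower:
  assumes "inj_on fst S" and "\<forall>x\<in>S. l < snd x" and "K \<subseteq> fst ` S" and "K \<inter> C = {}"
  shows "{x \<in> remove_keys C (lower_keys K l S). snd x \<le> l} = (\<lambda>k. (k, l)) ` K"
    and "{x \<in> remove_keys C (lower_keys K l S). l < snd x} = remove_keys (K \<union> C) S"
proof -
  have p: "l < p" if "(k, p) \<in> S" for k p using assms(2) that by force
  show "{x \<in> remove_keys C (lower_keys K l S). snd x \<le> l} = (\<lambda>k. (k, l)) ` K"
  proof (intro equalityI subsetI)
    fix x assume "x \<in> {x \<in> remove_keys C (lower_keys K l S). snd x \<le> l}"
    then show "x \<in> (\<lambda>k. (k, l)) ` K"
      by (auto simp: remove_keys_def lower_keys_def split: if_splits dest!: p)
  next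
    fix x assume "x \<in> (\<lambda>k. (k, l)) ` K"
    then obtain k where k: "x = (k, l)" "k \<in> K" by auto
    then obtain p' where p': "(k, p') \<in> S" using assms(3) by auto
    have "(k, if k \<in> K then min l p' else p') \<in> lower_keys K l S"
      unfolding lower_keys_def using p' by force
    then have "x \<in> lower_keys K l S" using k p[OF p'] by simp
    then show "x \<in> {x \<in> remove_keys C (lower_keys K l S). snd x \<le> l}"
      using k assms(4) by (auto simp: remove_keys_def)
  qed
  show "{x \<in> remove_keys C (lower_keys K l S). l < snd x} = remove_keys (K \<union> C) S"
  proof (intro equalityI subsetI)
    fix x assume "x \<in> {x \<in> remove_keys C (lower_keys K l S). l < snd x}"
    then show "x \<in> remove_keys (K \<union> C) S"
      by (auto simp: remove_keys_def lower_keys_def split: if_splits)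
  next
    fix x assume x: "x \<in> remove_keys (K \<union> C) S"
    obtain k p' where kp: "x = (k, p')" by (cases x)
    have "(k, if k \<in> K then min l p' else p') \<in> lower_keys K l S"
      unfolding lower_keys_def using x kp by (force simp: remove_keys_def)
    then show "x \<in> {x \<in> remove_keys C (lower_keys K l S). l < snd x}"
      using x kp p by (auto simp: remove_keys_def)
  qed
qed

lemma lower_keys_ge: "\<forall>x\<in>S. l < snd x \<Longrightarrow> \<forall>x\<in>lower_keys K l S. l \<le> snd x"
  by (force simp: lower_keys_def)

text \<open>On entry all priorities exceed the level of the node. Keys lowered to that level are
  still above the level of the children, so the same condition holds for every child.\<close>

lemma steps_to_node:
  "Suc l < 2 ^ pb \<Longrightarrow> inj_on fst S \<Longrightarrow> finite S \<Longrightarrow> \<forall>x\<in>S. l < snd x \<Longrightarrow> inj_on \<omega> (nslots l j) \<Longrightarrow>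
   \<omega> ` nslots l j \<subseteq> fst ` S \<Longrightarrow> steps_to kb pb S (node \<omega> l j) (remove_keys (\<omega> ` nslots l j) S)"
proof (induction l arbitrary: S j)
  case 0
  then show ?case using steps_to_delete[of S "\<omega> (0, j, 0)"] by (simp add: nslots_0)
next
  case (Suc l)
  let ?K = "\<omega> ` zslots (Suc l) j"
  let ?cs = "\<Union>i \<in> set [\<beta> * j..<\<beta> * j + \<beta>]. nslots l i"
  let ?S1 = "lower_keys ?K (Suc l) S"
  let ?S2 = "remove_keys (\<omega> ` ?cs) ?S1"
  have ns: "nslots (Suc l) j = zslots (Suc l) j \<union> ?cs" by (simp add: nslots_Suc)
  have K: "?K \<subseteq> fst ` S" and C: "\<omega> ` ?cs \<subseteq> fst ` S" using Suc.prems(6) unfolding ns by auto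
  have "zslots (Suc l) j \<inter> ?cs = {}" using zslots_disjoint[of l "Suc l"] by auto
  then have KC: "?K \<inter> \<omega> ` ?cs = {}"
    using inj_on_image_Int[OF Suc.prems(5), of "zslots (Suc l) j" ?cs] unfolding ns by auto
  have 1: "steps_to kb pb S (map (\<lambda>t. DecreaseKey (\<omega> (Suc l, j, t)) (Suc l)) [0..<nz (Suc l)]) ?S1"
    unfolding zslots_image using Suc.prems K by (intro steps_to_DecreaseKeys) (auto simp: zslots_image)
  have 2: "steps_to kb pb ?S1 (concat (map (node \<omega> l) [\<beta> * j..<\<beta> * j + \<beta>])) ?S2"
  proof (rule steps_to_concat)
    show "\<forall>x\<in>?S1. l < snd x" using lower_keys_ge[OF Suc.prems(4), of ?K] by auto
    show "inj_on \<omega> ?cs" using Suc.prems(5) unfolding ns by (rule inj_on_subset) auto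
    show "\<omega> ` ?cs \<subseteq> fst ` ?S1" using C unfolding fst_lower_keys .
    show "inj_on fst ?S1" using Suc.prems(2) by (rule inj_on_lower_keys)
    show "finite ?S1" using Suc.prems(3) by (simp add: lower_keys_def)
  qed (use Suc in auto)
  have "inj_on \<omega> (zslots (Suc l) j)" using Suc.prems(5) unfolding ns by (rule inj_on_subset) auto
  then have "card {x \<in> ?S2. snd x \<le> Suc l} = nz (Suc l)"
    unfolding low_after_lower(1)[OF Suc.prems(2,4) K KC] using card_zslots by (simp add: card_image inj_on_def)
  moreover have "finite ?S2" using Suc.prems by (simp add: remove_keys_def lower_keys_def)
  ultimately have 3: "steps_to kb pb ?S2 (replicate (nz (Suc l)) ExtractMin) {x \<in> ?S2. Suc l < snd x}"
    by (intro steps_to_extract)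
  have "{x \<in> ?S2. Suc l < snd x} = remove_keys (\<omega> ` nslots (Suc l) j) S"
    unfolding low_after_lower(2)[OF Suc.prems(2,4) K KC] ns image_Un ..
  with steps_to_append[OF 1 steps_to_append[OF 2 3]] show ?case by simp
qed

lemma steps_to_nodes:
  "Suc l < 2 ^ pb \<Longrightarrow> inj_on fst S \<Longrightarrow> finite S \<Longrightarrow> \<forall>x\<in>S. l < snd x \<Longrightarrow> distinct js \<Longrightarrow>
    inj_on \<omega> (\<Union>j\<in>set js. nslots l j) \<Longrightarrow> \<omega> ` (\<Union>j\<in>set js. nslots l j) \<subseteq> fst ` S \<Longrightarrow>
    steps_to kb pb S (concat (map (node \<omega> l) js)) (remove_keys (\<omega> ` (\<Union>j\<in>set js. nslots l j)) S)"
  by (intro steps_to_concat steps_to_node)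

end

section \<open>Cutting the request sequence at a node\<close>

context pq_tree begin

text \<open>What the parent still does after its child \<open>j\<close>. Reads made here of cells
  last written during the child are the ones charged to the child.\<close>

definition later :: "(slot \<Rightarrow> nat) \<Rightarrow> nat \<Rightarrow> nat \<Rightarrow> request list" where
  "later \<omega> d j = concat (map (node \<omega> (H - Suc d)) [Suc j..<\<beta> * (j div \<beta>) + \<beta>]) @
     replicate (nz (H - d)) ExtractMin"

text \<open>Stops just before the extractions that close node \<open>j\<close>, so that the
  contested answers are those to the next \<open>nz (H - d)\<close> requests.\<close>

definition entering :: "(slot \<Rightarrow> nat) \<Rightarrow> nat \<Rightarrow> nat \<Rightarrow> request list" where
  "entering \<omega> d j = before \<omega> d j @
     map (\<lambda>t. DecreaseKey (\<omega> (H - d, j, t)) (H - d)) [0..<nz (H - d)] @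
     concat (map (node \<omega> (H - Suc d)) [\<beta> * j..<\<beta> * j + \<beta>])"

lemma upt_split_at: "a \<le> j \<Longrightarrow> j < b \<Longrightarrow> [a..<b] = [a..<j] @ j # [Suc j..<b]"
  by (metis le_add_diff_inverse less_imp_le upt_add_eq_append upt_conv_Cons)

lemma siblings_split:
  "[\<beta> * (j div \<beta>)..<\<beta> * (j div \<beta>) + \<beta>] = [\<beta> * (j div \<beta>)..<j] @ j # [Suc j..<\<beta> * (j div \<beta>) + \<beta>]"
  using less_last_sibling[of j] by (intro upt_split_at) auto

lemma node_cong: "(\<And>s. s \<in> nslots l j \<Longrightarrow> \<omega> s = \<omega>' s) \<Longrightarrow> node \<omega> l j = node \<omega>' l j"
proof (induction l arbitrary: j)
  case 0
  then show ?case by (simp add: nslots_0)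
next
  case (Suc l)
  have "node \<omega> l i = node \<omega>' l i" if i: "i \<in> set [\<beta> * j..<\<beta> * j + \<beta>]" for i
  proof (rule Suc.IH)
    fix s assume "s \<in> nslots l i"
    then have "s \<in> nslots (Suc l) j" using i unfolding nslots_Suc by auto
    then show "\<omega> s = \<omega>' s" by (rule Suc.prems)
  qed
  then have "map (node \<omega> l) [\<beta> * j..<\<beta> * j + \<beta>] = map (node \<omega>' l) [\<beta> * j..<\<beta> * j + \<beta>]"
    by (intro map_cong) auto
  moreover have "\<omega> (Suc l, j, t) = \<omega>' (Suc l, j, t)" if "t < nz (Suc l)" for t
    using that by (intro Suc.prems) (auto simp: nslots_Suc zslots_def)
  then have "map (\<lambda>t. DecreaseKey (\<omega> (Suc l, j, t)) (Suc l)) [0..<nz (Suc l)] =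
      map (\<lambda>t. DecreaseKey (\<omega>' (Suc l, j, t)) (Suc l)) [0..<nz (Suc l)]" by simp
  ultimately show ?case by (simp only: node.simps)
qed

lemma nslots_unique: "s \<in> nslots l i \<Longrightarrow> s \<in> nslots l j \<Longrightarrow> i = j"
  by (auto simp: nslots_def)

lemma nodes_cong:
  assumes "\<And>s. s \<notin> nslots l j \<Longrightarrow> \<omega> s = \<omega>' s" and "j \<notin> set js"
  shows "map (node \<omega> l) js = map (node \<omega>' l) js"
proof (intro map_cong node_cong refl)
  fix i s assume "i \<in> set js" "s \<in> nslots l i"
  then have "s \<notin> nslots l j" using assms(2) nslots_unique by blast
  then show "\<omega> s = \<omega>' s" by (rule assms(1))
qed

lemma level_step: "d < H \<Longrightarrow> Suc (H - Suc d) = H - d"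
  by simp

lemma nslots_parent': "d < H \<Longrightarrow> nslots (H - Suc d) j \<subseteq> nslots (H - d) (j div \<beta>)"
  using nslots_parent[of "H - Suc d" j] by (simp add: level_step)

lemma parent_index: "j < F * \<beta> ^ Suc d \<Longrightarrow> j div \<beta> < F * \<beta> ^ d"
  by (intro less_mult_imp_div_less) (simp add: mult_ac)

lemma full_split:
  "d \<le> H \<Longrightarrow> j < F * \<beta> ^ d \<Longrightarrow> full \<omega> = before \<omega> d j @ node \<omega> (H - d) j @ after \<omega> d j"
proof (induction d arbitrary: j)
  case 0
  then have "[0..<F] = [0..<j] @ j # [Suc j..<F]" by (intro upt_split_at) auto
  then show ?case by (simp add: full_def)
next
  case (Suc d)
  then have "full \<omega> = before \<omega> d (j div \<beta>) @ node \<omega> (Suc (H - Suc d)) (j div \<beta>) @ after \<omega> d (j div \<beta>)"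
    using parent_index by (simp add: level_step)
  then show ?case
    using Suc.prems unfolding node.simps by (simp add: level_step siblings_split)
qed

lemma after_Suc: "after \<omega> (Suc d) j = later \<omega> d j @ after \<omega> d (j div \<beta>)"
  by (simp add: later_def)

lemma entering_eq:
  "entering \<omega> d (j div \<beta>) @ replicate (nz (H - d)) ExtractMin =
   before \<omega> (Suc d) j @ node \<omega> (H - Suc d) j @ later \<omega> d j"
  using siblings_split[of j] by (simp add: entering_def later_def)

lemma before_cong:
  "d \<le> H \<Longrightarrow> (\<And>s. s \<notin> nslots (H - d) j \<Longrightarrow> \<omega> s = \<omega>' s) \<Longrightarrow> before \<omega> d j = before \<omega>' d j"
proof (induction d arbitrary: j)
  case 0
  have "map (node \<omega> H) [0..<j] = map (node \<omega>' H) [0..<j]"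
    using 0 by (intro nodes_cong[of H j]) auto
  then show ?case by (simp only: before.simps)
next
  case (Suc d)
  have "before \<omega> d (j div \<beta>) = before \<omega>' d (j div \<beta>)"
    using Suc.prems nslots_parent'[of d j] by (intro Suc.IH) auto
  moreover have "map (node \<omega> (H - Suc d)) [\<beta> * (j div \<beta>)..<j] = map (node \<omega>' (H - Suc d)) [\<beta> * (j div \<beta>)..<j]"
    using Suc.prems by (intro nodes_cong[of _ j]) auto
  moreover have "\<omega> (H - d, i, t) = \<omega>' (H - d, i, t)" for i t
    using Suc.prems by (intro Suc.prems) (auto simp: nslots_def)
  ultimately show ?case by (simp only: before.simps)
qed

lemma nslots_subset_slots: "d \<le> H \<Longrightarrow> j < F * \<beta> ^ d \<Longrightarrow> nslots (H - d) j \<subseteq> slots"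
proof (induction d arbitrary: j)
  case 0
  then show ?case by (auto simp: slots_def)
next
  case (Suc d)
  then have "nslots (H - d) (j div \<beta>) \<subseteq> slots" using parent_index by auto
  then show ?case using nslots_parent'[of d j] Suc.prems by auto
qed

text \<open>\<open>X\<close> stands for a subtree not yet entered: only keys of slots outside
  \<open>X\<close> can have left the queue.\<close>

definition reaches :: "request list \<Rightarrow> (slot \<Rightarrow> nat) \<Rightarrow> nat \<Rightarrow> slot set \<Rightarrow> (nat \<times> nat) set \<Rightarrow> bool" where
  "reaches qs \<omega> l X S \<longleftrightarrow> steps_to kb pb {} qs S \<and> finite S \<and> inj_on fst S \<and> (\<forall>x\<in>S. l < snd x) \<and>
     {..<u} - \<omega> ` (slots - X) \<subseteq> fst ` S \<and> fst ` S \<subseteq> {..<u}"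

lemma pow_le: "l \<le> H \<Longrightarrow> Suc l < 2 ^ pb"
  using H_less by linarith

lemma inj_on_imageD: "inj_on \<omega> A \<Longrightarrow> B \<subseteq> A \<Longrightarrow> C \<subseteq> A \<Longrightarrow> B \<inter> C = {} \<Longrightarrow> \<omega> ` B \<inter> \<omega> ` C = {}"
  by (metis image_empty inj_on_image_Int)

lemma subset_diffI: "A \<subseteq> B \<Longrightarrow> A \<inter> C = {} \<Longrightarrow> A \<subseteq> B - C"
  by blast

text \<open>Keys are assumed distinct only outside the subtree of the node, since in an exchanged
  run they may collide inside it.\<close>

lemma before_reaches:
  "d \<le> H \<Longrightarrow> j < F * \<beta> ^ d \<Longrightarrow> inj_on \<omega> (slots - nslots (H - d) j) \<Longrightarrow>
   \<omega> ` (slots - nslots (H - d) j) \<subseteq> {..<u} \<Longrightarrow> \<exists>S. reaches (before \<omega> d j) \<omega> (H - d) (nslots (H - d) j) S"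
proof (induction d arbitrary: j)
  case 0
  let ?S0 = "(\<lambda>k. (k, Suc H)) ` {..<u}"
  let ?cs = "\<Union>i \<in> set [0..<j]. nslots H i"
  have 1: "steps_to kb pb {} (map (\<lambda>k. Insert k (Suc H)) [0..<u]) ?S0"
    using steps_to_inserts[of "[0..<u]" kb "\<lambda>_. Suc H" pb "{}"] u_le H_less by (simp add: lessThan_atLeast0)
  have inj0: "inj_on fst ?S0" by (auto simp: inj_on_def)
  have sub: "?cs \<subseteq> slots - nslots H j"
  proof
    fix s assume "s \<in> ?cs"
    then obtain i where i: "i < j" "s \<in> nslots H i" by auto
    moreover have "i < F" using i(1) 0(2) by simp
    moreover have "s \<notin> nslots H j" using i nslots_unique by blast
    ultimately show "s \<in> slots - nslots H j" unfolding slots_def by blast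
  qed
  have fst0: "fst ` ?S0 = {..<u}" by force
  have "\<omega> ` ?cs \<subseteq> {..<u}" using sub 0(4) by auto
  then have 2: "steps_to kb pb ?S0 (concat (map (node \<omega> H) [0..<j])) (remove_keys (\<omega> ` ?cs) ?S0)"
    using inj0 fst0 pow_le[of H] inj_on_subset[OF 0(3)] sub by (intro steps_to_nodes) auto
  have "{..<u} - \<omega> ` (slots - nslots H j) \<subseteq> fst ` remove_keys (\<omega> ` ?cs) ?S0"
    unfolding fst_remove_keys[OF inj0] fst0 using sub by blast
  then show ?case unfolding reaches_def using steps_to_append[OF 1 2] inj_on_remove_keys[OF inj0, of "\<omega> ` ?cs"]
    by (intro exI[of _ "remove_keys (\<omega> ` ?cs) ?S0"])
       (auto simp: remove_keys_def)
next
  case (Suc d)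
  define l where "l = H - Suc d"
  have l: "H - d = Suc l" using Suc.prems by (simp add: l_def)
  let ?z = "zslots (Suc l) (j div \<beta>)"
  let ?cs = "\<Union>i \<in> set [\<beta> * (j div \<beta>)..<j]. nslots l i"
  let ?O = "slots - nslots (Suc l) (j div \<beta>)" and ?O' = "slots - nslots l j"
  have par: "nslots l j \<subseteq> nslots (Suc l) (j div \<beta>)" by (rule nslots_parent)
  have insl: "nslots (Suc l) (j div \<beta>) \<subseteq> slots"
    using nslots_subset_slots[of d "j div \<beta>"] Suc.prems parent_index[of j d] by (simp add: l)
  have inj': "inj_on \<omega> ?O'" and im': "\<omega> ` ?O' \<subseteq> {..<u}" using Suc.prems by (simp_all add: l_def)
  have "\<exists>S. reaches (before \<omega> d (j div \<beta>)) \<omega> (H - d) (nslots (H - d) (j div \<beta>)) S"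
  proof (rule Suc.IH)
    have OO: "?O \<subseteq> ?O'" using par by blast
    show "inj_on \<omega> (slots - nslots (H - d) (j div \<beta>))" using inj_on_subset[OF inj' OO] by (simp only: l)
    show "\<omega> ` (slots - nslots (H - d) (j div \<beta>)) \<subseteq> {..<u}" using image_mono[OF OO, of \<omega>] im' by (simp only: l)
  qed (use Suc.prems parent_index[of j d] in auto)
  then obtain S where S: "steps_to kb pb {} (before \<omega> d (j div \<beta>)) S" "finite S" "inj_on fst S"
    "\<forall>x\<in>S. Suc l < snd x" "{..<u} - \<omega> ` ?O \<subseteq> fst ` S" "fst ` S \<subseteq> {..<u}"
    unfolding reaches_def l by blast
  have cs_desc: "?cs \<subseteq> nslots (Suc l) (j div \<beta>)"
    using less_last_sibling[of j] by (auto simp: nslots_Suc)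
  have cs_j: "?cs \<inter> nslots l j = {}" by (auto dest: nslots_unique)
  have zj: "?z \<inter> nslots l j = {}" by (rule zslots_disjoint) simp
  have zcs: "?z \<inter> ?cs = {}" using zslots_disjoint[of l "Suc l"] by blast
  have zO: "?z \<subseteq> ?O'" by (rule subset_diffI[OF subset_trans[OF zslots_parent insl] zj])
  have csO: "?cs \<subseteq> ?O'" by (rule subset_diffI[OF subset_trans[OF cs_desc insl] cs_j])
  have OO: "?O \<subseteq> ?O'" using par by blast
  have disj: "A \<inter> ?O = {}" if "A \<subseteq> nslots (Suc l) (j div \<beta>)" for A using that by blast
  \<comment> \<open>Only keys of \<open>?O\<close> can be missing from \<open>S\<close>, and
    distinctness separates them from the keys requested next.\<close>
  have dis: "\<omega> ` ?z \<inter> \<omega> ` ?O = {}" "\<omega> ` ?cs \<inter> \<omega> ` ?O = {}"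
    using inj_on_imageD[OF inj' zO OO disj[OF zslots_parent]] inj_on_imageD[OF inj' csO OO disj[OF cs_desc]] .
  have zS: "\<omega> ` ?z \<subseteq> fst ` S"
    using S(5) subset_diffI[OF subset_trans[OF image_mono[OF zO] im'] dis(1)] by (rule subset_trans[rotated])
  have csS: "\<omega> ` ?cs \<subseteq> fst ` S"
    using S(5) subset_diffI[OF subset_trans[OF image_mono[OF csO] im'] dis(2)] by (rule subset_trans[rotated])
  let ?S1 = "lower_keys (\<omega> ` ?z) (Suc l) S"
  let ?S2 = "remove_keys (\<omega> ` ?cs) ?S1"
  have 1: "steps_to kb pb S (map (\<lambda>t. DecreaseKey (\<omega> (Suc l, j div \<beta>, t)) (Suc l)) [0..<nz (Suc l)]) ?S1"
    unfolding zslots_image using zS pow_le[of l] Suc.prems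
    by (intro steps_to_DecreaseKeys) (auto simp: zslots_image l_def)
  have inj1: "inj_on fst ?S1" using S(3) by (rule inj_on_lower_keys)
  have fin1: "finite ?S1" using S(2) by (simp add: lower_keys_def)
  have ge1: "\<forall>x\<in>?S1. l < snd x" using lower_keys_ge[OF S(4), of "\<omega> ` ?z"] by auto
  have 2: "steps_to kb pb ?S1 (concat (map (node \<omega> l) [\<beta> * (j div \<beta>)..<j])) ?S2"
    using inj1 fin1 ge1 inj_on_subset[OF inj' csO] csS pow_le[of l] Suc.prems
    by (intro steps_to_nodes) (auto simp: fst_lower_keys l_def)
  have "{..<u} - \<omega> ` ?O' \<subseteq> fst ` ?S2"
    unfolding fst_remove_keys[OF inj1] fst_lower_keys using S(5) OO csO by blast
  moreover have "fst ` ?S2 \<subseteq> {..<u}"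
    unfolding fst_remove_keys[OF inj1] fst_lower_keys using S(6) by blast
  moreover have "finite ?S2" "\<forall>x\<in>?S2. l < snd x" using fin1 ge1 unfolding remove_keys_def by auto
  moreover have "inj_on fst ?S2" using inj1 by (rule inj_on_remove_keys)
  ultimately show ?case
    unfolding reaches_def before.simps l_def[symmetric] l
    using steps_to_append[OF S(1) steps_to_append[OF 1 2]] by blast
qed

text \<open>The keys lowered at the node may coincide with keys deleted below it, as happens in an
  exchanged run; such keys are gone at the end.\<close>

lemma entering_reaches:
  assumes d: "d < H" "j < F * \<beta> ^ d" and l: "H - d = Suc l"
    and cs: "cs = (\<Union>i \<in> {\<beta> * j..<\<beta> * j + \<beta>}. nslots l i)"
    and inj: "inj_on \<omega> (slots - nslots (Suc l) j)" "inj_on \<omega> cs"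
    and im: "\<omega> ` (slots - nslots (Suc l) j) \<subseteq> {..<u}"
      "\<omega> ` nslots (Suc l) j \<subseteq> {..<u} - \<omega> ` (slots - nslots (Suc l) j)"
  shows "\<exists>S. inj_on fst S \<and> finite S \<and> (\<forall>x\<in>S. Suc l < snd x) \<and>
    {..<u} - \<omega> ` (slots - nslots (Suc l) j) \<subseteq> fst ` S \<and> fst ` S \<subseteq> {..<u} \<and>
    steps_to kb pb {} (entering \<omega> d j) (remove_keys (\<omega> ` cs) (lower_keys (\<omega> ` zslots (Suc l) j) (Suc l) S))"
proof -
  have "\<exists>S. reaches (before \<omega> d j) \<omega> (H - d) (nslots (H - d) j) S"
    using d inj im by (intro before_reaches) (auto simp: l)
  then obtain S where S: "steps_to kb pb {} (before \<omega> d j) S" "finite S" "inj_on fst S"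
    "\<forall>x\<in>S. Suc l < snd x" "{..<u} - \<omega> ` (slots - nslots (Suc l) j) \<subseteq> fst ` S" "fst ` S \<subseteq> {..<u}"
    unfolding reaches_def l by blast
  have ns: "nslots (Suc l) j = zslots (Suc l) j \<union> cs" by (simp add: nslots_Suc cs)
  have zS: "\<omega> ` zslots (Suc l) j \<subseteq> fst ` S" and csS: "\<omega> ` cs \<subseteq> fst ` S"
    using im(2) S(5) ns by blast+
  let ?S1 = "lower_keys (\<omega> ` zslots (Suc l) j) (Suc l) S"
  have lH: "l \<le> H" "Suc l \<le> H" "H - Suc d = l" using d l by auto
  have 1: "steps_to kb pb S (map (\<lambda>t. DecreaseKey (\<omega> (Suc l, j, t)) (Suc l)) [0..<nz (Suc l)]) ?S1"
    unfolding zslots_image using zS pow_le[of l] lH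
    by (intro steps_to_DecreaseKeys) (auto simp: zslots_image)
  have inj1: "inj_on fst ?S1" using S(3) by (rule inj_on_lower_keys)
  have fin1: "finite ?S1" using S(2) by (simp add: lower_keys_def)
  have ge1: "\<forall>x\<in>?S1. l < snd x" using lower_keys_ge[OF S(4), of "\<omega> ` zslots (Suc l) j"] by auto
  have 2: "steps_to kb pb ?S1 (concat (map (node \<omega> l) [\<beta> * j..<\<beta> * j + \<beta>]))
     (remove_keys (\<omega> ` (\<Union>i \<in> set [\<beta> * j..<\<beta> * j + \<beta>]. nslots l i)) ?S1)"
    using inj1 fin1 ge1 inj(2) csS pow_le[OF lH(1)]
    by (intro steps_to_nodes) (auto simp: fst_lower_keys cs)
  then have "steps_to kb pb {} (entering \<omega> d j) (remove_keys (\<omega> ` cs) ?S1)"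
    using steps_to_append[OF S(1) steps_to_append[OF 1 2]] by (simp add: entering_def lH l cs)
  with S show ?thesis by blast
qed

lemma full_valid:
  assumes "inj_on \<omega> slots" and "\<omega> ` slots \<subseteq> {..<u}"
  shows "valid_requests kb pb {} (full \<omega>)"
proof -
  let ?S0 = "(\<lambda>k. (k, Suc H)) ` {..<u}"
  have 1: "steps_to kb pb {} (map (\<lambda>k. Insert k (Suc H)) [0..<u]) ?S0"
    using steps_to_inserts[of "[0..<u]" kb "\<lambda>_. Suc H" pb "{}"] u_le H_less by (simp add: lessThan_atLeast0)
  have inj0: "inj_on fst ?S0" by (auto simp: inj_on_def)
  have eq: "(\<Union>i \<in> set [0..<F]. nslots H i) = slots" by (auto simp: slots_def)
  have fst0: "fst ` ?S0 = {..<u}" by force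
  have "steps_to kb pb ?S0 (concat (map (node \<omega> H) [0..<F])) (remove_keys (\<omega> ` (\<Union>i \<in> set [0..<F]. nslots H i)) ?S0)"
    using inj0 fst0 pow_le[of H] assms unfolding eq by (intro steps_to_nodes[of H _ "[0..<F]", unfolded eq]) auto
  from steps_to_valid[OF steps_to_append[OF 1 this]] show ?thesis by (simp add: full_def)
qed

text \<open>One half of the contradiction: with distinct keys, exactly the lowered keys have
  priority at most the level of the node when it is left, and there are as many extractions.\<close>

lemma full_answers:
  assumes d: "d < H" "j < F * \<beta> ^ d" and inj: "inj_on \<omega> slots" and im: "\<omega> ` slots \<subseteq> {..<u}"
    and "correct_answers {} (entering \<omega> d j @ replicate (nz (H - d)) ExtractMin @ rest) as"
    and z: "z \<in> zslots (H - d) j"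
  shows "\<exists>p. Some (\<omega> z, p) \<in> set (take (nz (H - d)) (drop (length (entering \<omega> d j)) as))"
proof -
  define l where "l = H - Suc d"
  have l: "H - d = Suc l" using d by (simp add: l_def)
  define cs where "cs = (\<Union>i \<in> {\<beta> * j..<\<beta> * j + \<beta>}. nslots l i)"
  have ns: "nslots (Suc l) j = zslots (Suc l) j \<union> cs" by (simp add: nslots_Suc cs_def)
  have sub: "nslots (Suc l) j \<subseteq> slots" using nslots_subset_slots[of d j] d by (simp add: l)
  have zcs: "zslots (Suc l) j \<inter> cs = {}" using zslots_disjoint[of l "Suc l"] unfolding cs_def by blast
  have KC: "\<omega> ` zslots (Suc l) j \<inter> \<omega> ` cs = {}"
    using sub ns zcs by (intro inj_on_imageD[OF inj]) auto
  have dis: "\<omega> ` nslots (Suc l) j \<inter> \<omega> ` (slots - nslots (Suc l) j) = {}"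
    using sub by (intro inj_on_imageD[OF inj]) auto
  have "\<exists>S. inj_on fst S \<and> finite S \<and> (\<forall>x\<in>S. Suc l < snd x) \<and>
    {..<u} - \<omega> ` (slots - nslots (Suc l) j) \<subseteq> fst ` S \<and> fst ` S \<subseteq> {..<u} \<and>
    steps_to kb pb {} (entering \<omega> d j) (remove_keys (\<omega> ` cs) (lower_keys (\<omega> ` zslots (Suc l) j) (Suc l) S))"
    using d l cs_def
  proof (rule entering_reaches)
    show "inj_on \<omega> (slots - nslots (Suc l) j)" "inj_on \<omega> cs"
      using inj sub ns by (auto intro: inj_on_subset)
    show "\<omega> ` (slots - nslots (Suc l) j) \<subseteq> {..<u}" using im by blast
    show "\<omega> ` nslots (Suc l) j \<subseteq> {..<u} - \<omega> ` (slots - nslots (Suc l) j)" using dis im sub by blast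
  qed
  then obtain S where S: "inj_on fst S" "finite S" "\<forall>x\<in>S. Suc l < snd x"
    "{..<u} - \<omega> ` (slots - nslots (Suc l) j) \<subseteq> fst ` S"
    "steps_to kb pb {} (entering \<omega> d j) (remove_keys (\<omega> ` cs) (lower_keys (\<omega> ` zslots (Suc l) j) (Suc l) S))"
    by blast
  let ?S2 = "remove_keys (\<omega> ` cs) (lower_keys (\<omega> ` zslots (Suc l) j) (Suc l) S)"
  have K: "\<omega> ` zslots (Suc l) j \<subseteq> fst ` S" using S(4) dis im sub ns by blast
  note low = low_after_lower(1)[OF S(1,3) K KC]
  have "inj_on \<omega> (zslots (Suc l) j)" using inj sub ns by (auto intro: inj_on_subset)
  then have card: "card {x \<in> ?S2. snd x \<le> Suc l} = nz (Suc l)"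
    unfolding low using card_zslots by (simp add: card_image inj_on_def)
  have fin: "finite ?S2" using S(2) by (simp add: remove_keys_def lower_keys_def)
  have "correct_answers ?S2 (replicate (nz (Suc l)) ExtractMin @ rest) (drop (length (entering \<omega> d j)) as)"
    using S(5) assms(5) by (simp add: steps_to_def l)
  from low_extract_answers[OF fin card this]
  have "Some ` (\<lambda>k. (k, Suc l)) ` \<omega> ` zslots (Suc l) j \<subseteq> set (take (nz (Suc l)) (drop (length (entering \<omega> d j)) as))"
    unfolding low by simp
  then show ?thesis using z by (auto simp: l image_subset_iff)
qed

text \<open>The other half: a key deleted below the node has left the queue and cannot be reported.
  After a collision the closing extractions also reach keys above the level of the node, so validity
  needs enough keys in all; \<open>2 * card slots \<le> u\<close> provides them.\<close>

lemma conflict_answers: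
  assumes d: "d < H" "j < F * \<beta> ^ d" and l: "H - d = Suc l"
    and cs: "cs = (\<Union>i \<in> {\<beta> * j..<\<beta> * j + \<beta>}. nslots l i)"
    and inj: "inj_on \<omega> (slots - nslots (Suc l) j)" "inj_on \<omega> cs"
    and im: "\<omega> ` (slots - nslots (Suc l) j) \<subseteq> {..<u}"
      "\<omega> ` nslots (Suc l) j \<subseteq> {..<u} - \<omega> ` (slots - nslots (Suc l) j)"
    and u: "2 * card slots \<le> u"
  shows "u + r \<le> 2 ^ kb \<Longrightarrow> valid_requests kb pb {}
        (entering \<omega> d j @ replicate (nz (Suc l)) ExtractMin @ map (\<lambda>k. Insert k 0) [u..<u + r])"
    and "correct_answers {} (entering \<omega> d j @ replicate (nz (Suc l)) ExtractMin @ rest) as \<Longrightarrow>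
        Some (k, p) \<in> set (take (nz (Suc l)) (drop (length (entering \<omega> d j)) as)) \<Longrightarrow> k \<notin> \<omega> ` cs"
proof -
  obtain S where S: "inj_on fst S" "finite S" "{..<u} - \<omega> ` (slots - nslots (Suc l) j) \<subseteq> fst ` S"
    "fst ` S \<subseteq> {..<u}"
    "steps_to kb pb {} (entering \<omega> d j) (remove_keys (\<omega> ` cs) (lower_keys (\<omega> ` zslots (Suc l) j) (Suc l) S))"
    using entering_reaches[OF d l cs inj im] by blast
  let ?S1 = "lower_keys (\<omega> ` zslots (Suc l) j) (Suc l) S"
  let ?S2 = "remove_keys (\<omega> ` cs) ?S1"
  have inj1: "inj_on fst ?S1" using S(1) by (rule inj_on_lower_keys)
  have fst2: "fst ` ?S2 = fst ` S - \<omega> ` cs" by (simp add: fst_remove_keys[OF inj1] fst_lower_keys)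
  have inj2: "inj_on fst ?S2" using inj1 by (rule inj_on_remove_keys)
  have fin2: "finite ?S2" using S(2) by (simp add: remove_keys_def lower_keys_def)
  have ns: "nslots (Suc l) j = zslots (Suc l) j \<union> cs" by (simp add: nslots_Suc cs)
  have sub: "nslots (Suc l) j \<subseteq> slots" using nslots_subset_slots[of d j] d by (simp add: l)
  \<comment> \<open>Only keys of \<open>?X\<close> can be missing, that is, at most
    \<open>card slots\<close> of the \<open>u\<close> keys. At least \<open>card slots\<close> keys
    remain, enough for the extractions.\<close>
  let ?X = "(slots - nslots (Suc l) j) \<union> cs"
  have "{..<u} - \<omega> ` ?X \<subseteq> fst ` ?S2" unfolding fst2 using S(3) by blast
  then have "card ({..<u} - \<omega> ` ?X) \<le> card ?S2"
    using fin2 card_mono[of "fst ` ?S2"] card_image[OF inj2] by auto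
  moreover have "u - card (\<omega> ` ?X) \<le> card ({..<u} - \<omega> ` ?X)"
  proof -
    have "finite ?X" using finite_slots sub ns finite_subset[of _ slots] by auto
    then show ?thesis using diff_card_le_card_Diff[of "\<omega> ` ?X" "{..<u}"] by simp
  qed
  moreover have "card (\<omega> ` ?X) \<le> card slots"
  proof -
    have "?X \<subseteq> slots" using sub ns by blast
    then show ?thesis using finite_slots card_image_le[of ?X \<omega>] card_mono[of slots ?X] finite_subset
      by (meson le_trans)
  qed
  moreover have "nz (Suc l) \<le> card slots"
    using card_mono[OF finite_slots, of "zslots (Suc l) j"] sub ns card_zslots by auto
  ultimately have card2: "nz (Suc l) \<le> card ?S2" using u by linarith
  show "valid_requests kb pb {} (entering \<omega> d j @ replicate (nz (Suc l)) ExtractMin @ map (\<lambda>k. Insert k 0) [u..<u + r])"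
    if "u + r \<le> 2 ^ kb"
  proof -
    have "valid_requests kb pb ?S2 (replicate (nz (Suc l)) ExtractMin @ map (\<lambda>k. Insert k 0) [u..<u + r])"
      using fin2 card2
    proof (rule extract_valid)
      show "valid_requests kb pb S' (map (\<lambda>k. Insert k 0) [u..<u + r])" if "S' \<subseteq> ?S2" for S'
      proof (rule inserts_valid[OF \<open>u + r \<le> 2 ^ kb\<close>])
        have "fst ` S' \<subseteq> fst ` ?S2" using that by (rule image_mono)
        then show "fst ` S' \<subseteq> {..<u}" using S(4) fst2 by blast
      qed
    qed
    then show ?thesis using S(5) by (simp add: steps_to_def)
  qed
  show "k \<notin> \<omega> ` cs"
    if "correct_answers {} (entering \<omega> d j @ replicate (nz (Suc l)) ExtractMin @ rest) as"
       "Some (k, p) \<in> set (take (nz (Suc l)) (drop (length (entering \<omega> d j)) as))"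
  proof -
    have "correct_answers ?S2 (replicate (nz (Suc l)) ExtractMin @ rest) (drop (length (entering \<omega> d j)) as)"
      using S(5) that(1) by (simp add: steps_to_def)
    from extract_answers_subset[OF this] that(2) have "(k, p) \<in> ?S2" by auto
    then show ?thesis using fst2 by (force simp: image_iff)
  qed
qed

end

section \<open>Labels of runs in three phases\<close>

lemma card_bit_strings: "card {b :: bool list. length b = n} = 2 ^ n"
  and finite_bit_strings: "finite {b :: bool list. length b = n}"
  using card_lists_length_eq[of "UNIV :: bool set" n] finite_lists_length_eq[of "UNIV :: bool set" n] by auto

lemma card_bounded_lists:
  assumes "finite A" and "\<And>x. x \<in> S \<Longrightarrow> set x \<subseteq> A \<and> length x \<le> n"
  shows "finite S \<and> card S \<le> (card A + 1) ^ n"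
proof -
  have sub: "S \<subseteq> {xs. set xs \<subseteq> A \<and> length xs \<le> n}" using assms(2) by auto
  have fin: "finite {xs. set xs \<subseteq> A \<and> length xs \<le> n}" using assms(1) by (rule finite_lists_length_le)
  show ?thesis
    using finite_subset[OF sub fin] card_mono[OF fin sub] card_lists_le[OF assms(1), of n] by linarith
qed

text \<open>The opening phase depends only on \<open>Z\<close>, the child only on \<open>D\<close>,
  and the closing phase on neither, so runs of different pairs can be exchanged. The label
  \<open>q\<close> is the shape of the child's trace, \<open>\<gamma>\<close> the memory and the
  touched cells before it, \<open>\<rho>\<close> the memory after it and the recorded reads.
  \<open>R\<close> counts recorded addresses and contents, \<open>Y\<close> only addresses.\<close>

lemma phases_contradiction:
  fixes U :: "nat set" and I :: "'i set" and J :: "'j set" and X Y C R :: real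
    and pre :: "('j \<Rightarrow> nat) \<Rightarrow> request list" and mid :: "('i \<Rightarrow> nat) \<Rightarrow> request list"
  assumes fin: "finite U" "finite I" "finite J" and U: "U \<noteq> {}" and I: "card I = 2 * h"
    and G: "G \<subseteq> (I \<rightarrow>\<^sub>E U) \<times> (J \<rightarrow>\<^sub>E U)"
    and big: "real (card U) ^ (2 * h) * real (card U) ^ card J / 4 \<le> card G"
    and wf: "wf_machine M B w A"
    and runs: "\<And>D Z. (D, Z) \<in> G \<Longrightarrow> \<exists>as1 s1 e1 as2 s2 e2 as3 s3 e3.
       seq_trace A 0 (initial A) (pre Z) as1 s1 e1 \<and> seq_trace A imid s1 (mid D) as2 s2 e2 \<and>
       seq_trace A ipost s2 post as3 s3 e3 \<and> length e2 \<le> T \<and> length (recorded (written e2) e3) \<le> r"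
    and conflict: "\<And>D Z D' Z' as1 s1 e1 as2 s2 e2 as3 s3 e3 as2' s2' e2' s3'. (D, Z) \<in> G \<Longrightarrow> (D', Z') \<in> G \<Longrightarrow>
       seq_trace A 0 (initial A) (pre Z) as1 s1 e1 \<Longrightarrow>
       seq_trace A imid s1 (mid D) as2 s2 e2 \<Longrightarrow> seq_trace A ipost s2 post as3 s3 e3 \<Longrightarrow>
       seq_trace A imid s1 (mid D') as2' s2' e2' \<Longrightarrow> seq_trace A ipost s2' post as3 s3' e3 \<Longrightarrow>
       D' ` I \<inter> Z ` J = {}"
    and X: "X = (2 * 2 ^ w + 1) ^ T" and C: "C = 2 ^ (M * w) * (2 ^ (B * w) + 1) ^ T"
    and R: "R = 2 ^ (M * w) * (2 ^ w * 2 ^ (B * w) + 1) ^ r" and Y: "Y = (2 ^ w + 1) ^ r"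
    and s: "0 < s"
    and small: "(1/16) ^ h + R * (1 / (16 * real s)) ^ h \<le> 1 / (16 * X)"
    and final: "(63/64) ^ card J < 1 / (8 * X * C) * (1 / (16 * X * Y)) ^ s"
  shows False
proof -
  have "\<exists>x. case x of (s1, e2, s2, e3) \<Rightarrow> (\<exists>as1 e1 as2 as3 s3.
       seq_trace A 0 (initial A) (pre Z) as1 s1 e1 \<and> seq_trace A imid s1 (mid D) as2 s2 e2 \<and>
       seq_trace A ipost s2 post as3 s3 e3 \<and> length e2 \<le> T \<and> length (recorded (written e2) e3) \<le> r)"
    if "(D, Z) \<in> G" for D Z using runs[OF that] by (simp add: split_paired_Ex) blast
  then have "\<forall>p\<in>G. \<exists>x. case p of (D, Z) \<Rightarrow> case x of (s1, e2, s2, e3) \<Rightarrow> (\<exists>as1 e1 as2 as3 s3.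
       seq_trace A 0 (initial A) (pre Z) as1 s1 e1 \<and> seq_trace A imid s1 (mid D) as2 s2 e2 \<and>
       seq_trace A ipost s2 post as3 s3 e3 \<and> length e2 \<le> T \<and> length (recorded (written e2) e3) \<le> r)"
    by (simp add: split_paired_all)
  from bchoice[OF this] obtain f where f: "\<forall>p\<in>G. case p of (D, Z) \<Rightarrow> case f p of (s1, e2, s2, e3) \<Rightarrow> (\<exists>as1 e1 as2 as3 s3.
       seq_trace A 0 (initial A) (pre Z) as1 s1 e1 \<and> seq_trace A imid s1 (mid D) as2 s2 e2 \<and>
       seq_trace A ipost s2 post as3 s3 e3 \<and> length e2 \<le> T \<and> length (recorded (written e2) e3) \<le> r)"
    by blast
  define e2 s2 e3 where "e2 = (\<lambda>D Z. fst (snd (f (D, Z))))" and "s2 = (\<lambda>D Z. fst (snd (snd (f (D, Z)))))"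
    and "e3 = (\<lambda>D Z. snd (snd (snd (f (D, Z)))))"
  have f': "\<exists>s1 as1 e1 as2 as3 s3.
       seq_trace A 0 (initial A) (pre Z) as1 s1 e1 \<and> seq_trace A imid s1 (mid D) as2 (s2 D Z) (e2 D Z) \<and>
       seq_trace A ipost (s2 D Z) post as3 s3 (e3 D Z) \<and> length (e2 D Z) \<le> T \<and>
       length (recorded (written (e2 D Z)) (e3 D Z)) \<le> r" if "(D, Z) \<in> G" for D Z
  proof -
    obtain a b c d where x: "f (D, Z) = (a, b, c, d)" by (cases "f (D, Z)")
    have "\<exists>as1 e1 as2 as3 s3.
       seq_trace A 0 (initial A) (pre Z) as1 a e1 \<and> seq_trace A imid a (mid D) as2 c b \<and>
       seq_trace A ipost c post as3 s3 d \<and> length b \<le> T \<and> length (recorded (written b) d) \<le> r"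
      using bspec[OF f that] by (simp only: x prod.case)
    then show ?thesis unfolding e2_def s2_def e3_def x fst_conv snd_conv by blast
  qed
  \<comment> \<open>By determinism the configuration before the child is a function of
    \<open>Z\<close> alone, as the form of \<open>\<gamma>\<close> requires.\<close>
  define s1 where "s1 = (\<lambda>Z. THE s. \<exists>as es. seq_trace A 0 (initial A) (pre Z) as s es)"
  have s1: "s1 Z = s" if "seq_trace A 0 (initial A) (pre Z) as s es" for Z s as es
    unfolding s1_def using that seq_trace_deterministic by (intro the_equality) blast+
  have tr: "\<exists>as1 e1 as2 as3 s3.
       seq_trace A 0 (initial A) (pre Z) as1 (s1 Z) e1 \<and> seq_trace A imid (s1 Z) (mid D) as2 (s2 D Z) (e2 D Z) \<and>
       seq_trace A ipost (s2 D Z) post as3 s3 (e3 D Z) \<and> length (e2 D Z) \<le> T \<and>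
       length (recorded (written (e2 D Z)) (e3 D Z)) \<le> r" if DZ: "(D, Z) \<in> G" for D Z
  proof -
    obtain s1' as1 e1 as2 as3 s3 where *: "seq_trace A 0 (initial A) (pre Z) as1 s1' e1"
      "seq_trace A imid s1' (mid D) as2 (s2 D Z) (e2 D Z)"
      "seq_trace A ipost (s2 D Z) post as3 s3 (e3 D Z)" "length (e2 D Z) \<le> T"
      "length (recorded (written (e2 D Z)) (e3 D Z)) \<le> r" using f'[OF DZ] by blast
    from s1[OF *(1)] * show ?thesis by blast
  qed
  have wf0: "wf_config M B w (initial A)" using wf by (simp add: wf_machine_def wf_config_def)
  have wfs: "wf_config M B w (s1 Z) \<and> wf_config M B w (s2 D Z) \<and>
      (\<forall>(k, wr, a, b) \<in> set (e2 D Z). a < 2 ^ w \<and> length b = B * w) \<and>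
      (\<forall>(k, wr, a, b) \<in> set (e3 D Z). a < 2 ^ w \<and> length b = B * w)" if DZ: "(D, Z) \<in> G" for D Z
  proof -
    obtain as1 e1 as2 as3 s3 where *: "seq_trace A 0 (initial A) (pre Z) as1 (s1 Z) e1"
      "seq_trace A imid (s1 Z) (mid D) as2 (s2 D Z) (e2 D Z)"
      "seq_trace A ipost (s2 D Z) post as3 s3 (e3 D Z)" using tr[OF DZ] by blast
    have 1: "wf_config M B w (s1 Z)" using seq_trace_wf[OF *(1) wf wf0] by blast
    note 2 = seq_trace_wf[OF *(2) wf 1]
    from 1 2 seq_trace_wf[OF *(3) wf conjunct1[OF 2]] show ?thesis by blast
  qed
  define q where "q = (\<lambda>D Z. shape (e2 D Z))"
  define \<gamma> where "\<gamma> = (\<lambda>(q0 :: (bool \<times> nat) list) Z. (fst (s1 Z), map (snd (s1 Z)) (map snd q0)))"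
  define \<rho> where "\<rho> = (\<lambda>D Z. (fst (s2 D Z), recorded (written (e2 D Z)) (e3 D Z)))"
  have agree: "\<forall>a \<in> set (addresses (e2 D Z)). snd (s1 Z) a = snd (s1 Z') a" and mem: "fst (s1 Z) = fst (s1 Z')"
    if "\<gamma> (q D Z) Z = \<gamma> (q D Z) Z'" for D Z Z'
    using that by (auto simp: \<gamma>_def q_def addresses_shape)
  show False
  proof (rule transcript_labels_contradiction[where q = q and \<gamma> = \<gamma> and \<rho> = \<rho> and X = X and C = C and R = R and Y = Y and s = s,
        OF fin U I G big])
    have "finite {q D Z |D Z. (D, Z) \<in> G} \<and>
       card {q D Z |D Z. (D, Z) \<in> G} \<le> (card ((UNIV :: bool set) \<times> {..<2 ^ w :: nat}) + 1) ^ T"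
    proof (rule card_bounded_lists)
      fix x assume "x \<in> {q D Z |D Z. (D, Z) \<in> G}"
      then obtain D Z where x: "x = q D Z" "(D, Z) \<in> G" by blast
      have "\<forall>(k, wr, a, b) \<in> set (e2 D Z). a < 2 ^ w" using wfs[OF x(2)] by fastforce
      then have "set x \<subseteq> UNIV \<times> {..<2 ^ w}" by (force simp: x q_def shape_def)
      moreover have "length x \<le> T" using tr[OF x(2)] by (auto simp: x q_def length_shape)
      ultimately show "set x \<subseteq> UNIV \<times> {..<2 ^ w} \<and> length x \<le> T" by blast
    qed simp
    then have "card {q D Z |D Z. (D, Z) \<in> G} \<le> (2 * 2 ^ w + 1) ^ T" by (simp add: card_cartesian_product)
    then have "real (card {q D Z |D Z. (D, Z) \<in> G}) \<le> real ((2 * 2 ^ w + 1) ^ T)" by (simp only: of_nat_le_iff)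
    then show "card {q D Z |D Z. (D, Z) \<in> G} \<le> X" by (simp add: X add.commute)
    show "1 \<le> X" by (simp add: X one_le_power)
    show "1 \<le> C" by (auto simp: C intro!: one_le_power mult_ge1_I)
    show "1 \<le> Y" by (simp add: Y one_le_power)
    show "card (\<gamma> q0 ` {Z. \<exists>D. (D, Z) \<in> G \<and> q D Z = q0}) \<le> C" for q0
    proof -
      let ?B = "{b :: bool list. length b = B * w}" and ?M = "{m :: bool list. length m = M * w}"
      let ?S = "\<gamma> q0 ` {Z. \<exists>D. (D, Z) \<in> G \<and> q D Z = q0}"
      have *: "finite (snd ` ?S) \<and> card (snd ` ?S) \<le> (card ?B + 1) ^ T"
      proof (rule card_bounded_lists)
        fix x assume "x \<in> snd ` ?S"
        then obtain D Z where x: "(D, Z) \<in> G" "q D Z = q0" "x = snd (\<gamma> q0 Z)" by blast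
        have "set x \<subseteq> ?B" using wfs[OF x(1)] by (auto simp: x(3) \<gamma>_def wf_config_def)
        moreover have "length x \<le> T" using tr[OF x(1)] x(2) by (auto simp: x(3) \<gamma>_def q_def length_shape)
        ultimately show "set x \<subseteq> ?B \<and> length x \<le> T" by blast
      qed (rule finite_bit_strings)
      have "?S \<subseteq> ?M \<times> snd ` ?S"
      proof
        fix x assume x: "x \<in> ?S"
        then obtain D Z where "(D, Z) \<in> G" "x = \<gamma> q0 Z" by blast
        then have "fst x \<in> ?M" using wfs[of D Z] by (simp add: \<gamma>_def wf_config_def)
        with x show "x \<in> ?M \<times> snd ` ?S" by (simp only: mem_Times_iff) simp
      qed
      then have "card ?S \<le> card (?M \<times> snd ` ?S)"
        using * finite_bit_strings by (intro card_mono) auto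
      also have "\<dots> \<le> 2 ^ (M * w) * (2 ^ (B * w) + 1) ^ T"
        using * by (simp add: card_cartesian_product card_bit_strings)
      finally have "real (card ?S) \<le> real (2 ^ (M * w) * (2 ^ (B * w) + 1) ^ T)" by (simp only: of_nat_le_iff)
      then show ?thesis by (simp add: C add.commute)
    qed
    show "card {\<rho> D Z |D Z. (D, Z) \<in> G} \<le> R"
    proof -
      let ?M = "{m :: bool list. length m = M * w}"
      let ?A = "{..<2 ^ w :: nat} \<times> {b :: bool list. length b = B * w}"
      let ?S = "{\<rho> D Z |D Z. (D, Z) \<in> G}"
      have *: "finite (snd ` ?S) \<and> card (snd ` ?S) \<le> (card ?A + 1) ^ r"
      proof (rule card_bounded_lists)
        fix x assume "x \<in> snd ` ?S"
        then obtain D Z where x: "(D, Z) \<in> G" "x = snd (\<rho> D Z)" by blast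
        have e3: "\<forall>(k, wr, a, b) \<in> set (e3 D Z). a < 2 ^ w \<and> length b = B * w" using wfs[OF x(1)] by blast
        have "a < 2 ^ w \<and> length b = B * w" if "(a, b) \<in> set (snd (\<rho> D Z))" for a b
          using recorded_wf[OF e3, of a b "written (e2 D Z)"] that by (simp add: \<rho>_def)
        then have "set x \<subseteq> ?A" by (auto simp: x(2))
        moreover have "length x \<le> r" using tr[OF x(1)] by (auto simp: x(2) \<rho>_def)
        ultimately show "set x \<subseteq> ?A \<and> length x \<le> r" by blast
      qed (simp add: finite_bit_strings)
      have "?S \<subseteq> ?M \<times> snd ` ?S"
      proof
        fix x assume x: "x \<in> ?S"
        then obtain D Z where "(D, Z) \<in> G" "x = \<rho> D Z" by blast
        then have "fst x \<in> ?M" using wfs[of D Z] by (simp add: \<rho>_def wf_config_def)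
        with x show "x \<in> ?M \<times> snd ` ?S" by (simp only: mem_Times_iff) simp
      qed
      then have "card ?S \<le> card (?M \<times> snd ` ?S)"
        using * finite_bit_strings by (intro card_mono) auto
      also have "\<dots> \<le> 2 ^ (M * w) * (2 ^ w * 2 ^ (B * w) + 1) ^ r"
        using * by (simp add: card_cartesian_product card_bit_strings)
      finally have "real (card ?S) \<le> real (2 ^ (M * w) * (2 ^ w * 2 ^ (B * w) + 1) ^ r)" by (simp only: of_nat_le_iff)
      then show ?thesis by (simp add: R add.commute)
    qed
    \<comment> \<open>Equal memory and equal contents of all touched cells make the child behave
      identically. So for fixed \<open>D\<close> the memory afterwards and all cells written by the
      child agree.\<close>
    have same: "e2 D Z = e2 D Z' \<and> fst (s2 D Z) = fst (s2 D Z') \<and>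
        (\<forall>a \<in> written (e2 D Z). snd (s2 D Z) a = snd (s2 D Z') a)"
      if G: "(D, Z) \<in> G" "(D, Z') \<in> G" "q D Z = q D Z'" "\<gamma> (q D Z) Z = \<gamma> (q D Z) Z'" for D Z Z'
    proof -
      obtain as2 where 1: "seq_trace A imid (s1 Z) (mid D) as2 (s2 D Z) (e2 D Z)" using tr[OF G(1)] by blast
      obtain as2' where 2: "seq_trace A imid (s1 Z') (mid D) as2' (s2 D Z') (e2 D Z')" using tr[OF G(2)] by blast
      have "reads_agree (e2 D Z) (snd (s1 Z'))"
        by (rule reads_agree_cong[of _ "snd (s1 Z)"]) (use seq_trace_agree[OF 1] agree[OF G(4)] in auto)
      from seq_trace_simulate[OF 1 this]
      have 3: "seq_trace A imid (s1 Z') (mid D) as2 (fst (s2 D Z), apply_writes (e2 D Z) (snd (s1 Z'))) (e2 D Z)"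
        by (simp add: mem[OF G(4)])
      have 4: "s2 D Z' = (fst (s2 D Z), apply_writes (e2 D Z) (snd (s1 Z')))" "e2 D Z' = e2 D Z"
        using seq_trace_deterministic[OF 3 2] by auto
      have "snd (s2 D Z) a = snd (s2 D Z') a" if "a \<in> written (e2 D Z)" for a
        using apply_writes_inside[OF that] seq_trace_agree[OF 1] 4 by simp
      with 4 show ?thesis by simp
    qed
    show "card {\<rho> D Z |Z. (D, Z) \<in> G \<and> q D Z = q0 \<and> \<gamma> q0 Z = c0} \<le> Y" for D q0 c0
    proof -
      let ?S = "{\<rho> D Z |Z. (D, Z) \<in> G \<and> q D Z = q0 \<and> \<gamma> q0 Z = c0}"
      let ?adr = "\<lambda>x :: bool list \<times> (nat \<times> bool list) list. map fst (snd x)"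
      \<comment> \<open>The recorded contents are those left by the child, which are the same
        throughout \<open>?S\<close>; hence the addresses alone determine the label.\<close>
      have inj: "inj_on ?adr ?S"
      proof (rule inj_onI)
        fix x y assume xy: "x \<in> ?S" "y \<in> ?S" "?adr x = ?adr y"
        then obtain Z Z' where Z: "(D, Z) \<in> G" "q D Z = q0" "\<gamma> q0 Z = c0" "x = \<rho> D Z"
          and Z': "(D, Z') \<in> G" "q D Z' = q0" "\<gamma> q0 Z' = c0" "y = \<rho> D Z'" by blast
        have sm: "e2 D Z = e2 D Z'" "fst (s2 D Z) = fst (s2 D Z')"
          "\<forall>a \<in> written (e2 D Z). snd (s2 D Z) a = snd (s2 D Z') a"
          using same[OF Z(1) Z'(1)] Z Z' by auto
        have cont: "snd xy = snd (s2 D Z) (fst xy)"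
          if that: "(D, Z'') \<in> G" "e2 D Z'' = e2 D Z" "\<forall>a \<in> written (e2 D Z). snd (s2 D Z) a = snd (s2 D Z'') a"
             "xy \<in> set (snd (\<rho> D Z''))" for Z'' xy
        proof -
          have "\<exists>as3 s3. seq_trace A ipost (s2 D Z'') post as3 s3 (e3 D Z'')" using tr[OF that(1)] by blast
          then obtain as3 s3 where t3: "seq_trace A ipost (s2 D Z'') post as3 s3 (e3 D Z'')" by blast
          have "fst xy \<in> written (e2 D Z'') \<and> snd (s2 D Z'') (fst xy) = snd xy"
            using seq_trace_agree[OF t3] that(4) by (intro recordedD[of "e3 D Z''"]) (auto simp: \<rho>_def)
          then show ?thesis using that by simp
        qed
        have "snd x = map (\<lambda>a. (a, snd (s2 D Z) a)) (?adr x)"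
          unfolding Z(4) map_map by (rule map_idI[symmetric]) (use cont[OF Z(1)] in \<open>auto simp: prod_eq_iff\<close>)
        moreover have "snd y = map (\<lambda>a. (a, snd (s2 D Z) a)) (?adr y)"
          unfolding Z'(4) map_map by (rule map_idI[symmetric]) (use cont[OF Z'(1)] sm in \<open>auto simp: prod_eq_iff\<close>)
        ultimately have "snd x = snd y" using xy(3) by simp
        then show "x = y" using sm(2) by (simp add: Z(4) Z'(4) \<rho>_def)
      qed
      have "card (?adr ` ?S) \<le> (card {..<2 ^ w :: nat} + 1) ^ r"
      proof (rule conjunct2[OF card_bounded_lists])
        fix x assume "x \<in> ?adr ` ?S"
        then obtain Z where x: "(D, Z) \<in> G" "x = map fst (snd (\<rho> D Z))" by blast
        have e3: "\<forall>(k, wr, a, b) \<in> set (e3 D Z). a < 2 ^ w \<and> length b = B * w" using wfs[OF x(1)] by blast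
        have "a < 2 ^ w \<and> length b = B * w" if "(a, b) \<in> set (snd (\<rho> D Z))" for a b
          using recorded_wf[OF e3, of a b "written (e2 D Z)"] that by (simp add: \<rho>_def)
        then have "set x \<subseteq> {..<2 ^ w}" by (auto simp: x(2))
        moreover have "length x \<le> r" using tr[OF x(1)] by (auto simp: x(2) \<rho>_def)
        ultimately show "set x \<subseteq> {..<2 ^ w} \<and> length x \<le> r" by blast
      qed simp
      then have "card ?S \<le> (2 ^ w + 1) ^ r" using card_image[OF inj] by simp
      then have "real (card ?S) \<le> real ((2 ^ w + 1) ^ r)" by (simp only: of_nat_le_iff)
      then show ?thesis by (simp add: Y add.commute)
    qed
    show "D' ` I \<inter> Z ` J = {}"
      if G: "(D, Z) \<in> G" "(D', Z') \<in> G" "q D Z = q D' Z'" "\<gamma> (q D Z) Z = \<gamma> (q D Z) Z'" "\<rho> D Z = \<rho> D' Z'"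
      for D Z D' Z'
    proof -
      obtain as1 e1 as2 as3 s3 where 1: "seq_trace A 0 (initial A) (pre Z) as1 (s1 Z) e1"
        "seq_trace A imid (s1 Z) (mid D) as2 (s2 D Z) (e2 D Z)"
        "seq_trace A ipost (s2 D Z) post as3 s3 (e3 D Z)" using tr[OF G(1)] by blast
      obtain as2' as3' s3' where 2: "seq_trace A imid (s1 Z') (mid D') as2' (s2 D' Z') (e2 D' Z')"
        "seq_trace A ipost (s2 D' Z') post as3' s3' (e3 D' Z')" using tr[OF G(2)] by blast
      have m: "fst (s2 D' Z') = fst (s2 D Z)" "fst (s1 Z') = fst (s1 Z)" using G(5) mem[OF G(4)] by (auto simp: \<rho>_def)
      have a: "seq_trace A imid (fst (s1 Z), snd (s1 Z)) (mid D) as2 (fst (s2 D Z), snd (s2 D Z)) (e2 D Z)"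
        "seq_trace A ipost (fst (s2 D Z), snd (s2 D Z)) post as3 s3 (e3 D Z)" using 1 by simp_all
      have b: "seq_trace A imid (fst (s1 Z), snd (s1 Z')) (mid D') as2' (fst (s2 D Z), snd (s2 D' Z')) (e2 D' Z')"
        "seq_trace A ipost (fst (s2 D Z), snd (s2 D' Z')) post as3' s3' (e3 D' Z')"
        using 2 unfolding m[symmetric] prod.collapse by simp_all
      have "\<exists>D'' s''. seq_trace A imid (fst (s1 Z), snd (s1 Z)) (mid D') as2' (fst (s2 D Z), D'') (e2 D' Z') \<and>
         seq_trace A ipost (fst (s2 D Z), D'') post as3 s'' (e3 D Z)"
        using G(3,5) agree[OF G(4)] by (intro seq_trace_exchange[OF a b]) (auto simp: q_def \<rho>_def)
      then obtain D'' s'' where c: "seq_trace A imid (s1 Z) (mid D') as2' (fst (s2 D Z), D'') (e2 D' Z')"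
        "seq_trace A ipost (fst (s2 D Z), D'') post as3 s'' (e3 D Z)" unfolding prod.collapse by blast
      show ?thesis by (rule conflict[OF G(1,2) 1 c])
    qed
  qed (use s small final in auto)
qed

section \<open>Runs on the tree\<close>

text \<open>The birthday estimate: collisions among \<open>k\<close> draws from \<open>u\<close>
  keys cost at most the fraction \<open>k ^ 2 / u\<close>.\<close>

lemma prod_falling_ge:
  fixes u :: nat
  assumes "0 < u"
  shows "k \<le> u \<Longrightarrow> real u ^ k * (1 - real k ^ 2 / u) \<le> (\<Prod>i<k. real (u - i))"
proof (induction k)
  case (Suc k)
  have u: "real u > 0" using assms by simp
  have "1 - real (Suc k) ^ 2 / u \<le> (1 - real k ^ 2 / u) * (1 - k / u)"
  proof -
    have "(1 - real k ^ 2 / u) * (1 - k / u) = 1 - (real k ^ 2 + k) / u + real k ^ 2 / u * (k / u)"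
      using u by (simp add: field_simps)
    moreover have "0 \<le> real k ^ 2 / u * (k / u)" using u by simp
    moreover have "(real k ^ 2 + k) / u \<le> real (Suc k) ^ 2 / u"
      using u by (intro divide_right_mono) (auto simp: power2_eq_square algebra_simps)
    ultimately show ?thesis by linarith
  qed
  then have "real u ^ Suc k * (1 - real (Suc k) ^ 2 / u) \<le> real u ^ Suc k * ((1 - real k ^ 2 / u) * (1 - k / u))"
    using u by (intro mult_left_mono) auto
  also have "\<dots> = real u ^ k * (1 - real k ^ 2 / u) * (u * (1 - k / u))" by simp
  also have "u * (1 - k / u) = real (u - k)" using u Suc.prems by (simp add: right_diff_distrib of_nat_diff)
  also have "real u ^ k * (1 - real k ^ 2 / u) * real (u - k) \<le> (\<Prod>i<k. real (u - i)) * real (u - k)"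
    using Suc by (intro mult_right_mono) auto
  finally show ?case by simp
qed simp

lemma card_injections_ge:
  assumes "finite K" and "finite U" and "U \<noteq> {}" and "2 * card K ^ 2 \<le> card U"
  shows "real (card U) ^ card K / 2 \<le> card {f \<in> K \<rightarrow>\<^sub>E U. inj_on f K}"
proof -
  have U: "0 < card U" using assms by (simp add: card_gt_0_iff)
  have "card K \<le> card K ^ 2" by (simp add: power2_eq_square)
  then have KU: "card K \<le> card U" using assms(4) by linarith
  have "card {f \<in> K \<rightarrow>\<^sub>E U. inj_on f K} = (\<Prod>i<card K. card U - i)"
    using card_inj_on_subset_funcset[OF assms(1,2), of K] by (simp add: lessThan_atLeast0)
  then have "real (card {f \<in> K \<rightarrow>\<^sub>E U. inj_on f K}) = (\<Prod>i<card K. real (card U - i))" by simp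
  moreover have "real (card U) ^ card K * (1/2) \<le> real (card U) ^ card K * (1 - real (card K) ^ 2 / card U)"
  proof -
    have "real (2 * card K ^ 2) \<le> real (card U)" using assms(4) by (simp only: of_nat_le_iff)
    then show ?thesis using U by (intro mult_left_mono) (auto simp: field_simps)
  qed
  ultimately show ?thesis using prod_falling_ge[OF U KU] by linarith
qed

text \<open>Outside the locale, because the number \<open>u\<close> of inserted keys is chosen from
  this length so that the whole sequence has length \<open>N\<close>.\<close>

fun node_length :: "nat \<Rightarrow> (nat \<Rightarrow> nat) \<Rightarrow> nat \<Rightarrow> nat" where
  "node_length \<beta> nz 0 = 2"
| "node_length \<beta> nz (Suc l) = 2 * nz (Suc l) + \<beta> * node_length \<beta> nz l"

context pq_tree
begin

abbreviation nlen :: "nat \<Rightarrow> nat" where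
  "nlen \<equiv> node_length \<beta> nz"

lemma length_concat_const: "(\<And>j. length (f j) = n) \<Longrightarrow> length (concat (map f js)) = length js * n"
  by (induction js) auto

lemma length_node: "length (node \<omega> l j) = nlen l"
proof (induction l arbitrary: j)
  case (Suc l)
  have "length (concat (map (node \<omega> l) [\<beta> * j..<\<beta> * j + \<beta>])) = length [\<beta> * j..<\<beta> * j + \<beta>] * nlen l"
    by (rule length_concat_const[OF Suc.IH])
  then show ?case by simp
qed simp

lemma length_nodes: "length (concat (map (node \<omega> l) js)) = length js * nlen l"
  by (rule length_concat_const[OF length_node])

text \<open>Every slot accounts for one \<open>DecreaseKey\<close> and one
  \<open>ExtractMin\<close>.\<close>

lemma card_nslots: "2 * card (nslots l j) \<le> nlen l"
proof (induction l arbitrary: j)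
  case 0
  then show ?case by (simp add: nslots_0)
next
  case (Suc l)
  have "card (\<Union>i \<in> {\<beta> * j..<\<beta> * j + \<beta>}. nslots l i) \<le> (\<Sum>i \<in> {\<beta> * j..<\<beta> * j + \<beta>}. card (nslots l i))"
    by (rule card_UN_le) simp
  then have "2 * card (\<Union>i \<in> {\<beta> * j..<\<beta> * j + \<beta>}. nslots l i) \<le> (\<Sum>i \<in> {\<beta> * j..<\<beta> * j + \<beta>}. 2 * card (nslots l i))"
    by (simp add: sum_distrib_left[symmetric])
  also have "\<dots> \<le> (\<Sum>i \<in> {\<beta> * j..<\<beta> * j + \<beta>}. nlen l)" by (intro sum_mono Suc.IH)
  also have "\<dots> = \<beta> * nlen l" by simp
  finally have "2 * card (\<Union>i \<in> {\<beta> * j..<\<beta> * j + \<beta>}. nslots l i) \<le> \<beta> * nlen l" .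
  moreover have "card (nslots (Suc l) j) \<le> nz (Suc l) + card (\<Union>i \<in> {\<beta> * j..<\<beta> * j + \<beta>}. nslots l i)"
    unfolding nslots_Suc using card_Un_le[of "zslots (Suc l) j"] by (simp add: card_zslots)
  ultimately show ?case unfolding node_length.simps by linarith
qed

lemma card_slots: "2 * card slots \<le> F * nlen H"
proof -
  have "card slots \<le> (\<Sum>j<F. card (nslots H j))" unfolding slots_def by (rule card_UN_le) simp
  then have "2 * card slots \<le> (\<Sum>j<F. 2 * card (nslots H j))" by (simp add: sum_distrib_left[symmetric])
  also have "\<dots> \<le> (\<Sum>j<F. nlen H)" by (intro sum_mono card_nslots)
  finally show ?thesis by simp
qed

lemma length_full_tree: "length (full \<omega>) = u + F * nlen H"
  by (simp add: full_def length_nodes)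

end

text \<open>The machine with its coins fixed. Correctness and termination cover all valid sequences
  of length \<open>N\<close>, since exchanged runs answer sequences outside the tree family;
  \<open>uN\<close> leaves fresh keys for their padding.\<close>

locale pq_run = pq_tree +
  fixes A :: machine and M B w N :: nat
  assumes wf: "wf_machine M B w A"
    and correct: "\<And>qs as c. length qs = N \<Longrightarrow> valid_requests kb pb {} qs \<Longrightarrow>
      seq_run A 0 (initial A) qs as c \<Longrightarrow> correct_answers {} qs as"
    and terminates: "\<And>qs. length qs = N \<Longrightarrow> valid_requests kb pb {} qs \<Longrightarrow>
      \<exists>as c. seq_run A 0 (initial A) qs as c"
    and length_full_N: "length (full (\<lambda>_. 0)) = N"
    and uN: "u + N \<le> 2 ^ kb"
    and slots_u: "2 * card slots \<le> u"
begin

lemma length_full: "length (full \<omega>) = N"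
  using length_full_N by (simp add: full_def length_nodes)

declare before.simps(2) [simp del] after.simps(2) [simp del]

text \<open>Lengths do not depend on the keys, so any assignment may be used, here the constant
  \<open>0\<close>.\<close>

definition start :: "nat \<Rightarrow> nat \<Rightarrow> nat" where
  "start d j = length (before (\<lambda>_. 0) d j)"

definition span :: "nat \<Rightarrow> nat \<Rightarrow> nat set" where
  "span d j = {start d j..<start d j + nlen (H - d)}"

definition later_span :: "nat \<Rightarrow> nat \<Rightarrow> nat set" where
  "later_span d j = {start (Suc d) j + nlen (H - Suc d)..<
     start (Suc d) j + nlen (H - Suc d) + length (later (\<lambda>_. 0) d j)}"

lemma length_before: "length (before \<omega> d j) = start d j"
proof -
  have "length (before \<omega> d j) = length (before \<omega>' d j)" for \<omega> \<omega>'
    by (induction d arbitrary: j) (simp_all only: before.simps length_append length_map length_nodes)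
  then show ?thesis by (simp add: start_def)
qed

lemma length_later: "length (later \<omega> d j) = length (later (\<lambda>_. 0) d j)"
  by (simp add: later_def length_nodes)

definition configs :: "(slot \<Rightarrow> nat) set" where
  "configs = {\<omega> \<in> slots \<rightarrow>\<^sub>E {..<u}. inj_on \<omega> slots}"

definition trace :: "(slot \<Rightarrow> nat) \<Rightarrow> event list" where
  "trace \<omega> = (SOME es. \<exists>as s. seq_trace A 0 (initial A) (full \<omega>) as s es)"

definition inner_ios :: "(slot \<Rightarrow> nat) \<Rightarrow> nat \<Rightarrow> nat \<Rightarrow> nat" where
  "inner_ios \<omega> d j = length (filter (\<lambda>e. fst e \<in> span d j) (trace \<omega>))"

text \<open>Initially no cell has a last writer, so reads of the initial disk are charged to no
  node.\<close>

definition transferred :: "(slot \<Rightarrow> nat) \<Rightarrow> nat \<Rightarrow> nat \<Rightarrow> nat" where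
  "transferred \<omega> d j = length (filter (\<lambda>(k', k). k' \<in> Some ` span (Suc d) j \<and> k \<in> later_span d j)
     (transfers (\<lambda>_. None) (trace \<omega>)))"

lemma finite_configs: "finite configs"
  by (rule finite_subset[of _ "slots \<rightarrow>\<^sub>E {..<u}"]) (auto simp: configs_def finite_slots intro!: finite_PiE)

lemma configs_valid: "\<omega> \<in> configs \<Longrightarrow> valid_requests kb pb {} (full \<omega>)"
  by (intro full_valid) (auto simp: configs_def PiE_def Pi_def)

lemma configs_trace:
  assumes "\<omega> \<in> configs"
  shows "\<exists>as s. seq_trace A 0 (initial A) (full \<omega>) as s (trace \<omega>) \<and> correct_answers {} (full \<omega>) as"
proof -
  note v = configs_valid[OF assms]
  obtain as c where r: "seq_run A 0 (initial A) (full \<omega>) as c"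
    using terminates[OF length_full v] by blast
  then obtain s es where "seq_trace A 0 (initial A) (full \<omega>) as s es" using seq_run_imp_seq_trace by blast
  then have "\<exists>es as s. seq_trace A 0 (initial A) (full \<omega>) as s es" by blast
  from someI_ex[OF this] obtain as' s' where t: "seq_trace A 0 (initial A) (full \<omega>) as' s' (trace \<omega>)"
    unfolding trace_def by blast
  from correct[OF length_full v seq_trace_imp_seq_run[OF t]] t show ?thesis by blast
qed

lemma seq_trace_split4:
  assumes "seq_trace A 0 s0 (qs1 @ qs2 @ qs3 @ qs4) as s es"
  shows "\<exists>as1 s1 e1 as2 s2 e2 as3 s3 e3 as4 e4. seq_trace A 0 s0 qs1 as1 s1 e1 \<and>
    seq_trace A (length qs1) s1 qs2 as2 s2 e2 \<and>
    seq_trace A (length qs1 + length qs2) s2 qs3 as3 s3 e3 \<and>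
    seq_trace A (length qs1 + length qs2 + length qs3) s3 qs4 as4 s e4 \<and>
    as = as1 @ as2 @ as3 @ as4 \<and> es = e1 @ e2 @ e3 @ e4 \<and>
    length as1 = length qs1 \<and> length as2 = length qs2 \<and> length as3 = length qs3"
proof -
  from assms obtain as1 asr s1 e1 er where 1: "as = as1 @ asr" "es = e1 @ er" "length as1 = length qs1"
    "seq_trace A 0 s0 qs1 as1 s1 e1" "seq_trace A (0 + length qs1) s1 (qs2 @ qs3 @ qs4) asr s er"
    by (rule seq_trace_appendE)
  from 1(5) obtain as2 asr' s2 e2 er' where 2: "asr = as2 @ asr'" "er = e2 @ er'" "length as2 = length qs2"
    "seq_trace A (0 + length qs1) s1 qs2 as2 s2 e2" "seq_trace A (0 + length qs1 + length qs2) s2 (qs3 @ qs4) asr' s er'"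
    by (rule seq_trace_appendE)
  from 2(5) obtain as3 as4 s3 e3 e4 where 3: "asr' = as3 @ as4" "er' = e3 @ e4" "length as3 = length qs3"
    "seq_trace A (0 + length qs1 + length qs2) s2 qs3 as3 s3 e3"
    "seq_trace A (0 + length qs1 + length qs2 + length qs3) s3 qs4 as4 s e4"
    by (rule seq_trace_appendE)
  have "as = as1 @ as2 @ as3 @ as4" "es = e1 @ e2 @ e3 @ e4" using 1(1,2) 2(1,2) 3(1,2) by simp_all
  then show ?thesis using 1(3,4) 2(3,4) 3(3-5) unfolding add_0 by blast
qed

lemma full_split4:
  assumes "d < H" and "j < F * \<beta> ^ Suc d"
  shows "full \<omega> = before \<omega> (Suc d) j @ node \<omega> (H - Suc d) j @ later \<omega> d j @ after \<omega> d (j div \<beta>)"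
  using full_split[of "Suc d" j \<omega>] assms by (simp only: after_Suc)

lemma configs_phases:
  assumes "\<omega> \<in> configs" and d: "d < H" "j < F * \<beta> ^ Suc d"
  shows "\<exists>as1 s1 e1 as2 s2 e2 as3 s3 e3. seq_trace A 0 (initial A) (before \<omega> (Suc d) j) as1 s1 e1 \<and>
    seq_trace A (start (Suc d) j) s1 (node \<omega> (H - Suc d) j) as2 s2 e2 \<and>
    seq_trace A (start (Suc d) j + nlen (H - Suc d)) s2 (later \<omega> d j) as3 s3 e3 \<and>
    length e2 \<le> inner_ios \<omega> (Suc d) j \<and> length (recorded (written e2) e3) \<le> transferred \<omega> d j"
proof -
  obtain as s where "seq_trace A 0 (initial A) (full \<omega>) as s (trace \<omega>)"
    using configs_trace[OF assms(1)] by blast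
  then have "seq_trace A 0 (initial A) (before \<omega> (Suc d) j @ node \<omega> (H - Suc d) j @ later \<omega> d j @
    after \<omega> d (j div \<beta>)) as s (trace \<omega>)" by (simp only: full_split4[OF d])
  from seq_trace_split4[OF this] obtain as1 s1 e1 as2 s2 e2 as3 s3 e3 as4 e4 where
    t: "seq_trace A 0 (initial A) (before \<omega> (Suc d) j) as1 s1 e1"
      "seq_trace A (start (Suc d) j) s1 (node \<omega> (H - Suc d) j) as2 s2 e2"
      "seq_trace A (start (Suc d) j + nlen (H - Suc d)) s2 (later \<omega> d j) as3 s3 e3"
      "trace \<omega> = e1 @ e2 @ e3 @ e4" unfolding length_before length_node by blast
  have "k \<notin> span (Suc d) j" if "(k, e) \<in> set e1" for k e
    using seq_trace_tags[OF t(1) that] by (simp add: span_def length_before)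
  then have tags1: "\<forall>(k, e) \<in> set e1. k \<notin> span (Suc d) j" by blast
  have "k \<in> span (Suc d) j" if "(k, e) \<in> set e2" for k e
    using seq_trace_tags[OF t(2) that] by (simp add: span_def length_node)
  then have tags2: "\<forall>(k, e) \<in> set e2. k \<in> span (Suc d) j" by blast
  have "k \<notin> span (Suc d) j \<and> k \<in> later_span d j" if "(k, e) \<in> set e3" for k e
    using seq_trace_tags[OF t(3) that] by (simp add: span_def later_span_def length_later[of \<omega>])
  then have tags3: "\<forall>(k, e) \<in> set e3. k \<notin> span (Suc d) j \<and> k \<in> later_span d j" by blast
  have "filter (\<lambda>e. fst e \<in> span (Suc d) j) e2 = e2" using tags2 by (intro filter_True) auto
  then have "length e2 \<le> inner_ios \<omega> (Suc d) j" by (simp add: inner_ios_def t(4))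
  moreover have "length (recorded (written e2) e3) \<le> transferred \<omega> d j"
    unfolding transferred_def t(4) using tags1 tags2 tags3 by (rule length_recorded_le_transfers)
  ultimately show ?thesis using t by blast
qed

definition dslots :: "nat \<Rightarrow> nat \<Rightarrow> slot set" where
  "dslots l j = {(0, i, 0) |i. i div \<beta> ^ l = j}"

lemma dslots_subset: "dslots l j \<subseteq> nslots l j"
  by (auto simp: dslots_def nslots_def width_def)

lemma card_dslots: "card (dslots l j) = \<beta> ^ l"
proof -
  have "i div \<beta> ^ l = j \<longleftrightarrow> i \<in> {j * \<beta> ^ l..<Suc j * \<beta> ^ l}" for i
  proof -
    have p: "0 < \<beta> ^ l" using \<beta>_pos by simp
    have "j * \<beta> ^ l \<le> i \<longleftrightarrow> j \<le> i div \<beta> ^ l" using p by (simp add: less_eq_div_iff_mult_less_eq)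
    moreover have "i < Suc j * \<beta> ^ l \<longleftrightarrow> i div \<beta> ^ l < Suc j" using p by (simp add: div_less_iff_less_mult)
    ultimately show ?thesis by auto
  qed
  then have "dslots l j = (\<lambda>i. (0, i, 0)) ` {j * \<beta> ^ l..<Suc j * \<beta> ^ l}" by (auto simp: dslots_def)
  then show ?thesis by (simp add: card_image inj_on_def)
qed

end

locale pq_child = pq_run +
  fixes d j l :: nat and g :: "slot \<Rightarrow> nat" and I J Q :: "slot set" and U :: "nat set"
  assumes d: "d < H" and j: "j < F * \<beta> ^ Suc d" and l: "l = H - Suc d"
    and I: "I = dslots l j" and J: "J = zslots (Suc l) (j div \<beta>)" and Q: "Q = slots - (I \<union> J)"
    and g: "inj_on g Q" "g ` Q \<subseteq> {..<u}" "\<And>s. s \<notin> slots \<Longrightarrow> g s = undefined"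
    and U: "U = {..<u} - g ` Q"
begin

definition comb :: "(slot \<Rightarrow> nat) \<Rightarrow> (slot \<Rightarrow> nat) \<Rightarrow> slot \<Rightarrow> nat" where
  "comb D Z s = (if s \<in> I then D s else if s \<in> J then Z s else g s)"

definition pairs :: "((slot \<Rightarrow> nat) \<times> (slot \<Rightarrow> nat)) set" where
  "pairs = {(D, Z). D \<in> I \<rightarrow>\<^sub>E U \<and> Z \<in> J \<rightarrow>\<^sub>E U \<and> inj_on (comb D Z) (I \<union> J)}"

lemma l': "H - d = Suc l" using d l by simp

lemma j': "j div \<beta> < F * \<beta> ^ d" using j by (rule parent_index)

lemma parent_sub: "nslots (Suc l) (j div \<beta>) \<subseteq> slots"
  using nslots_subset_slots[of d "j div \<beta>"] d j' by (simp add: l')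

lemma I_sub: "I \<subseteq> nslots l j" unfolding I by (rule dslots_subset)

lemma I_sub': "I \<subseteq> nslots (Suc l) (j div \<beta>)" using I_sub nslots_parent by blast

lemma J_sub: "J \<subseteq> nslots (Suc l) (j div \<beta>)" unfolding J by (rule zslots_parent)

lemma IJ: "I \<inter> J = {}" using I_sub zslots_disjoint[of l "Suc l" "j div \<beta>" j] unfolding J by blast

lemma J_disj: "J \<inter> nslots l i = {}" unfolding J by (rule zslots_disjoint) simp

lemma finU: "finite U" and finI: "finite I" and finJ: "finite J"
  using U finite_subset[OF I_sub' finite_nslots] finite_subset[OF J_sub finite_nslots] by auto

text \<open>Allows an arbitrary \<open>X\<close>, because a combination of \<open>D\<close> and
  \<open>Z\<close> from different pairs may be injective only on parts of
  \<open>slots\<close>.\<close>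

lemma comb_inj:
  assumes "X \<subseteq> slots" and "inj_on (comb D Z) (X \<inter> (I \<union> J))" and "D ` I \<subseteq> U" and "Z ` J \<subseteq> U"
  shows "inj_on (comb D Z) X" and "comb D Z ` X \<subseteq> {..<u}"
proof -
  have inU: "comb D Z s \<in> U" if "s \<in> I \<union> J" for s using that assms(3,4) by (auto simp: comb_def)
  have out: "comb D Z s = g s \<and> s \<in> Q" if "s \<in> X" "s \<notin> I \<union> J" for s
    using that assms(1) by (auto simp: comb_def Q)
  have mixed: "comb D Z s \<noteq> comb D Z t" if "s \<in> I \<union> J" "t \<in> X" "t \<notin> I \<union> J" for s t
    using inU[OF that(1)] out[OF that(2,3)] unfolding U by auto
  show "inj_on (comb D Z) X"
  proof (rule inj_onI)
    fix s t assume st: "s \<in> X" "t \<in> X" "comb D Z s = comb D Z t"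
    show "s = t"
    proof (cases "s \<in> I \<union> J"; cases "t \<in> I \<union> J")
      assume "s \<in> I \<union> J" "t \<in> I \<union> J"
      then show ?thesis using inj_onD[OF assms(2) st(3)] st by simp
    next
      assume "s \<in> I \<union> J" "t \<notin> I \<union> J"
      then show ?thesis using mixed[of s t] st by simp
    next
      assume "s \<notin> I \<union> J" "t \<in> I \<union> J"
      then show ?thesis using mixed[of t s] st by simp
    next
      assume "s \<notin> I \<union> J" "t \<notin> I \<union> J"
      then show ?thesis using inj_onD[OF g(1), of s t] out[of s] out[of t] st by simp
    qed
  qed
  show "comb D Z ` X \<subseteq> {..<u}"
  proof
    fix x assume "x \<in> comb D Z ` X"
    then obtain s where s: "x = comb D Z s" "s \<in> X" by blast
    show "x \<in> {..<u}"
    proof (cases "s \<in> I \<union> J")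
      case True
      then show ?thesis using inU s unfolding U by blast
    next
      case False
      then show ?thesis using out[of s] s g(2) by auto
    qed
  qed
qed

lemma comb_disjoint:
  assumes "D ` I \<subseteq> U" and "Z ` J \<subseteq> U" and "I \<union> J \<subseteq> X" and "X \<subseteq> slots"
  shows "comb D Z ` X \<inter> comb D Z ` (slots - X) = {}"
proof (rule ccontr)
  assume "\<not> ?thesis"
  then obtain s t where st: "s \<in> X" "t \<in> slots" "t \<notin> X" "comb D Z s = comb D Z t" by fastforce
  then have t: "comb D Z t = g t" "t \<in> Q" using assms(3) by (auto simp: comb_def Q)
  show False
  proof (cases "s \<in> I \<union> J")
    case True
    then have "comb D Z s \<in> U" using assms(1,2) by (auto simp: comb_def)
    then show False using st t U by auto
  next
    case False
    then have "comb D Z s = g s" "s \<in> Q" using st assms(4) by (auto simp: comb_def Q)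
    then have "s = t" using st t g(1) by (auto dest: inj_onD)
    then show False using st by simp
  qed
qed

lemma pairsD: "(D, Z) \<in> pairs \<Longrightarrow> D ` I \<subseteq> U \<and> Z ` J \<subseteq> U"
  by (auto simp: pairs_def PiE_def Pi_def)

lemma comb_configs:
  assumes "(D, Z) \<in> pairs"
  shows "comb D Z \<in> configs"
proof -
  have "inj_on (comb D Z) (slots \<inter> (I \<union> J))" using assms unfolding pairs_def by (auto intro: inj_on_subset)
  note 1 = comb_inj[OF subset_refl this conjunct1[OF pairsD[OF assms]] conjunct2[OF pairsD[OF assms]]]
  have "comb D Z s = undefined" if "s \<notin> slots" for s
    using that I_sub' J_sub parent_sub g(3) by (auto simp: comb_def)
  with 1 show ?thesis by (auto simp: configs_def PiE_def extensional_def)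
qed

text \<open>With the next two lemmas, the product structure behind the exchange. The closing part
  does not depend on \<open>Z\<close> because \<open>ExtractMin\<close> names no key.\<close>

lemma before_comb: "before (comb D Z) (Suc d) j = before (comb D' Z) (Suc d) j"
proof (rule before_cong)
  show "comb D Z s = comb D' Z s" if "s \<notin> nslots (H - Suc d) j" for s
    using that I_sub by (auto simp: comb_def l)
qed (use d in simp)

lemma node_comb: "node (comb D Z) l j = node (comb D Z') l j"
proof (rule node_cong)
  show "comb D Z s = comb D Z' s" if "s \<in> nslots l j" for s
    using that J_disj[of j] by (auto simp: comb_def)
qed

lemma later_comb: "later (comb D Z) d j = later (comb D' Z') d j"
proof -
  have "node (comb D Z) l i = node (comb D' Z') l i" if "i \<noteq> j" for i
  proof (rule node_cong)
    show "comb D Z s = comb D' Z' s" if s: "s \<in> nslots l i" for s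
    proof -
      have "s \<notin> I" using I_sub s \<open>i \<noteq> j\<close> nslots_unique by blast
      moreover have "s \<notin> J" using J_disj s by blast
      ultimately show ?thesis by (simp add: comb_def)
    qed
  qed
  then have "map (node (comb D Z) l) [Suc j..<\<beta> * (j div \<beta>) + \<beta>] =
     map (node (comb D' Z') l) [Suc j..<\<beta> * (j div \<beta>) + \<beta>]" by (intro map_cong) auto
  then show ?thesis unfolding later_def l[symmetric] by (simp only:)
qed

text \<open>
  In the exchanged run a common key has been deleted before it is reported. The run is completed by
  insertions, because only full sequences of length \<open>N\<close> are guaranteed to be answered correctly.
\<close>

lemma conflict:
  assumes p: "(D, Z) \<in> pairs" "(D', Z') \<in> pairs"
    and t: "seq_trace A 0 (initial A) (before (comb D Z) (Suc d) j) as1 s1 e1"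
      "seq_trace A (start (Suc d) j) s1 (node (comb D Z) l j) as2 s2 e2"
      "seq_trace A (start (Suc d) j + nlen l) s2 (later (comb D Z) d j) as3 s3 e3"
    and t': "seq_trace A (start (Suc d) j) s1 (node (comb D' Z) l j) as2' s2' e2'"
      "seq_trace A (start (Suc d) j + nlen l) s2' (later (comb D Z) d j) as3 s3' e3"
  shows "D' ` I \<inter> Z ` J = {}"
proof (rule ccontr)
  assume "D' ` I \<inter> Z ` J \<noteq> {}"
  then obtain x where "x \<in> D' ` I" "x \<in> Z ` J" by blast
  then obtain i z where iz: "i \<in> I" "z \<in> J" "D' i = Z z" by (elim imageE) simp
  define \<omega> where "\<omega> = comb D Z"
  define \<omega>' where "\<omega>' = comb D' Z"
  define n where "n = nz (Suc l)"
  define cs where "cs = (\<Union>i \<in> {\<beta> * (j div \<beta>)..<\<beta> * (j div \<beta>) + \<beta>}. nslots l i)"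
  have ns: "nslots (Suc l) (j div \<beta>) = J \<union> cs" by (simp add: nslots_Suc cs_def J)
  have cs: "nslots l j \<subseteq> cs" using less_last_sibling[of j] unfolding cs_def by (intro UN_upper) simp
  have Jcs: "J \<inter> cs = {}" using J_disj unfolding cs_def by blast
  note l1 = l[symmetric]
  have enter: "entering \<omega>'' d (j div \<beta>) @ replicate n ExtractMin = before \<omega>'' (Suc d) j @ node \<omega>'' l j @ later \<omega>'' d j" for \<omega>''
    using entering_eq[of \<omega>'' d j] by (simp add: l' n_def l)
  have enter_rest: "entering \<omega>'' d (j div \<beta>) @ replicate n ExtractMin @ rest =
      before \<omega>'' (Suc d) j @ node \<omega>'' l j @ later \<omega>'' d j @ rest" for \<omega>'' rest
    using arg_cong[OF enter[of \<omega>''], of "\<lambda>qs. qs @ rest"] by simp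
  have len: "length (entering \<omega>'' d (j div \<beta>)) + n = start (Suc d) j + nlen l + length (later \<omega>'' d j)" for \<omega>''
    using arg_cong[OF enter[of \<omega>''], of length] by (simp add: length_before length_node)
  have len': "length (entering \<omega>' d (j div \<beta>)) = length (entering \<omega> d (j div \<beta>))"
    using len[of \<omega>] len[of \<omega>'] length_later[of \<omega> d j] length_later[of \<omega>' d j] by linarith
  have \<omega>: "\<omega> \<in> configs" unfolding \<omega>_def using p(1) by (rule comb_configs)
  obtain as s where r: "seq_trace A 0 (initial A) (full \<omega>) as s (trace \<omega>)" "correct_answers {} (full \<omega>) as"
    using configs_trace[OF \<omega>] by blast
  have full: "full \<omega> = before \<omega> (Suc d) j @ node \<omega> l j @ later \<omega> d j @ after \<omega> d (j div \<beta>)"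
    using full_split4[OF d j] by (simp add: l)
  from seq_trace_split4[OF r(1)[unfolded full]] obtain bs1 t1 f1 bs2 t2 f2 bs3 t3 f3 bs4 f4 where
    f: "seq_trace A 0 (initial A) (before \<omega> (Suc d) j) bs1 t1 f1"
      "seq_trace A (start (Suc d) j) t1 (node \<omega> l j) bs2 t2 f2"
      "seq_trace A (start (Suc d) j + nlen l) t2 (later \<omega> d j) bs3 t3 f3"
      "as = bs1 @ bs2 @ bs3 @ bs4" "length bs1 = start (Suc d) j" "length bs2 = nlen l"
      "length bs3 = length (later \<omega> d j)"
    unfolding length_before length_node by blast
  have b1: "t1 = s1" using seq_trace_deterministic[OF f(1) t(1)[folded \<omega>_def]] by simp
  have b2: "t2 = s2" using seq_trace_deterministic[OF f(2)[unfolded b1] t(2)[folded \<omega>_def]] by simp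
  have b3: "bs3 = as3" using seq_trace_deterministic[OF f(3)[unfolded b2] t(3)[folded \<omega>_def]] by simp
  have "correct_answers {} (entering \<omega> d (j div \<beta>) @ replicate (nz (H - d)) ExtractMin @ after \<omega> d (j div \<beta>)) as"
    using r(2) unfolding l' n_def[symmetric] enter_rest full .
  moreover have "inj_on \<omega> slots" "\<omega> ` slots \<subseteq> {..<u}" using \<omega> by (auto simp: configs_def PiE_def Pi_def)
  moreover have "z \<in> zslots (H - d) (j div \<beta>)" using iz by (simp add: J l')
  ultimately obtain pr where mem0: "Some (\<omega> z, pr) \<in> set (take n (drop (length (entering \<omega> d (j div \<beta>))) as))"
    using full_answers[OF d j', of \<omega> "after \<omega> d (j div \<beta>)" as z] by (auto simp: l' n_def)
  \<comment> \<open>The closing extractions are the last requests of the \<open>later\<close> part,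
    so their answers are the end of \<open>as3\<close> in either run.\<close>
  have take_eq: "take n (drop (length (entering \<omega> d (j div \<beta>))) (xs1 @ xs2 @ as3 @ xs4)) =
      drop (length (later \<omega> d j) - n) as3"
    if "length xs1 = start (Suc d) j" "length xs2 = nlen l" for xs1 xs2 xs4
  proof -
    have n: "n \<le> length (later \<omega> d j)" by (simp add: later_def l' n_def)
    have e: "length (entering \<omega> d (j div \<beta>)) = length xs1 + length xs2 + (length (later \<omega> d j) - n)"
      using len[of \<omega>] that n by linarith
    have a3: "length as3 = length (later \<omega> d j)" using f(7) b3 by simp
    show ?thesis unfolding e using n a3 by simp
  qed
  have mem: "Some (\<omega> z, pr) \<in> set (drop (length (later \<omega> d j) - n) as3)"
    using mem0 unfolding f(4) b3 take_eq[OF f(5,6)] .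
  define rr where "rr = N - (length (entering \<omega>' d (j div \<beta>)) + n)"
  define tail where "tail = map (\<lambda>k. Insert k 0) [u..<u + rr]"
  let ?qs = "entering \<omega>' d (j div \<beta>) @ replicate n ExtractMin @ tail"
  have "length (entering \<omega> d (j div \<beta>)) + n \<le> N"
  proof -
    have "length (entering \<omega> d (j div \<beta>)) + n \<le> length (full \<omega>)"
      unfolding full using len[of \<omega>] by (simp add: length_before length_node)
    then show ?thesis by (simp add: length_full)
  qed
  then have lenqs: "length ?qs = N" by (simp add: rr_def tail_def len')
  have D'U: "D' ` I \<subseteq> U" "Z ` J \<subseteq> U" using pairsD p by auto
  have injD': "inj_on D' I"
  proof -
    have "inj_on (comb D' Z') I" using p(2) unfolding pairs_def by (auto intro: inj_on_subset)
    then show ?thesis by (rule inj_on_cong[THEN iffD1, rotated]) (simp add: comb_def)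
  qed
  \<comment> \<open>\<open>D'\<close> and \<open>Z\<close> share a key, so \<open>\<omega>'\<close>
    is not injective on the subtree; the weaker hypotheses of \<open>conflict_answers\<close> still
    hold.\<close>
  have c1: "inj_on \<omega>' (slots - nslots (Suc l) (j div \<beta>))"
    "\<omega>' ` (slots - nslots (Suc l) (j div \<beta>)) \<subseteq> {..<u}"
    unfolding \<omega>'_def using comb_inj[OF _ _ D'U, of "slots - nslots (Suc l) (j div \<beta>)"] I_sub' J_sub
    by (auto simp: inj_on_def)
  have c2: "inj_on \<omega>' cs" unfolding \<omega>'_def
  proof (rule comb_inj(1)[OF _ _ D'U])
    show "cs \<subseteq> slots" using ns parent_sub by blast
    have "cs \<inter> (I \<union> J) \<subseteq> I" using Jcs by blast
    moreover have "inj_on (comb D' Z) I"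
      using injD' by (rule inj_on_cong[THEN iffD1, rotated]) (simp add: comb_def)
    ultimately show "inj_on (comb D' Z) (cs \<inter> (I \<union> J))" by (rule inj_on_subset[rotated])
  qed
  have c3: "\<omega>' ` nslots (Suc l) (j div \<beta>) \<subseteq> {..<u} - \<omega>' ` (slots - nslots (Suc l) (j div \<beta>))"
  proof (rule subset_diffI)
    show "\<omega>' ` nslots (Suc l) (j div \<beta>) \<subseteq> {..<u}"
    proof (clarify)
      fix a b c assume s: "(a, b, c) \<in> nslots (Suc l) (j div \<beta>)"
      \<comment> \<open>\<open>comb_inj\<close> bounds an image only under an injectivity condition,
        which is trivial on a singleton.\<close>
      have "\<omega>' ` {(a, b, c)} \<subseteq> {..<u}"
        unfolding \<omega>'_def using s parent_sub by (intro comb_inj(2)[OF _ _ D'U]) (auto simp: inj_on_def)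
      then show "\<omega>' (a, b, c) < u" by simp
    qed
    show "\<omega>' ` nslots (Suc l) (j div \<beta>) \<inter> \<omega>' ` (slots - nslots (Suc l) (j div \<beta>)) = {}"
      unfolding \<omega>'_def using I_sub' J_sub parent_sub by (intro comb_disjoint[OF D'U]) auto
  qed
  note ca = conflict_answers[OF d j' l' cs_def c1(1) c2 c1(2) c3 slots_u, folded n_def]
  have "u + rr \<le> 2 ^ kb" using uN by (simp add: rr_def)
  from ca(1)[OF this] have v: "valid_requests kb pb {} ?qs" by (simp add: tail_def)
  obtain as' c where "seq_run A 0 (initial A) ?qs as' c" using terminates[OF lenqs v] by blast
  then obtain s' es' where r': "seq_trace A 0 (initial A) ?qs as' s' es'" using seq_run_imp_seq_trace by blast
  have corr': "correct_answers {} ?qs as'" using correct[OF lenqs v seq_trace_imp_seq_run[OF r']] .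
  have "?qs = before \<omega>' (Suc d) j @ node \<omega>' l j @ later \<omega>' d j @ tail"
    by (rule enter_rest)
  from seq_trace_split4[OF r'[unfolded this]] obtain bs1 t1 f1 bs2 t2 f2 bs3 t3 f3 bs4 f4 where
    f': "seq_trace A 0 (initial A) (before \<omega>' (Suc d) j) bs1 t1 f1"
      "seq_trace A (start (Suc d) j) t1 (node \<omega>' l j) bs2 t2 f2"
      "seq_trace A (start (Suc d) j + nlen l) t2 (later \<omega>' d j) bs3 t3 f3"
      "as' = bs1 @ bs2 @ bs3 @ bs4" "length bs1 = start (Suc d) j" "length bs2 = nlen l"
    unfolding length_before length_node by blast
  have same: "before \<omega>' (Suc d) j = before \<omega> (Suc d) j" "later \<omega>' d j = later \<omega> d j"
    unfolding \<omega>_def \<omega>'_def by (rule before_comb, rule later_comb)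
  have b1: "t1 = s1" using seq_trace_deterministic[OF f'(1)[unfolded same] t(1)[folded \<omega>_def]] by simp
  have b2: "t2 = s2'" using seq_trace_deterministic[OF f'(2)[unfolded b1] t'(1)[folded \<omega>'_def]] by simp
  have b3: "bs3 = as3" using seq_trace_deterministic[OF f'(3)[unfolded b2 same] t'(2)[folded \<omega>_def]] by simp
  \<comment> \<open>The exchanged run gives the same closing answers and so reports the key
    \<open>\<omega> z = \<omega>' i\<close>, which it has deleted at a leaf of the child.\<close>
  have "Some (\<omega> z, pr) \<in> set (take n (drop (length (entering \<omega>' d (j div \<beta>))) as'))"
    using mem unfolding f'(4) b3 len' take_eq[OF f'(5,6)] .
  from ca(2)[OF corr' this] have "\<omega> z \<notin> \<omega>' ` cs" .
  moreover have "\<omega> z = \<omega>' i" using iz IJ by (auto simp: \<omega>_def \<omega>'_def comb_def)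
  ultimately show False using iz I_sub cs by blast
qed

end

text \<open>The numerical hypotheses of \<open>phases_contradiction\<close> together with the
  birthday condition, for \<open>k\<close> free keys.\<close>

definition parameters_ok :: "nat \<Rightarrow> nat \<Rightarrow> nat \<Rightarrow> nat \<Rightarrow> nat \<Rightarrow> nat \<Rightarrow> nat \<Rightarrow> nat \<Rightarrow> nat \<Rightarrow> bool" where
  "parameters_ok M B w h n T r s k \<longleftrightarrow> 0 < s \<and> 2 * (2 * h + n) ^ 2 \<le> k \<and>
    (1/16 :: real) ^ h + 2 ^ (M * w) * (2 ^ w * 2 ^ (B * w) + 1) ^ r * (1 / (16 * real s)) ^ h
      \<le> 1 / (16 * (2 * 2 ^ w + 1) ^ T) \<and>
    (63/64 :: real) ^ n < 1 / (8 * (2 * 2 ^ w + 1) ^ T * (2 ^ (M * w) * (2 ^ (B * w) + 1) ^ T)) *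
      (1 / (16 * (2 * 2 ^ w + 1) ^ T * (2 ^ w + 1) ^ r)) ^ s"

context pq_child
begin

lemma pairs_subset: "pairs \<subseteq> (I \<rightarrow>\<^sub>E U) \<times> (J \<rightarrow>\<^sub>E U)"
  by (auto simp: pairs_def)

lemma finite_pairs: "finite pairs"
  using pairs_subset finU finI finJ by (meson finite_PiE finite_SigmaI finite_subset)

lemma card_pairs_ge:
  assumes "U \<noteq> {}" and "2 * (card I + card J) ^ 2 \<le> card U"
  shows "real (card U) ^ card I * real (card U) ^ card J / 2 \<le> card pairs"
proof -
  let ?K = "I \<union> J"
  let ?F = "{f \<in> ?K \<rightarrow>\<^sub>E U. inj_on f ?K}"
  let ?split = "\<lambda>f. (restrict f I, restrict f J)"
  have K: "card ?K = card I + card J" using finI finJ IJ by (rule card_Un_disjoint)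
  have "inj_on ?split ?F"
  proof (rule inj_onI)
    fix f f' assume f: "f \<in> ?F" "f' \<in> ?F" "?split f = ?split f'"
    have "f x = f' x" for x
    proof (cases "x \<in> ?K")
      case True
      have "restrict f I x = restrict f' I x" "restrict f J x = restrict f' J x" using f(3) by simp_all
      then show ?thesis using True by (auto simp: restrict_def split: if_splits)
    next
      case False
      have "f \<in> ?K \<rightarrow>\<^sub>E U" "f' \<in> ?K \<rightarrow>\<^sub>E U" using f(1,2) by simp_all
      then show ?thesis using PiE_arb False by metis
    qed
    then show "f = f'" by blast
  qed
  moreover have "?split ` ?F \<subseteq> pairs"
  proof
    fix p assume "p \<in> ?split ` ?F"
    then obtain f where f: "p = ?split f" "f \<in> ?F" by blast
    have eq: "comb (restrict f I) (restrict f J) x = f x" if "x \<in> ?K" for x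
      using that by (auto simp: comb_def)
    have "inj_on (comb (restrict f I) (restrict f J)) ?K \<longleftrightarrow> inj_on f ?K" by (rule inj_on_cong) (rule eq)
    then have "inj_on (comb (restrict f I) (restrict f J)) ?K" using f(2) by simp
    moreover have "restrict f I \<in> I \<rightarrow>\<^sub>E U" "restrict f J \<in> J \<rightarrow>\<^sub>E U" using f(2) by auto
    ultimately show "p \<in> pairs" by (simp add: pairs_def f(1))
  qed
  ultimately have "card ?F \<le> card pairs"
    using finite_pairs by (rule card_inj_on_le)
  moreover have "real (card U) ^ card ?K / 2 \<le> card ?F"
    using finI finJ finU assms K by (intro card_injections_ge) auto
  ultimately show ?thesis by (simp add: K power_add)
qed

text \<open>If the average of the normalised cost were below \<open>1/2\<close>, at least half of
  the pairs would cost at most \<open>1\<close> and so respect both thresholds. With the birthday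
  factor \<open>1/2\<close> they fill a quarter of the product, as
  \<open>phases_contradiction\<close> asks. Adding the two normalised costs keeps the bound linear,
  ready for summation over nodes.\<close>

lemma fibre_bound:
  fixes rE tE :: real
  assumes h: "\<beta> ^ l = 2 * h" and pos: "0 < rE" "0 < tE"
    and ok: "parameters_ok M B w h (nz (Suc l)) (nat \<lfloor>tE\<rfloor>) (nat \<lfloor>rE\<rfloor>) s (card U)"
  shows "card pairs / 2 \<le>
    (\<Sum>(D, Z)\<in>pairs. transferred (comb D Z) d j / rE + inner_ios (comb D Z) (Suc d) j / tE)"
proof (rule ccontr)
  assume neg: "\<not> ?thesis"
  let ?f = "\<lambda>(D, Z). transferred (comb D Z) d j / rE + inner_ios (comb D Z) (Suc d) j / tE"
  define G where "G = {p \<in> pairs. ?f p \<le> 1}"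
  have cI: "card I = 2 * h" unfolding I card_dslots by (rule h)
  have cJ: "card J = nz (Suc l)" unfolding J by (rule card_zslots)
  have nonneg: "0 \<le> ?f p" for p using pos by (cases p) auto
  have "(\<Sum>p\<in>pairs. if ?f p \<le> 1 then 0 else 1) \<le> (\<Sum>p\<in>pairs. ?f p)"
    using nonneg by (intro sum_mono) auto
  moreover have "(\<Sum>p\<in>pairs. if ?f p \<le> 1 then 0 else 1 :: real) = card pairs - card G"
  proof -
    have "(\<Sum>p\<in>pairs. if ?f p \<le> 1 then 0 else 1 :: real) = card (pairs \<inter> - {p. ?f p \<le> 1})"
      using finite_pairs by (simp add: sum.If_cases)
    also have "pairs \<inter> - {p. ?f p \<le> 1} = pairs - G" unfolding G_def by blast
    finally have "(\<Sum>p\<in>pairs. if ?f p \<le> 1 then 0 else 1 :: real) = card (pairs - G)" .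
    then show ?thesis using finite_pairs by (simp add: card_Diff_subset G_def card_mono of_nat_diff)
  qed
  ultimately have G: "card pairs / 2 \<le> card G" using neg by linarith
  have two: "2 * (card I + card J) ^ 2 \<le> card U" using ok cI cJ by (simp add: parameters_ok_def)
  have "0 < card U"
  proof (rule ccontr)
    assume "\<not> 0 < card U"
    then have "card I = 0" using two by simp
    then show False using cI h \<beta>_pos by simp
  qed
  then have Une: "U \<noteq> {}" by auto
  have big: "real (card U) ^ (2 * h) * real (card U) ^ card J / 4 \<le> card G"
    using G card_pairs_ge[OF Une two] by (simp add: cI)
  have thr: "inner_ios (comb D Z) (Suc d) j \<le> nat \<lfloor>tE\<rfloor> \<and> transferred (comb D Z) d j \<le> nat \<lfloor>rE\<rfloor>"
    if "(D, Z) \<in> G" for D Z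
  proof -
    have le: "transferred (comb D Z) d j / rE + inner_ios (comb D Z) (Suc d) j / tE \<le> 1"
      using that by (simp add: G_def)
    have "0 \<le> transferred (comb D Z) d j / rE" "0 \<le> inner_ios (comb D Z) (Suc d) j / tE" using pos by auto
    then have "transferred (comb D Z) d j / rE \<le> 1" "inner_ios (comb D Z) (Suc d) j / tE \<le> 1" using le by linarith+
    then have "real (transferred (comb D Z) d j) \<le> rE" "real (inner_ios (comb D Z) (Suc d) j) \<le> tE"
      using pos by (simp_all add: divide_le_eq)
    then show ?thesis by (simp add: le_nat_floor)
  qed
  have Gp: "(D, Z) \<in> G \<Longrightarrow> (D, Z) \<in> pairs" for D Z by (simp add: G_def)
  let ?P1 = "\<lambda>Z. before (comb (\<lambda>_. 0) Z) (Suc d) j"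
  let ?P2 = "\<lambda>D. node (comb D (\<lambda>_. 0)) l j"
  let ?P3 = "later (comb (\<lambda>_. 0) (\<lambda>_. 0)) d j"
  have eqs: "before (comb D Z) (Suc d) j = ?P1 Z" "node (comb D Z) l j = ?P2 D" "later (comb D Z) d j = ?P3" for D Z
    by (rule before_comb, rule node_comb, rule later_comb)
  show False
  proof (rule phases_contradiction[where A = A and M = M and B = B and w = w and r = "nat \<lfloor>rE\<rfloor>" and T = "nat \<lfloor>tE\<rfloor>"
        and s = s and imid = "start (Suc d) j" and ipost = "start (Suc d) j + nlen l"
        and pre = ?P1 and mid = ?P2 and post = ?P3, OF finU finI finJ Une cI _ big wf _ _ refl refl refl refl])
    show "G \<subseteq> (I \<rightarrow>\<^sub>E U) \<times> (J \<rightarrow>\<^sub>E U)" using pairs_subset by (auto simp: G_def)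
    show "\<exists>as1 s1 e1 as2 s2 e2 as3 s3 e3.
       seq_trace A 0 (initial A) (?P1 Z) as1 s1 e1 \<and> seq_trace A (start (Suc d) j) s1 (?P2 D) as2 s2 e2 \<and>
       seq_trace A (start (Suc d) j + nlen l) s2 ?P3 as3 s3 e3 \<and> length e2 \<le> nat \<lfloor>tE\<rfloor> \<and>
       length (recorded (written e2) e3) \<le> nat \<lfloor>rE\<rfloor>" if DZ: "(D, Z) \<in> G" for D Z
    proof -
      obtain as1 s1 e1 as2 s2 e2 as3 s3 e3 where p: "seq_trace A 0 (initial A) (before (comb D Z) (Suc d) j) as1 s1 e1"
        "seq_trace A (start (Suc d) j) s1 (node (comb D Z) (H - Suc d) j) as2 s2 e2"
        "seq_trace A (start (Suc d) j + nlen (H - Suc d)) s2 (later (comb D Z) d j) as3 s3 e3"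
        "length e2 \<le> inner_ios (comb D Z) (Suc d) j" "length (recorded (written e2) e3) \<le> transferred (comb D Z) d j"
        using configs_phases[OF comb_configs[OF Gp[OF DZ]] d j] by blast
      have "length e2 \<le> nat \<lfloor>tE\<rfloor>" "length (recorded (written e2) e3) \<le> nat \<lfloor>rE\<rfloor>"
        using p(4,5) thr[OF DZ] by linarith+
      with p(1-3)[folded l] show ?thesis
        unfolding eqs(1)[of D Z, symmetric] eqs(2)[of D Z, symmetric] eqs(3)[of D Z, symmetric] by blast
    qed
    show "D' ` I \<inter> Z ` J = {}"
      if "(D, Z) \<in> G" "(D', Z') \<in> G" "seq_trace A 0 (initial A) (?P1 Z) as1 s1 e1"
       "seq_trace A (start (Suc d) j) s1 (?P2 D) as2 s2 e2" "seq_trace A (start (Suc d) j + nlen l) s2 ?P3 as3 s3 e3"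
       "seq_trace A (start (Suc d) j) s1 (?P2 D') as2' s2' e2'" "seq_trace A (start (Suc d) j + nlen l) s2' ?P3 as3 s3' e3"
      for D Z D' Z' as1 s1 e1 as2 s2 e2 as3 s3 e3 as2' s2' e2' s3'
    proof (rule conflict[OF Gp[OF that(1)] Gp[OF that(2)]])
      show "seq_trace A 0 (initial A) (before (comb D Z) (Suc d) j) as1 s1 e1"
        using that(3) unfolding eqs(1)[of D Z] .
      show "seq_trace A (start (Suc d) j) s1 (node (comb D Z) l j) as2 s2 e2"
        using that(4) unfolding eqs(2)[of D Z] .
      show "seq_trace A (start (Suc d) j + nlen l) s2 (later (comb D Z) d j) as3 s3 e3"
        using that(5) unfolding eqs(3)[of D Z] .
      show "seq_trace A (start (Suc d) j) s1 (node (comb D' Z) l j) as2' s2' e2'"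
        using that(6) unfolding eqs(2)[of D' Z] .
      show "seq_trace A (start (Suc d) j + nlen l) s2' (later (comb D Z) d j) as3 s3' e3"
        using that(7) unfolding eqs(3)[of D Z] .
    qed
  qed (use ok in \<open>auto simp: parameters_ok_def cJ\<close>)
qed

end

context pq_run
begin

lemma node_bound:
  fixes rE tE :: real
  assumes d: "d < H" and j: "j < F * \<beta> ^ Suc d" and h: "\<beta> ^ (H - Suc d) = 2 * h" and pos: "0 < rE" "0 < tE"
    and ok: "\<And>k. u - card slots \<le> k \<Longrightarrow>
      parameters_ok M B w h (nz (H - d)) (nat \<lfloor>tE\<rfloor>) (nat \<lfloor>rE\<rfloor>) s k"
  shows "card configs / 2 \<le> (\<Sum>\<omega>\<in>configs. transferred \<omega> d j / rE + inner_ios \<omega> (Suc d) j / tE)"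
proof -
  define l where "l = H - Suc d"
  define I where "I = dslots l j"
  define J where "J = zslots (Suc l) (j div \<beta>)"
  define Q where "Q = slots - (I \<union> J)"
  let ?f = "\<lambda>\<omega>. transferred \<omega> d j / rE + inner_ios \<omega> (Suc d) j / tE"
  have l': "H - d = Suc l" using d by (simp add: l_def)
  have fib: "card {\<omega> \<in> configs. restrict \<omega> Q = g} / 2 \<le> (\<Sum>\<omega> | \<omega> \<in> configs \<and> restrict \<omega> Q = g. ?f \<omega>)"
    if g: "g \<in> (\<lambda>\<omega>. restrict \<omega> Q) ` configs" for g
  proof -
    obtain \<omega>0 where \<omega>0: "\<omega>0 \<in> configs" "g = restrict \<omega>0 Q" using g by blast
    have Qs: "Q \<subseteq> slots" by (auto simp: Q_def)
    have "inj_on \<omega>0 Q" "\<omega>0 ` Q \<subseteq> {..<u}" using \<omega>0(1) Qs by (auto simp: configs_def intro: inj_on_subset)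
    then have gQ: "inj_on g Q" "g ` Q \<subseteq> {..<u}" by (simp_all add: \<omega>0(2))
    interpret pq_child \<beta> nz H F u kb pb A M B w N d j l g I J Q "{..<u} - g ` Q"
    proof unfold_locales
      show "g s = undefined" if "s \<notin> slots" for s using that Qs by (auto simp: \<omega>0(2))
    qed (use d j gQ in \<open>auto simp: l_def I_def J_def Q_def\<close>)
    have cU: "u - card slots \<le> card ({..<u} - g ` Q)"
    proof -
      have "card (g ` Q) \<le> card Q" using finite_subset[OF Qs finite_slots] by (rule card_image_le)
      also have "\<dots> \<le> card slots" using finite_slots Qs by (rule card_mono)
      finally have "card (g ` Q) \<le> card slots" .
      moreover have "card {..<u} - card (g ` Q) \<le> card ({..<u} - g ` Q)"
        using finite_subset[OF Qs finite_slots] by (intro diff_card_le_card_Diff) simp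
      ultimately show ?thesis by simp
    qed
    have eq: "{\<omega> \<in> configs. restrict \<omega> Q = g} = (\<lambda>(D, Z). comb D Z) ` pairs"
    proof (intro equalityI subsetI)
      fix \<omega> assume "\<omega> \<in> {\<omega> \<in> configs. restrict \<omega> Q = g}"
      then have \<omega>: "\<omega> \<in> slots \<rightarrow>\<^sub>E {..<u}" "inj_on \<omega> slots" "restrict \<omega> Q = g" by (auto simp: configs_def)
      have g_eq: "g s = \<omega> s" if "s \<in> Q" for s using that \<omega>(3) by auto
      have comb: "comb (restrict \<omega> I) (restrict \<omega> J) = \<omega>"
      proof
        fix s
        consider "s \<in> I" | "s \<in> J" "s \<notin> I" | "s \<in> Q" "s \<notin> I" "s \<notin> J" | "s \<notin> slots" "s \<notin> I" "s \<notin> J"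
          unfolding Q_def by blast
        then show "comb (restrict \<omega> I) (restrict \<omega> J) s = \<omega> s"
        proof cases
          case 4
          then have "\<omega> s = undefined" by (intro PiE_arb[OF \<omega>(1)])
          then show ?thesis using 4 g(3) by (simp add: comb_def)
        qed (auto simp: comb_def g_eq)
      qed
      have IJs: "I \<union> J \<subseteq> slots" using I_sub' J_sub parent_sub by blast
      have inU: "\<omega> s \<in> {..<u} - g ` Q" if s: "s \<in> I \<union> J" for s
      proof -
        have "\<omega> s < u" using PiE_mem[OF \<omega>(1), of s] s IJs by auto
        moreover have "\<omega> s \<noteq> g t" if t: "t \<in> Q" for t
        proof
          assume "\<omega> s = g t"
          then have "\<omega> s = \<omega> t" using g_eq[OF t] by simp
          then have "s = t" using \<omega>(2) s t IJs Qs by (auto dest!: inj_onD)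
          then show False using s t by (simp add: Q_def)
        qed
        ultimately show ?thesis by auto
      qed
      have "inj_on \<omega> (I \<union> J)" using \<omega>(2) IJs by (rule inj_on_subset)
      then have "(restrict \<omega> I, restrict \<omega> J) \<in> pairs"
        using inU by (simp add: pairs_def comb)
      then show "\<omega> \<in> (\<lambda>(D, Z). comb D Z) ` pairs" using comb by (intro image_eqI[of _ _ "(restrict \<omega> I, restrict \<omega> J)"]) simp_all
    next
      fix \<omega> assume "\<omega> \<in> (\<lambda>(D, Z). comb D Z) ` pairs"
      then obtain D Z where DZ: "(D, Z) \<in> pairs" "\<omega> = comb D Z" by auto
      have "restrict (comb D Z) Q = g"
      proof
        fix s show "restrict (comb D Z) Q s = g s"
        proof (cases "s \<in> Q")
          case True
          then have "comb D Z s = g s" by (simp add: comb_def Q_def)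
          with True show ?thesis by simp
        next
          case False
          then show ?thesis by (simp add: \<omega>0(2))
        qed
      qed
      with comb_configs[OF DZ(1)] show "\<omega> \<in> {\<omega> \<in> configs. restrict \<omega> Q = g}" by (simp add: DZ(2))
    qed
    have inj: "inj_on (\<lambda>(D, Z). comb D Z) pairs"
    proof (rule inj_onI, clarify)
      fix D Z D' Z' assume p: "(D, Z) \<in> pairs" "(D', Z') \<in> pairs" "comb D Z = comb D' Z'"
      have "D s = D' s" for s
      proof (cases "s \<in> I")
        case True
        then show ?thesis using fun_cong[OF p(3), of s] by (simp add: comb_def)
      next
        case False
        then have "D s = undefined" "D' s = undefined" using p(1,2) by (auto simp: pairs_def intro: PiE_arb)
        then show ?thesis by simp
      qed
      moreover have "Z s = Z' s" for s
      proof (cases "s \<in> J")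
        case True
        then show ?thesis using fun_cong[OF p(3), of s] IJ by (auto simp: comb_def split: if_splits)
      next
        case False
        then have "Z s = undefined" "Z' s = undefined" using p(1,2) by (auto simp: pairs_def intro: PiE_arb)
        then show ?thesis by simp
      qed
      ultimately show "D = D' \<and> Z = Z'" by blast
    qed
    have "parameters_ok M B w h (nz (Suc l)) (nat \<lfloor>tE\<rfloor>) (nat \<lfloor>rE\<rfloor>) s (card ({..<u} - g ` Q))"
      using ok[OF cU] by (simp only: l')
    from fibre_bound[OF h[folded l_def] pos this] show ?thesis
      unfolding eq sum.reindex[OF inj] card_image[OF inj] by (simp add: o_def case_prod_beta)
  qed
  have "real (card configs) / 2 = (\<Sum>\<omega>\<in>configs. 1 / 2)" by simp
  also have "\<dots> = (\<Sum>g \<in> (\<lambda>\<omega>. restrict \<omega> Q) ` configs. \<Sum>\<omega> | \<omega> \<in> configs \<and> restrict \<omega> Q = g. 1 / 2)"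
    using finite_configs by (rule sum.image_gen)
  also have "\<dots> \<le> (\<Sum>g \<in> (\<lambda>\<omega>. restrict \<omega> Q) ` configs. \<Sum>\<omega> | \<omega> \<in> configs \<and> restrict \<omega> Q = g. ?f \<omega>)"
  proof (rule sum_mono)
    fix g assume "g \<in> (\<lambda>\<omega>. restrict \<omega> Q) ` configs"
    from fib[OF this] show "(\<Sum>\<omega> | \<omega> \<in> configs \<and> restrict \<omega> Q = g. 1 / 2) \<le>
      (\<Sum>\<omega> | \<omega> \<in> configs \<and> restrict \<omega> Q = g. ?f \<omega>)" by simp
  qed
  also have "\<dots> = (\<Sum>\<omega>\<in>configs. ?f \<omega>)"
    using finite_configs by (rule sum.image_gen[symmetric])
  finally show ?thesis .
qed

section \<open>Request intervals of nodes and the charging of I/Os\<close>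

lemma start_Suc: "start (Suc d) j = start d (j div \<beta>) + nz (H - d) + (j mod \<beta>) * nlen (H - Suc d)"
proof -
  have "j - \<beta> * (j div \<beta>) = j mod \<beta>" by (simp add: minus_mult_div_eq_mod)
  then show ?thesis unfolding start_def before.simps(2) length_append length_map length_nodes by simp
qed

lemma nlen_parent: "d < H \<Longrightarrow> nlen (H - d) = 2 * nz (H - d) + \<beta> * nlen (H - Suc d)"
  by (metis level_step node_length.simps(2))

lemma child_end:
  assumes "d < H"
  shows "start (Suc d) j + nlen (H - Suc d) \<le> start d (j div \<beta>) + nz (H - d) + \<beta> * nlen (H - Suc d)"
proof -
  have "Suc (j mod \<beta>) * nlen (H - Suc d) \<le> \<beta> * nlen (H - Suc d)"
    using \<beta>_pos by (intro mult_right_mono) (auto simp: Suc_le_eq)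
  then show ?thesis by (simp add: start_Suc)
qed

lemma span_parent: "d < H \<Longrightarrow> span (Suc d) j \<subseteq> span d (j div \<beta>)"
  using child_end[of d j] nlen_parent[of d] start_Suc[of d j] by (auto simp: span_def)

lemma later_span_parent: "d < H \<Longrightarrow> later_span d j \<subseteq> span d (j div \<beta>)"
proof -
  assume d: "d < H"
  have "\<beta> * (j div \<beta>) + \<beta> - Suc j + Suc (j mod \<beta>) = \<beta>"
    using less_last_sibling[of j] mult_div_mod_eq[of \<beta> j] by linarith
  then have "(\<beta> * (j div \<beta>) + \<beta> - Suc j) * nlen (H - Suc d) + Suc (j mod \<beta>) * nlen (H - Suc d) = \<beta> * nlen (H - Suc d)"
    by (metis add_mult_distrib)
  moreover have "length (later (\<lambda>_. 0) d j) = (\<beta> * (j div \<beta>) + \<beta> - Suc j) * nlen (H - Suc d) + nz (H - d)"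
    unfolding later_def length_append length_nodes by simp
  ultimately show ?thesis
    using nlen_parent[OF d] start_Suc[of d j] by (auto simp: span_def later_span_def)
qed

lemma span_disjoint: "d \<le> H \<Longrightarrow> k \<in> span d j \<Longrightarrow> k \<in> span d j' \<Longrightarrow> j = j'"
proof (induction d arbitrary: j j')
  case 0
  have s: "start 0 j = u + j * nlen H" for j by (simp add: start_def length_nodes)
  show ?case
  proof (rule ccontr)
    assume "j \<noteq> j'"
    then consider "Suc j \<le> j'" | "Suc j' \<le> j" by linarith
    then show False
    proof cases
      case 1
      then have "Suc j * nlen H \<le> j' * nlen H" by (rule mult_le_mono1)
      then show False using 0 by (simp add: span_def s)
    next
      case 2
      then have "Suc j' * nlen H \<le> j * nlen H" by (rule mult_le_mono1)
      then show False using 0 by (simp add: span_def s)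
    qed
  qed
next
  case (Suc d)
  have "k \<in> span d (j div \<beta>)" "k \<in> span d (j' div \<beta>)"
    using Suc.prems span_parent[of d j] span_parent[of d j'] by auto
  then have div: "j div \<beta> = j' div \<beta>" using Suc by auto
  have "j mod \<beta> = j' mod \<beta>"
  proof (rule ccontr)
    assume "j mod \<beta> \<noteq> j' mod \<beta>"
    then consider "Suc (j mod \<beta>) \<le> j' mod \<beta>" | "Suc (j' mod \<beta>) \<le> j mod \<beta>" by linarith
    then show False
    proof cases
      case 1
      then have "Suc (j mod \<beta>) * nlen (H - Suc d) \<le> j' mod \<beta> * nlen (H - Suc d)" by (rule mult_le_mono1)
      then show False using Suc.prems by (simp add: span_def start_Suc div)
    next
      case 2
      then have "Suc (j' mod \<beta>) * nlen (H - Suc d) \<le> j mod \<beta> * nlen (H - Suc d)" by (rule mult_le_mono1)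
      then show False using Suc.prems by (simp add: span_def start_Suc div)
    qed
  qed
  with div show ?case by (metis mult_div_mod_eq)
qed

lemma span_ancestor: "d + e \<le> H \<Longrightarrow> span (d + e) j \<subseteq> span d (j div \<beta> ^ e)"
proof (induction e arbitrary: j)
  case (Suc e)
  have "span (d + Suc e) j \<subseteq> span (d + e) (j div \<beta>)" using span_parent[of "d + e" j] Suc.prems by simp
  also have "\<dots> \<subseteq> span d (j div \<beta> div \<beta> ^ e)" using Suc by simp
  finally show ?case by (simp add: div_mult2_eq)
qed simp

text \<open>A pair charged at depth \<open>d2\<close> has writer and reader in one node of depth
  \<open>d2\<close>, hence in one node of depth \<open>Suc d1\<close>, whereas a pair charged at
  \<open>d1\<close> is separated there. So a pair is charged only at the depth of the lowest node
  containing both requests.\<close>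

lemma transfer_not_deeper:
  assumes "d1 < d2" and "d2 < H" and "k' \<in> span (Suc d1) j1" "k \<in> later_span d1 j1"
    and "k' \<in> span (Suc d2) j2" "k \<in> later_span d2 j2"
  shows False
proof -
  define b where "b = j2 div \<beta> div \<beta> ^ (d2 - Suc d1)"
  have "span d2 (j2 div \<beta>) \<subseteq> span (Suc d1) b"
    using span_ancestor[of "Suc d1" "d2 - Suc d1" "j2 div \<beta>"] assms(1,2) by (simp add: b_def)
  moreover have "k' \<in> span d2 (j2 div \<beta>)" "k \<in> span d2 (j2 div \<beta>)"
    using span_parent[OF assms(2)] later_span_parent[OF assms(2)] assms(5,6) by auto
  ultimately have "k' \<in> span (Suc d1) b" "k \<in> span (Suc d1) b" by auto
  moreover have "j1 = b" using \<open>k' \<in> span (Suc d1) b\<close> assms(1-3) by (intro span_disjoint) auto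
  ultimately show False using assms(4) by (auto simp: span_def later_span_def)
qed

lemma sum_length_filter_le:
  assumes "finite S" and "\<And>a b x. a \<in> S \<Longrightarrow> b \<in> S \<Longrightarrow> P a x \<Longrightarrow> P b x \<Longrightarrow> a = b"
  shows "(\<Sum>a\<in>S. length (filter (P a) xs)) \<le> length xs"
proof (induction xs)
  case (Cons x xs)
  have "(\<Sum>a\<in>S. length (filter (P a) (x # xs))) = (\<Sum>a\<in>S. length (filter (P a) xs)) + card {a \<in> S. P a x}"
  proof -
    have "(\<Sum>a\<in>S. length (filter (P a) (x # xs))) = (\<Sum>a\<in>S. length (filter (P a) xs) + (if P a x then 1 else 0))"
      by (intro sum.cong) auto
    also have "\<dots> = (\<Sum>a\<in>S. length (filter (P a) xs)) + card {a \<in> S. P a x}"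
      using assms(1) by (simp add: sum.distrib sum.If_cases Int_def)
    finally show ?thesis .
  qed
  moreover have "card {a \<in> S. P a x} \<le> 1"
    using assms by (intro card_le_Suc0_iff_eq[THEN iffD2, unfolded One_nat_def[symmetric]]) auto
  ultimately show ?case using Cons by simp
qed simp

lemma sum_inner_ios: "d \<le> H \<Longrightarrow> finite Js \<Longrightarrow> (\<Sum>j\<in>Js. inner_ios \<omega> d j) \<le> length (trace \<omega>)"
  unfolding inner_ios_def using span_disjoint by (intro sum_length_filter_le) auto

text \<open>Over all levels at once, in contrast to \<open>sum_inner_ios\<close>: an I/O may lie
  inside one child on each level, but a transfer is charged at most once.\<close>

lemma sum_transferred:
  assumes "finite S" and "\<And>d j. (d, j) \<in> S \<Longrightarrow> d < H"
  shows "(\<Sum>(d, j)\<in>S. transferred \<omega> d j) \<le> length (trace \<omega>)"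
proof -
  have "(\<Sum>p\<in>S. length (filter (\<lambda>(k', k). k' \<in> Some ` span (Suc (fst p)) (snd p) \<and> k \<in> later_span (fst p) (snd p))
     (transfers (\<lambda>_. None) (trace \<omega>)))) \<le> length (transfers (\<lambda>_. None) (trace \<omega>))"
  proof (rule sum_length_filter_le[OF assms(1)])
    fix p q :: "nat \<times> nat" and x :: "nat option \<times> nat"
    assume pq: "p \<in> S" "q \<in> S"
      and P: "case x of (k', k) \<Rightarrow> k' \<in> Some ` span (Suc (fst p)) (snd p) \<and> k \<in> later_span (fst p) (snd p)"
         "case x of (k', k) \<Rightarrow> k' \<in> Some ` span (Suc (fst q)) (snd q) \<and> k \<in> later_span (fst q) (snd q)"
    obtain k' k where x: "x = (Some k', k)" "k' \<in> span (Suc (fst p)) (snd p)" "k \<in> later_span (fst p) (snd p)"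
      "k' \<in> span (Suc (fst q)) (snd q)" "k \<in> later_span (fst q) (snd q)" using P by (cases x) auto
    have H: "fst p < H" "fst q < H" using pq assms(2)[of "fst p" "snd p"] assms(2)[of "fst q" "snd q"] by auto
    have "fst p = fst q"
      using transfer_not_deeper[of "fst p" "fst q"] transfer_not_deeper[of "fst q" "fst p"] x H
      by (meson linorder_neqE_nat)
    moreover from this have "snd p = snd q" using span_disjoint[of "Suc (fst p)" k'] x H by auto
    ultimately show "p = q" by (rule prod_eqI)
  qed
  also have "\<dots> \<le> length (trace \<omega>)" by (rule length_transfers)
  finally show ?thesis by (simp add: transferred_def case_prod_beta)
qed

text \<open>The \<open>F * \<beta> ^ Suc d\<close> children at depth \<open>Suc d\<close> are
  charged in proportion to their \<open>\<beta> ^ (H - Suc d)\<close> leaves, so every level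
  contributes \<open>F * \<beta> ^ H * \<rho> / 2\<close>. I/Os inside children are counted once per
  level, with weight \<open>\<rho> / \<tau>\<close>. Evenness of \<open>\<beta>\<close> gives the
  children \<open>2 * h\<close> leaves.\<close>

lemma total_io_bound:
  fixes \<rho> \<tau> :: real
  assumes pos: "0 < \<rho>" "0 < \<tau>" and Ds: "Ds \<subseteq> {..<H}" and \<beta>: "even \<beta>" and low: "\<And>d. d \<in> Ds \<Longrightarrow> Suc d < H"
    and ok: "\<And>d k. d \<in> Ds \<Longrightarrow> u - card slots \<le> k \<Longrightarrow>
      parameters_ok M B w (\<beta> ^ (H - Suc d) div 2) (nz (H - d)) (nat \<lfloor>\<beta> ^ (H - Suc d) * \<tau>\<rfloor>)
        (nat \<lfloor>\<beta> ^ (H - Suc d) * \<rho>\<rfloor>) s k"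
  shows "card configs * (card Ds * (F * \<beta> ^ H) * \<rho> / 2) \<le>
    (\<Sum>\<omega>\<in>configs. (1 + card Ds * (\<rho> / \<tau>)) * length (trace \<omega>))"
proof -
  have finD: "finite Ds" using Ds finite_subset by blast
  have one: "card configs * (F * \<beta> ^ H * \<rho> / 2) \<le>
      (\<Sum>\<omega>\<in>configs. (\<Sum>j<F * \<beta> ^ Suc d. real (transferred \<omega> d j)) + \<rho> / \<tau> * length (trace \<omega>))"
    if dD: "d \<in> Ds" for d
  proof -
    define m where "m = real (\<beta> ^ (H - Suc d))"
    have m: "0 < m" using \<beta>_pos by (simp add: m_def)
    have d: "d < H" using dD Ds by auto
    have h: "\<beta> ^ (H - Suc d) = 2 * (\<beta> ^ (H - Suc d) div 2)" using low[OF dD] \<beta> by simp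
    have "card configs / 2 * (m * \<rho>) \<le> (\<Sum>\<omega>\<in>configs. transferred \<omega> d j + \<rho> / \<tau> * inner_ios \<omega> (Suc d) j)"
      if j: "j < F * \<beta> ^ Suc d" for j
    proof -
      have "card configs / 2 \<le> (\<Sum>\<omega>\<in>configs. transferred \<omega> d j / (m * \<rho>) + inner_ios \<omega> (Suc d) j / (m * \<tau>))"
        by (rule node_bound[OF d j h, where s = s]) (use ok[OF dD] m pos in \<open>auto simp: m_def\<close>)
      then have "card configs / 2 * (m * \<rho>) \<le>
         (\<Sum>\<omega>\<in>configs. transferred \<omega> d j / (m * \<rho>) + inner_ios \<omega> (Suc d) j / (m * \<tau>)) * (m * \<rho>)"
        using m pos by (intro mult_right_mono) auto
      also have "\<dots> = (\<Sum>\<omega>\<in>configs. transferred \<omega> d j + \<rho> / \<tau> * inner_ios \<omega> (Suc d) j)"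
        unfolding sum_distrib_right using m pos by (intro sum.cong) (auto simp: field_simps)
      finally show ?thesis .
    qed
    then have "(\<Sum>j<F * \<beta> ^ Suc d. card configs / 2 * (m * \<rho>)) \<le>
       (\<Sum>j<F * \<beta> ^ Suc d. \<Sum>\<omega>\<in>configs. transferred \<omega> d j + \<rho> / \<tau> * inner_ios \<omega> (Suc d) j)"
      by (intro sum_mono) auto
    also have "\<dots> = (\<Sum>\<omega>\<in>configs. \<Sum>j<F * \<beta> ^ Suc d. transferred \<omega> d j + \<rho> / \<tau> * inner_ios \<omega> (Suc d) j)"
      by (rule sum.swap)
    also have "\<dots> \<le> (\<Sum>\<omega>\<in>configs. (\<Sum>j<F * \<beta> ^ Suc d. real (transferred \<omega> d j)) + \<rho> / \<tau> * length (trace \<omega>))"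
    proof (rule sum_mono)
      fix \<omega>
      have "(\<Sum>j<F * \<beta> ^ Suc d. inner_ios \<omega> (Suc d) j) \<le> length (trace \<omega>)" using d by (intro sum_inner_ios) auto
      then have "(\<Sum>j<F * \<beta> ^ Suc d. real (inner_ios \<omega> (Suc d) j)) \<le> length (trace \<omega>)"
        by (simp only: of_nat_sum[symmetric] of_nat_le_iff)
      then have "\<rho> / \<tau> * (\<Sum>j<F * \<beta> ^ Suc d. real (inner_ios \<omega> (Suc d) j)) \<le> \<rho> / \<tau> * length (trace \<omega>)"
        using pos by (intro mult_left_mono) auto
      then show "(\<Sum>j<F * \<beta> ^ Suc d. transferred \<omega> d j + \<rho> / \<tau> * inner_ios \<omega> (Suc d) j) \<le>
        (\<Sum>j<F * \<beta> ^ Suc d. real (transferred \<omega> d j)) + \<rho> / \<tau> * length (trace \<omega>)"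
        by (simp add: sum.distrib sum_distrib_left)
    qed
    also have "(\<Sum>j<F * \<beta> ^ Suc d. card configs / 2 * (m * \<rho>)) = card configs * (F * \<beta> ^ H * \<rho> / 2)"
    proof -
      have "\<beta> ^ H = \<beta> ^ Suc d * \<beta> ^ (H - Suc d)" using d by (simp only: power_add[symmetric]) simp
      then have "real \<beta> ^ H = real \<beta> ^ Suc d * m" unfolding m_def by (metis of_nat_mult of_nat_power)
      then show ?thesis by (simp add: algebra_simps)
    qed
    finally show ?thesis .
  qed
  have "card configs * (card Ds * (F * \<beta> ^ H) * \<rho> / 2) = (\<Sum>d\<in>Ds. card configs * (F * \<beta> ^ H * \<rho> / 2))"
    by simp
  also have "\<dots> \<le> (\<Sum>d\<in>Ds. \<Sum>\<omega>\<in>configs. (\<Sum>j<F * \<beta> ^ Suc d. real (transferred \<omega> d j)) + \<rho> / \<tau> * length (trace \<omega>))"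
    using one by (intro sum_mono) auto
  also have "\<dots> = (\<Sum>\<omega>\<in>configs. \<Sum>d\<in>Ds. (\<Sum>j<F * \<beta> ^ Suc d. real (transferred \<omega> d j)) + \<rho> / \<tau> * length (trace \<omega>))"
    by (rule sum.swap)
  also have "\<dots> \<le> (\<Sum>\<omega>\<in>configs. (1 + card Ds * (\<rho> / \<tau>)) * length (trace \<omega>))"
  proof (rule sum_mono)
    fix \<omega>
    have "(\<Sum>d\<in>Ds. \<Sum>j<F * \<beta> ^ Suc d. transferred \<omega> d j) = (\<Sum>(d, j)\<in>(SIGMA d:Ds. {..<F * \<beta> ^ Suc d}). transferred \<omega> d j)"
      using finD by (intro sum.Sigma) auto
    also have "\<dots> \<le> length (trace \<omega>)" using finD Ds by (intro sum_transferred) auto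
    finally have "(\<Sum>d\<in>Ds. \<Sum>j<F * \<beta> ^ Suc d. real (transferred \<omega> d j)) \<le> length (trace \<omega>)"
      by (simp only: of_nat_sum[symmetric] of_nat_le_iff)
    then show "(\<Sum>d\<in>Ds. (\<Sum>j<F * \<beta> ^ Suc d. real (transferred \<omega> d j)) + \<rho> / \<tau> * length (trace \<omega>)) \<le>
      (1 + card Ds * (\<rho> / \<tau>)) * length (trace \<omega>)"
      by (simp add: sum.distrib algebra_simps)
  qed
  finally show ?thesis .
qed

end

section \<open>Random coins and small blocks\<close>

text \<open>Otherwise \<open>K < f x\<close> almost surely, and for finite \<open>K\<close> this
  makes the integral strictly larger than \<open>K\<close>.\<close>

lemma nn_integral_le_witness:
  assumes prob: "prob_space \<mu>" and f: "f \<in> borel_measurable \<mu>" and le: "(\<integral>\<^sup>+ x. f x \<partial>\<mu>) \<le> K"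
    and K: "K \<noteq> \<infinity>" and ae: "AE x in \<mu>. Q x"
  shows "\<exists>x \<in> space \<mu>. Q x \<and> f x \<le> K"
proof (rule ccontr)
  interpret prob_space \<mu> by (rule prob)
  assume neg: "\<not> ?thesis"
  have gt: "AE x in \<mu>. K < f x" using ae AE_space by eventually_elim (use neg in \<open>auto simp: not_le\<close>)
  have "\<not> (AE x in \<mu>. f x \<le> K)"
  proof
    assume "AE x in \<mu>. f x \<le> K"
    with gt have "AE x in \<mu>. False" by eventually_elim auto
    then show False using AE_False by auto
  qed
  then have "(\<integral>\<^sup>+ x. K \<partial>\<mu>) < (\<integral>\<^sup>+ x. f x \<partial>\<mu>)"
    using gt f K by (intro nn_integral_less) (auto simp: emeasure_space_1 elim: eventually_mono)
  with le show False by (simp add: emeasure_space_1)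
qed

instance request :: countable
  by countable_datatype

lemma prob_space_coin_space: "prob_space coin_space"
  unfolding coin_space_def by (rule prob_space_PiM) (rule prob_space_measure_pmf)

lemma io_cost_eq: "seq_run A 0 (initial A) qs as c \<Longrightarrow> io_cost A qs = of_nat c"
proof -
  assume r: "seq_run A 0 (initial A) qs as c"
  then have "{c. \<exists>as. seq_run A 0 (initial A) qs as c} = {c}" using seq_run_deterministic by blast
  then show ?thesis by (simp add: io_cost_def)
qed

lemma io_cost_finite: "io_cost A qs \<noteq> \<infinity> \<Longrightarrow> \<exists>as c. seq_run A 0 (initial A) qs as c"
proof (rule ccontr)
  assume "io_cost A qs \<noteq> \<infinity>" "\<not> (\<exists>as c. seq_run A 0 (initial A) qs as c)"
  moreover from this(2) have "{c. \<exists>as. seq_run A 0 (initial A) qs as c} = {}" by blast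
  ultimately show False by (simp add: io_cost_def)
qed

lemma request_counts: "num_insert qs + num_extract qs + num_decrease qs = length qs"
proof (induction qs)
  case (Cons q qs)
  then show ?case by (cases q) (auto simp: num_insert_def num_extract_def num_decrease_def)
qed (auto simp: num_insert_def num_extract_def num_decrease_def)

text \<open>The same coins must keep the total over \<open>X\<close> at most the bound on its
  expectation and terminate on every valid sequence, including those of exchanged runs. Bounding the
  three costs by their maximum leaves a bound in terms of the length \<open>N\<close> alone.\<close>

lemma exists_good_coins:
  fixes tI tE tD :: real
  assumes lv: "las_vegas_pq N M B w kb pb A" and ea: "expected_amortized N kb pb A tI tE tD"
    and fin: "finite X" and X: "\<And>x. x \<in> X \<Longrightarrow> length (f x) = N \<and> valid_requests kb pb {} (f x)"
  shows "\<exists>r. (\<forall>qs. length qs = N \<and> valid_requests kb pb {} qs \<longrightarrow> (\<exists>as c. seq_run (A r) 0 (initial (A r)) qs as c)) \<and>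
    (\<forall>c. (\<forall>x\<in>X. \<exists>as. seq_run (A r) 0 (initial (A r)) (f x) as (c x)) \<longrightarrow>
       (\<Sum>x\<in>X. real (c x)) \<le> card X * (N * max tI (max tE tD)))"
proof -
  define t where "t = max tI (max tE tD)"
  have t0: "0 \<le> t" using ea by (auto simp: expected_amortized_def t_def)
  have meas: "(\<lambda>r. io_cost (A r) qs) \<in> borel_measurable coin_space"
    if "length qs = N" "valid_requests kb pb {} qs" for qs
    using lv that by (simp add: las_vegas_pq_def)
  have int: "(\<integral>\<^sup>+ r. io_cost (A r) qs \<partial>coin_space) \<le> ennreal (N * t)"
    if qs: "length qs = N" "valid_requests kb pb {} qs" for qs
  proof -
    have "real (num_insert qs) * tI + real (num_extract qs) * tE + real (num_decrease qs) * tD \<le>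
        real (num_insert qs) * t + real (num_extract qs) * t + real (num_decrease qs) * t"
      by (intro add_mono mult_left_mono) (auto simp: t_def)
    also have "\<dots> = real (num_insert qs + num_extract qs + num_decrease qs) * t" by (simp add: algebra_simps)
    also have "\<dots> = N * t" using qs by (simp add: request_counts)
    finally have "ennreal (real (num_insert qs) * tI + real (num_extract qs) * tE + real (num_decrease qs) * tD) \<le> ennreal (N * t)"
      by (rule ennreal_leI)
    moreover have "(\<integral>\<^sup>+ r. io_cost (A r) qs \<partial>coin_space) \<le>
       ennreal (real (num_insert qs) * tI + real (num_extract qs) * tE + real (num_decrease qs) * tD)"
      using ea qs unfolding expected_amortized_def by blast
    ultimately show ?thesis by (rule order_trans[rotated])
  qed
  define V where "V = {qs. length qs = N \<and> valid_requests kb pb {} qs}"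
  have ae1: "AE r in coin_space. io_cost (A r) qs \<noteq> \<infinity>" if "qs \<in> V" for qs
  proof (rule nn_integral_noteq_infinite)
    show "(\<lambda>r. io_cost (A r) qs) \<in> borel_measurable coin_space" using that meas by (simp add: V_def)
    show "(\<integral>\<^sup>+ r. io_cost (A r) qs \<partial>coin_space) \<noteq> \<infinity>"
      using int[of qs] that by (auto simp: V_def top_unique)
  qed
  \<comment> \<open>Countability lets one null set serve all valid sequences.\<close>
  have "countable V" by (rule countableI_type)
  then have ae: "AE r in coin_space. \<forall>qs\<in>V. io_cost (A r) qs \<noteq> \<infinity>"
    using ae1 by (simp add: AE_ball_countable)
  have sum: "(\<integral>\<^sup>+ r. (\<Sum>x\<in>X. io_cost (A r) (f x)) \<partial>coin_space) \<le> ennreal (card X * (N * t))"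
  proof -
    have "(\<integral>\<^sup>+ r. (\<Sum>x\<in>X. io_cost (A r) (f x)) \<partial>coin_space) = (\<Sum>x\<in>X. \<integral>\<^sup>+ r. io_cost (A r) (f x) \<partial>coin_space)"
      using X meas by (intro nn_integral_sum) auto
    also have "\<dots> \<le> (\<Sum>x\<in>X. ennreal (N * t))" using X int by (intro sum_mono) auto
    also have "\<dots> = ennreal (card X * (N * t))" using t0 by (simp add: ennreal_of_nat_eq_real_of_nat ennreal_mult)
    finally show ?thesis .
  qed
  have "(\<lambda>r. \<Sum>x\<in>X. io_cost (A r) (f x)) \<in> borel_measurable coin_space"
    using X meas by (intro borel_measurable_sum) auto
  from nn_integral_le_witness[OF prob_space_coin_space this sum _ ae]
  obtain r where r: "\<forall>qs\<in>V. io_cost (A r) qs \<noteq> \<infinity>" "(\<Sum>x\<in>X. io_cost (A r) (f x)) \<le> ennreal (card X * (N * t))"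
    by auto
  have "(\<Sum>x\<in>X. real (c x)) \<le> card X * (N * t)" if c: "\<forall>x\<in>X. \<exists>as. seq_run (A r) 0 (initial (A r)) (f x) as (c x)" for c
  proof -
    have "(\<Sum>x\<in>X. io_cost (A r) (f x)) = (\<Sum>x\<in>X. ennreal (real (c x)))"
      using c by (intro sum.cong) (auto simp: io_cost_eq ennreal_of_nat_eq_real_of_nat)
    also have "\<dots> = ennreal (\<Sum>x\<in>X. real (c x))" by (intro sum_ennreal) auto
    finally have "ennreal (\<Sum>x\<in>X. real (c x)) \<le> ennreal (card X * (N * t))" using r(2) by simp
    then show ?thesis using t0 by (simp add: ennreal_le_iff)
  qed
  then show ?thesis using r(1) io_cost_finite unfolding V_def t_def by blast
qed

text \<open>The last insertion, present only for odd \<open>N\<close>, brings the length to exactly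
  \<open>N\<close>; its key is fresh.\<close>

definition sorting :: "nat \<Rightarrow> (nat \<Rightarrow> nat) \<Rightarrow> request list" where
  "sorting N x = map (\<lambda>i. Insert i (x i)) [0..<N div 2] @ replicate (N div 2) ExtractMin @
     map (\<lambda>k. Insert k 0) [N div 2..<N div 2 + N mod 2]"

lemma length_sorting: "length (sorting N x) = N"
  by (simp add: sorting_def) presburger

context
  fixes N kb pb :: nat and x :: "nat \<Rightarrow> nat"
  assumes N: "N \<le> 2 ^ kb" and x: "x \<in> {..<N div 2} \<rightarrow> {..<2 ^ pb}"
begin

lemma sorting_inserts:
  "steps_to kb pb {} (map (\<lambda>i. Insert i (x i)) [0..<N div 2]) ((\<lambda>i. (i, x i)) ` {..<N div 2})"
proof -
  have "steps_to kb pb {} (map (\<lambda>i. Insert i (x i)) [0..<N div 2])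
    ({} \<union> (\<lambda>i. (i, x i)) ` set [0..<N div 2])"
    using N x by (intro steps_to_inserts) (auto simp: Pi_def)
  then show ?thesis by (simp add: lessThan_atLeast0)
qed

lemma card_sorting_pairs: "card ((\<lambda>i. (i, x i)) ` {..<N div 2}) = N div 2"
  by (simp add: card_image inj_on_def)

lemma sorting_valid: "valid_requests kb pb {} (sorting N x)"
proof -
  have "valid_requests kb pb ((\<lambda>i. (i, x i)) ` {..<N div 2})
     (replicate (N div 2) ExtractMin @ map (\<lambda>k. Insert k 0) [N div 2..<N div 2 + N mod 2])"
  proof (rule extract_valid)
    show "valid_requests kb pb S' (map (\<lambda>k. Insert k 0) [N div 2..<N div 2 + N mod 2])"
      if "S' \<subseteq> (\<lambda>i. (i, x i)) ` {..<N div 2}" for S'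
    proof (rule inserts_valid)
      have "N div 2 + N mod 2 \<le> N" by presburger
      then show "N div 2 + N mod 2 \<le> 2 ^ kb" using N by linarith
      show "fst ` S' \<subseteq> {..<N div 2}" using that by auto
    qed
  qed (simp_all add: card_sorting_pairs)
  then show ?thesis using sorting_inserts by (simp add: steps_to_def sorting_def)
qed

lemma sorting_answers:
  assumes "correct_answers {} (sorting N x) as"
  shows "set (take (N div 2) (drop (N div 2) as)) = (\<lambda>i. Some (i, x i)) ` {..<N div 2}"
proof -
  let ?S = "(\<lambda>i. (i, x i)) ` {..<N div 2}"
  have c: "correct_answers ?S (replicate (N div 2) ExtractMin @ map (\<lambda>k. Insert k 0) [N div 2..<N div 2 + N mod 2])
     (drop (N div 2) as)"
    using sorting_inserts assms by (simp add: steps_to_def sorting_def)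
  have le: "{y \<in> ?S. snd y \<le> 2 ^ pb} = ?S" using x by (auto simp: Pi_def less_imp_le)
  have "Some ` ?S \<subseteq> set (take (N div 2) (drop (N div 2) as))"
    using low_extract_answers[of ?S "2 ^ pb", unfolded le, OF _ card_sorting_pairs c] by simp
  moreover have "set (take (N div 2) (drop (N div 2) as)) \<subseteq> Some ` ?S"
    using extract_answers_subset[OF c] .
  ultimately show ?thesis by (auto simp: image_image)
qed

end

text \<open>The memory after the insertions and the blocks read afterwards determine the answers and
  hence \<open>x\<close>. There are too few such descriptions for more than half of the
  \<open>x\<close> to cost at most \<open>thr\<close>, and each of the others costs more.\<close>

lemma sorting_io_bound:
  fixes c :: "(nat \<Rightarrow> nat) \<Rightarrow> nat" and thr :: real
  assumes wf: "wf_machine M B w A" and N: "N \<le> 2 ^ kb" "2 \<le> N"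
    and correct: "\<And>qs as c. length qs = N \<Longrightarrow> valid_requests kb pb {} qs \<Longrightarrow>
      seq_run A 0 (initial A) qs as c \<Longrightarrow> correct_answers {} qs as"
    and run: "\<And>x. x \<in> ({..<N div 2} \<rightarrow>\<^sub>E {..<2 ^ pb}) \<Longrightarrow> \<exists>as. seq_run A 0 (initial A) (sorting N x) as (c x)"
    and thr: "0 \<le> thr" "real (M * w) + real (B * w + 1) * thr + 1 < real (pb * (N div 2))"
  shows "card ({..<N div 2} \<rightarrow>\<^sub>E {..<2 ^ pb :: nat}) * (thr / 2) \<le> (\<Sum>x\<in>({..<N div 2} \<rightarrow>\<^sub>E {..<2 ^ pb}). real (c x))"
proof -
  define n where "n = N div 2"
  define X where "X = ({..<n} \<rightarrow>\<^sub>E {..<2 ^ pb :: nat})"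
  define S where "S = {x \<in> X. real (c x) \<le> thr}"
  define T where "T = nat \<lfloor>thr\<rfloor>"
  have finX: "finite X" by (simp add: X_def finite_PiE)
  have cX: "card X = 2 ^ (pb * n)" by (simp add: X_def card_PiE power_mult)
  let ?ins = "\<lambda>x. map (\<lambda>i. Insert i (x i)) [0..<n]"
  let ?rest = "replicate n ExtractMin @ map (\<lambda>k. Insert k 0) [n..<n + N mod 2]"
  have wf0: "wf_config M B w (initial A)" using wf by (simp add: wf_machine_def wf_config_def)
  have "\<exists>p. \<exists>as1 s1 e1 as2 s2 e2. seq_trace A 0 (initial A) (?ins x) as1 s1 e1 \<and>
      seq_trace A n s1 ?rest as2 s2 e2 \<and> p = (fst s1, read_blocks e2) \<and> length e2 \<le> c x \<and>
      length as1 = n \<and> correct_answers {} (sorting N x) (as1 @ as2)" if x: "x \<in> X" for x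
  proof -
    have x': "x \<in> {..<N div 2} \<rightarrow> {..<2 ^ pb}" using x by (auto simp: X_def n_def PiE_def)
    obtain as where r: "seq_run A 0 (initial A) (sorting N x) as (c x)" using run x by (auto simp: X_def n_def)
    obtain s2 es where t: "seq_trace A 0 (initial A) (sorting N x) as s2 es" "length es = c x"
      using seq_run_imp_seq_trace[OF r] by blast
    have ca: "correct_answers {} (sorting N x) as"
      using correct[OF length_sorting sorting_valid[OF N(1) x'] r] .
    have "seq_trace A 0 (initial A) (?ins x @ ?rest) as s2 es" using t(1) by (simp add: sorting_def n_def)
    then obtain as1 as2 s1 e1 e2 where "as = as1 @ as2" "es = e1 @ e2" "length as1 = length (?ins x)"
      "seq_trace A 0 (initial A) (?ins x) as1 s1 e1" "seq_trace A (0 + length (?ins x)) s1 ?rest as2 s2 e2"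
      by (rule seq_trace_appendE)
    then show ?thesis using ca t(2)
      by (intro exI[of _ "(fst s1, read_blocks e2)"] exI[of _ as1] exI[of _ s1] exI[of _ e1] exI[of _ as2]
          exI[of _ s2] exI[of _ e2]) simp
  qed
  then have "\<forall>x\<in>X. \<exists>p. \<exists>as1 s1 e1 as2 s2 e2. seq_trace A 0 (initial A) (?ins x) as1 s1 e1 \<and>
      seq_trace A n s1 ?rest as2 s2 e2 \<and> p = (fst s1, read_blocks e2) \<and> length e2 \<le> c x \<and>
      length as1 = n \<and> correct_answers {} (sorting N x) (as1 @ as2)" by blast
  from bchoice[OF this] obtain \<Phi> where \<Phi>: "\<forall>x\<in>X. \<exists>as1 s1 e1 as2 s2 e2. seq_trace A 0 (initial A) (?ins x) as1 s1 e1 \<and>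
      seq_trace A n s1 ?rest as2 s2 e2 \<and> \<Phi> x = (fst s1, read_blocks e2) \<and> length e2 \<le> c x \<and>
      length as1 = n \<and> correct_answers {} (sorting N x) (as1 @ as2)" by blast
  have inj: "inj_on \<Phi> S"
  proof (rule inj_onI)
    fix x y assume xy: "x \<in> S" "y \<in> S" "\<Phi> x = \<Phi> y"
    then have X: "x \<in> X" "y \<in> X" by (auto simp: S_def)
    obtain as1 s1 e1 as2 s2 e2 where 1: "seq_trace A n s1 ?rest as2 s2 e2" "\<Phi> x = (fst s1, read_blocks e2)"
      "length as1 = n" "correct_answers {} (sorting N x) (as1 @ as2)" using bspec[OF \<Phi> X(1)] by blast
    obtain bs1 t1 f1 bs2 t2 f2 where 2: "seq_trace A n t1 ?rest bs2 t2 f2" "\<Phi> y = (fst t1, read_blocks f2)"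
      "length bs1 = n" "correct_answers {} (sorting N y) (bs1 @ bs2)" using bspec[OF \<Phi> X(2)] by blast
    have "as2 = bs2" using xy(3) 1(2) 2(2) by (intro seq_trace_from_reads[OF 1(1) 2(1)]) auto
    moreover have "set (take n (drop n (as1 @ as2))) = (\<lambda>i. Some (i, x i)) ` {..<n}"
      unfolding n_def by (rule sorting_answers[where pb = pb, OF N(1) _ 1(4)]) (use X(1) in \<open>auto simp: n_def X_def PiE_def\<close>)
    moreover have "set (take n (drop n (bs1 @ bs2))) = (\<lambda>i. Some (i, y i)) ` {..<n}"
      unfolding n_def by (rule sorting_answers[where pb = pb, OF N(1) _ 2(4)]) (use X(2) in \<open>auto simp: n_def X_def PiE_def\<close>)
    ultimately have "(\<lambda>i. Some (i, x i)) ` {..<n} = (\<lambda>i. Some (i, y i)) ` {..<n}" using 1(3) 2(3) by simp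
    then have "Some (i, x i) \<in> (\<lambda>i. Some (i, y i)) ` {..<n}" if "i < n" for i using that by auto
    then have "x i = y i" if "i < n" for i using that by fastforce
    with X show "x = y" unfolding X_def by (intro PiE_ext) auto
  qed
  let ?B = "{b :: bool list. length b = B * w}" and ?M = "{m :: bool list. length m = M * w}"
  let ?L = "{bs. set bs \<subseteq> ?B \<and> length bs \<le> T}"
  have finL: "finite ?L \<and> card ?L \<le> (card ?B + 1) ^ T"
    by (rule card_bounded_lists) (auto simp: finite_bit_strings)
  have sub: "\<Phi> ` S \<subseteq> ?M \<times> ?L"
  proof
    fix p assume "p \<in> \<Phi> ` S"
    then obtain x where x: "x \<in> S" "p = \<Phi> x" by blast
    then have "x \<in> X" "real (c x) \<le> thr" by (auto simp: S_def)
    obtain as1 s1 e1 as2 s2 e2 where 1: "seq_trace A 0 (initial A) (?ins x) as1 s1 e1"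
      "seq_trace A n s1 ?rest as2 s2 e2" "\<Phi> x = (fst s1, read_blocks e2)" "length e2 \<le> c x"
      using bspec[OF \<Phi> \<open>x \<in> X\<close>] by blast
    have w1: "wf_config M B w s1" using seq_trace_wf[OF 1(1) wf wf0] by blast
    have "\<forall>(k, wr, a, b) \<in> set e2. a < 2 ^ w \<and> length b = B * w" using seq_trace_wf[OF 1(2) wf w1] by blast
    then have "set (read_blocks e2) \<subseteq> ?B" by (auto simp: read_blocks_def)
    moreover have "length (read_blocks e2) \<le> T"
    proof -
      have "real (length (read_blocks e2)) \<le> thr"
        using length_read_blocks[of e2] 1(4) \<open>real (c x) \<le> thr\<close> by linarith
      then show ?thesis by (simp add: T_def le_nat_floor)
    qed
    ultimately show "p \<in> ?M \<times> ?L" using w1 by (simp add: x(2) 1(3) wf_config_def)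
  qed
  have "card S \<le> card (?M \<times> ?L)"
    using inj sub finL finite_bit_strings by (intro card_inj_on_le[of \<Phi>]) auto
  also have "\<dots> \<le> 2 ^ (M * w) * (2 ^ (B * w) + 1) ^ T"
    using finL by (simp add: card_cartesian_product card_bit_strings)
  also have "\<dots> \<le> 2 ^ (M * w) * (2 ^ (B * w + 1)) ^ T"
    by (intro mult_left_mono power_mono) auto
  also have "\<dots> = 2 ^ (M * w + (B * w + 1) * T)" by (simp add: power_add power_mult)
  finally have cS: "card S \<le> 2 ^ (M * w + (B * w + 1) * T)" .
  have "real ((B * w + 1) * T) \<le> real (B * w + 1) * thr"
  proof -
    have "real T \<le> thr" using thr(1) by (simp add: T_def)
    then show ?thesis by (simp only: of_nat_mult) (intro mult_left_mono, auto)
  qed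
  then have "real (M * w + (B * w + 1) * T + 1) < real (pb * n)" using thr(2) unfolding n_def of_nat_add by linarith
  then have "M * w + (B * w + 1) * T + 1 \<le> pb * n" by linarith
  then have "2 ^ (M * w + (B * w + 1) * T + 1) \<le> (2 :: nat) ^ (pb * n)" by (intro power_increasing) auto
  then have half: "2 * card S \<le> card X" using cS by (simp add: cX)
  have "card X * (thr / 2) \<le> (card X - card S) * thr"
  proof -
    have "real (card X) / 2 \<le> real (card X - card S)" using half by linarith
    then have "real (card X) / 2 * thr \<le> real (card X - card S) * thr" using thr(1) by (rule mult_right_mono)
    then show ?thesis by simp
  qed
  also have "\<dots> = (\<Sum>x\<in>X - S. thr)"
    using finX by (simp add: card_Diff_subset S_def)
  also have "\<dots> \<le> (\<Sum>x\<in>X - S. real (c x))" by (intro sum_mono) (auto simp: S_def)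
  also have "\<dots> \<le> (\<Sum>x\<in>X. real (c x))" using finX by (intro sum_mono2) auto
  finally show ?thesis by (simp add: X_def n_def)
qed

section \<open>Parameters\<close>

lemma two_power_le_exp: "(2 :: real) ^ k \<le> exp (real k)"
proof -
  have "(2 :: real) ^ k \<le> exp 1 ^ k" using exp_ge_add_one_self[of 1] by (intro power_mono) auto
  then show ?thesis by (simp add: exp_of_nat_mult[symmetric])
qed

lemma two_power_power_powr: "((2 :: real) ^ k) ^ r = 2 powr (real k * real r)"
  by (metis of_nat_mult power_mult powr_realpow zero_less_numeral)

lemma exp_minus_add_mult:
  fixes u v :: real
  shows "exp (- (u + real s * v)) = 1 / exp u * (1 / exp v) ^ s"
proof -
  have "exp (u + real s * v) = exp u * exp v ^ s" by (simp only: exp_add exp_of_nat_mult)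
  then show ?thesis by (simp only: exp_minus inverse_eq_divide power_one_over) simp
qed

text \<open>Here \<open>m = 2 * h\<close>, and \<open>b\<close> is the fourth root of
  \<open>B\<close>. In the first inequality the factor \<open>2 powr (m * lgB / 8)\<close> from
  \<open>R\<close> is cancelled by the \<open>h\<close>-th power of \<open>1 / b\<close>. In the
  second one the contents of the touched cells dominate, with an exponent of order
  \<open>\<nu> ^ 2 * m\<close>, which \<open>n = \<nu> ^ 3 * m\<close> exceeds.\<close>

lemma parameters_ok_large:
  fixes b W lgB :: real and \<nu> :: nat
  assumes lgB_def: "lgB = log 2 (real B)"
    and w: "1 \<le> w" "real w \<le> W * \<nu>" and W: "1 \<le> W" and B: "2 \<le> B" "real B = b ^ 4" and b: "real \<nu> \<le> b"
    and lg: "lgB \<le> 4 * b" "lgB \<le> \<nu>" and mem: "M * w \<le> 2 * h" "B \<le> M" and h: "10 \<le> 2 * h"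
    and \<nu>: "64 * (28 + 2 * W) + 60 * W \<le> \<nu>" and n: "n = \<nu> ^ 3 * (2 * h)" and k: "2 * (2 * h + n) ^ 2 \<le> k"
  shows "parameters_ok M B w h n (nat \<lfloor>real (2 * h) * (lgB / B)\<rfloor>) (nat \<lfloor>real (2 * h) * (lgB / (24 * real B * real w))\<rfloor>) (nat \<lceil>4 * b\<rceil>) k"
proof -
  define m where "m = real (2 * h)"
  define T where "T = nat \<lfloor>real (2 * h) * (lgB / B)\<rfloor>"
  define r where "r = nat \<lfloor>real (2 * h) * (lgB / (24 * real B * real w))\<rfloor>"
  define s where "s = nat \<lceil>4 * b\<rceil>"
  have m: "10 \<le> m" using h unfolding m_def by linarith
  have lg0: "0 < lgB" using B(1) by (simp add: lgB_def)
  have W64: "1792 \<le> real \<nu>" and W60: "60 * W \<le> real \<nu>" using \<nu> W by simp_all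
  have b1: "60 * W \<le> b" "1000 \<le> b" using b W64 W60 by simp_all
  have B0: "0 < real B" using B(1) by simp
  have w0: "0 < real w" using w(1) by simp
  have T: "real T \<le> m * lgB / B" using lg0 B0 by (simp add: T_def m_def)
  have r: "real r \<le> m * lgB / (24 * real B * real w)" using lg0 B0 w0 by (simp add: r_def m_def)
  have s: "4 * b \<le> real s" "real s \<le> 5 * b" "0 < s" using b1 by (auto simp: s_def) linarith
  have \<nu>3: "real \<nu> * real \<nu> \<le> b * b" using b by (intro mult_mono) auto
  \<comment> \<open>\<open>a\<close> and \<open>y\<close> bound the binary exponents of
    \<open>X\<close> and \<open>Y\<close>. Both are paid in all \<open>s\<close> rounds, so they
    have to stay below \<open>m\<close> even after multiplication by \<open>s\<close>.\<close>
  define a where "a = real (w + 2) * real T"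
  define y where "y = real (w + 1) * real r"
  have wWb: "real w \<le> W * b"
  proof -
    have "W * \<nu> \<le> W * b" using W b by (intro mult_left_mono) auto
    then show ?thesis using w by linarith
  qed
  \<comment> \<open>The bounds \<open>w \<le> W * b\<close> and \<open>lgB \<le> 4 * b\<close>
    against \<open>B = b ^ 4\<close> leave a factor \<open>1 / b ^ 2\<close>: one power pays for the
    rounds, the other for the constants.\<close>
  have a: "a * b ^ 2 \<le> 12 * W * m"
  proof -
    have "a \<le> (3 * real w) * (m * lgB / B)" unfolding a_def using T w by (intro mult_mono) auto
    also have "\<dots> \<le> (3 * (W * b)) * (m * (4 * b) / B)"
      using wWb lg lg0 m B0 W b1 by (intro mult_mono divide_right_mono) auto
    also have "\<dots> = 12 * W * m / b ^ 2"
      unfolding B(2) using b1 by (simp add: field_simps power2_eq_square power4_eq_xxxx)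
    finally show ?thesis using b1 by (simp add: pos_le_divide_eq)
  qed
  have a0: "0 \<le> a" by (simp add: a_def)
  have a1: "s * a \<le> m"
  proof -
    have "s * a \<le> 5 * b * a" using s a0 by (intro mult_right_mono) auto
    also have "\<dots> = 5 * (a * b ^ 2) / b" using b1 by (simp add: power2_eq_square)
    also have "\<dots> \<le> 5 * (12 * W * m) / b" using a b1 by (intro divide_right_mono) auto
    also have "\<dots> = (60 * W) * m / b" by simp
    also have "\<dots> \<le> b * m / b" using b1 m by (intro divide_right_mono mult_right_mono) auto
    finally show ?thesis using b1 by simp
  qed
  have a2: "a \<le> m / 2"
  proof -
    have "2 * a \<le> s * a" using a0 s b1 by (intro mult_right_mono) auto
    then show ?thesis using a1 by simp
  qed
  have y0: "0 \<le> y" by (simp add: y_def)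
  have y1: "s * y \<le> m"
  proof -
    have "y \<le> (2 * real w) * (m * lgB / (24 * real B * real w))" unfolding y_def using r w by (intro mult_mono) auto
    also have "\<dots> = m * lgB / (12 * real B)" using w0 by (simp add: field_simps)
    also have "\<dots> \<le> m * (4 * b) / (12 * real B)" using lg m B0 by (intro divide_right_mono mult_left_mono) auto
    also have "\<dots> = m / (3 * b ^ 3)"
      unfolding B(2) using b1 by (simp add: field_simps power3_eq_cube power4_eq_xxxx)
    finally have y: "y \<le> m / (3 * b ^ 3)" .
    have "s * y \<le> 5 * b * (m / (3 * b ^ 3))" using s y y0 b1 by (intro mult_mono) auto
    also have "\<dots> = (5 / (3 * b ^ 2)) * m" using b1 by (simp add: field_simps power3_eq_cube power2_eq_square)
    also have "\<dots> \<le> 1 * m"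
    proof (rule mult_right_mono)
      have "1000 ^ 2 \<le> b ^ 2" using b1 by (intro power_mono) auto
      then have "5 \<le> 3 * b ^ 2" by simp
      then show "5 / (3 * b ^ 2) \<le> 1" using b1 by (simp add: divide_le_eq)
    qed (use m in simp)
    finally show ?thesis by simp
  qed
  have Bw: "1 \<le> B * w" using w(1) B(1) by (simp add: Suc_le_eq)
  have M1: "real (M * w) \<le> m" using mem(1) by (simp only: m_def of_nat_le_iff)
  have p: "1 \<le> (2 :: real) ^ w" "1 \<le> (2 :: real) ^ (B * w)" "1 \<le> (2 :: real) ^ w * 2 ^ (B * w)"
    using one_le_power[of "2 :: real" "w + B * w"] by (simp_all add: power_add)
  have Y1: "(2 :: real) ^ w + 1 \<le> 2 ^ (w + 1)" using p(1) unfolding power_add by simp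
  have C1: "(2 :: real) ^ (B * w) + 1 \<le> 2 ^ (B * w + 1)" using p(2) unfolding power_add by simp
  have R1: "(2 :: real) ^ w * 2 ^ (B * w) + 1 \<le> 2 ^ (w + B * w + 1)" using p(3) unfolding power_add by simp
  have X1: "2 * (2 :: real) ^ w + 1 \<le> 2 ^ (w + 2)"
  proof -
    have "(2 :: real) ^ (w + 2) = 4 * 2 ^ w" by simp
    then show ?thesis using p(1) by linarith
  qed
  define X where "X = (2 * (2 :: real) ^ w + 1) ^ T"
  have Xa: "X \<le> 2 ^ ((w + 2) * T)"
    unfolding X_def power_mult using X1 by (intro power_mono) auto
  have X0: "0 < X" unfolding X_def by (intro zero_less_power add_pos_pos mult_pos_pos) auto
  have X2: "X \<le> 2 powr a"
    using Xa by (simp add: a_def powr_realpow[symmetric] algebra_simps)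
  have one: "(1/16 :: real) ^ h + 2 ^ (M * w) * (2 ^ w * 2 ^ (B * w) + 1) ^ r * (1 / (16 * real s)) ^ h \<le> 1 / (16 * X)"
  proof -
    have 16: "(1/16 :: real) ^ h = 2 powr (- 2 * m)"
    proof -
      have "(1/16 :: real) ^ h = (2 powr (-4)) ^ h" by (simp add: powr_minus_divide)
      also have "\<dots> = 2 powr (real h * (-4))" by (simp add: powr_power)
      finally show ?thesis by (simp add: m_def mult.commute)
    qed
    have "(2 ^ w * 2 ^ (B * w) + 1) ^ r \<le> ((2 :: real) ^ (w + B * w + 1)) ^ r" using R1 by (intro power_mono) auto
    also have "\<dots> = 2 powr (real (w + B * w + 1) * r)" by (rule two_power_power_powr)
    also have "\<dots> \<le> 2 powr (m * lgB / 8)"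
    proof (rule powr_mono)
      \<comment> \<open>An address with a block takes at most \<open>3 * B * w\<close> bits, padding
        symbol included; with the 24 in \<open>r\<close> this gives the exponent
        \<open>m * lgB / 8\<close>.\<close>
      have "w + B * w + 1 \<le> 3 * (B * w)" using Bw B(1) by (simp add: Suc_le_eq)
      then have "real (w + B * w + 1) \<le> real (3 * (B * w))" by (simp only: of_nat_le_iff)
      then have "real (w + B * w + 1) * r \<le> (3 * (real B * real w)) * (m * lgB / (24 * real B * real w))"
        using r by (intro mult_mono) auto
      also have "\<dots> = m * lgB / 8" using B0 w0 by (simp add: field_simps)
      finally show "real (w + B * w + 1) * r \<le> m * lgB / 8" .
    qed simp
    finally have R2: "(2 ^ w * 2 ^ (B * w) + 1) ^ r \<le> 2 powr (m * lgB / 8)" .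
    have "(2 :: real) ^ (M * w) = 2 powr real (M * w)" by (rule powr_realpow[symmetric]) simp
    also have "\<dots> \<le> 2 powr m" using M1 by (intro powr_mono) auto
    finally have Mw: "(2 :: real) ^ (M * w) \<le> 2 powr m" .
    have "(1 / (16 * real s)) ^ h \<le> (1 / (64 * b)) ^ h"
      using s b1 by (intro power_mono divide_left_mono) auto
    also have "1 / (64 * b) = 2 powr (- (6 + lgB / 4))"
    proof -
      have "lgB = 4 * log 2 b" unfolding lgB_def B(2) using b1 by (simp add: log_nat_power)
      then have "2 powr (6 + lgB / 4) = 2 powr 6 * b" using b1 by (simp add: powr_add)
      also have "(2 :: real) powr 6 = 64" by simp
      finally show ?thesis by (simp only: powr_minus_divide)
    qed
    also have "(2 powr (- (6 + lgB / 4))) ^ h = 2 powr (- 3 * m - m * lgB / 8)"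
      by (simp add: powr_power m_def algebra_simps)
    finally have S2: "(1 / (16 * real s)) ^ h \<le> 2 powr (- 3 * m - m * lgB / 8)" .
    have "2 ^ (M * w) * (2 ^ w * 2 ^ (B * w) + 1) ^ r * (1 / (16 * real s)) ^ h \<le>
        2 powr m * 2 powr (m * lgB / 8) * 2 powr (- 3 * m - m * lgB / 8)"
      using R2 Mw S2 by (intro mult_mono) auto
    also have "\<dots> = 2 powr (- 2 * m)" by (simp add: powr_add[symmetric])
    finally have "(1/16 :: real) ^ h + 2 ^ (M * w) * (2 ^ w * 2 ^ (B * w) + 1) ^ r * (1 / (16 * real s)) ^ h \<le> 2 powr (- 2 * m) + 2 powr (- 2 * m)"
      using 16 by linarith
    also have "\<dots> = 2 powr (1 - 2 * m)" by (simp add: powr_diff powr_minus_divide)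
    \<comment> \<open>\<open>a \<le> m / 2\<close> and \<open>10 \<le> m\<close> give
      \<open>5 + a \<le> 2 * m\<close>.\<close>
    also have "\<dots> \<le> 2 powr (- (4 + a))" using a2 m by (intro powr_mono) auto
    also have "\<dots> = 1 / (16 * 2 powr a)" by (simp only: powr_minus_divide powr_add) simp
    also have "\<dots> \<le> 1 / (16 * X)" using X2 X0 by (intro divide_left_mono) auto
    finally show ?thesis .
  qed
  have two: "(63/64 :: real) ^ n < 1 / (8 * X * (2 ^ (M * w) * (2 ^ (B * w) + 1) ^ T)) * (1 / (16 * X * (2 ^ w + 1) ^ r)) ^ s"
  proof -
    define C where "C = (2 :: real) ^ (M * w) * (2 ^ (B * w) + 1) ^ T"
    define Y where "Y = ((2 :: real) ^ w + 1) ^ r"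
    define c where "c = real (B * w + 1) * real T"
    have C0: "0 < C" and Y0: "0 < Y" unfolding C_def Y_def by (intro mult_pos_pos zero_less_power add_pos_pos; simp)+
    have c2: "c \<le> 2 * W * real \<nu> ^ 2 * m"
    proof -
      have "c \<le> (2 * (real B * real w)) * (m * lgB / B)"
        unfolding c_def using T Bw by (intro mult_mono) (auto simp flip: of_nat_mult)
      also have "\<dots> = 2 * real w * m * lgB" using B0 by simp
      also have "\<dots> \<le> 2 * (W * \<nu>) * m * \<nu>" using w lg lg0 m W by (intro mult_mono) auto
      finally show ?thesis by (simp add: power2_eq_square mult_ac)
    qed
    have X3: "X \<le> exp a" using order_trans[OF Xa two_power_le_exp] unfolding a_def of_nat_mult .
    have "C \<le> 2 ^ (M * w) * (2 ^ (B * w + 1)) ^ T" unfolding C_def using C1 by (intro mult_left_mono power_mono) auto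
    also have "\<dots> = 2 ^ (M * w) * 2 ^ ((B * w + 1) * T)" by (simp only: power_mult[symmetric])
    also have "\<dots> \<le> exp (real (M * w)) * exp c"
      unfolding c_def of_nat_mult[symmetric] by (intro mult_mono two_power_le_exp) auto
    also have "\<dots> \<le> exp m * exp c" using M1 by (intro mult_right_mono) auto
    finally have C3: "C \<le> exp (m + c)" by (simp add: exp_add)
    have "Y \<le> (2 ^ (w + 1)) ^ r" unfolding Y_def using Y1 by (intro power_mono) auto
    also have "\<dots> = 2 ^ ((w + 1) * r)" by (simp only: power_mult[symmetric])
    also have "\<dots> \<le> exp y" unfolding y_def of_nat_mult[symmetric] by (rule two_power_le_exp)
    finally have Y3: "Y \<le> exp y" .
    have e8: "8 \<le> exp (3 :: real)" using two_power_le_exp[of 3] by simp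
    have e16: "16 \<le> exp (4 :: real)" using two_power_le_exp[of 4] by simp
    have "8 * X * C \<le> exp 3 * exp a * exp (m + c)" using e8 X3 C3 X0 C0 by (intro mult_mono) auto
    then have XC: "8 * X * C \<le> exp (3 + a + (m + c))" by (simp add: exp_add)
    have "16 * X * Y \<le> exp 4 * exp a * exp y" using e16 X3 Y3 X0 Y0 by (intro mult_mono) auto
    then have XY: "16 * X * Y \<le> exp (4 + a + y)" by (simp add: exp_add)
    \<comment> \<open>Compares the exponents of the two sides, as \<open>(63/64) ^ n\<close> is at
      most \<open>exp (- n / 64)\<close>. All terms on the left but \<open>c\<close>, the cell
      contents, are of order \<open>m\<close>.\<close>
    have lam: "(3 + a + (m + c)) + s * (4 + a + y) < real n / 64"
    proof -
      \<comment> \<open>\<open>s\<close> is of order \<open>b\<close>, and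
        \<open>b \<le> B \<le> M * w \<le> m\<close>.\<close>
      have "real s * 4 \<le> 20 * m"
      proof -
        have "b \<le> b ^ 4" using self_le_power[of b 4] b1 by simp
        also have "\<dots> \<le> m"
        proof -
          have "B \<le> M * w" using mem(2) w(1) by (metis le_trans mult_le_mono2 nat_mult_1_right)
          then have "real B \<le> real (M * w)" by (simp only: of_nat_le_iff)
          then show ?thesis using M1 B(2) by linarith
        qed
        finally show ?thesis using s by linarith
      qed
      then have "(3 + a + (m + c)) + s * (4 + a + y) \<le> 25 * m + c"
        using a1 a2 y1 m by (simp add: algebra_simps)
      also have "\<dots> \<le> 25 * m + 2 * W * real \<nu> ^ 2 * m" using c2 by simp
      also have "\<dots> < (28 + 2 * W) * real \<nu> ^ 2 * m"
      proof -
        have "1 \<le> real \<nu> ^ 2" using W64 by (intro one_le_power) auto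
        then have "25 * m < 28 * real \<nu> ^ 2 * m" using m by (intro mult_strict_right_mono) auto
        then show ?thesis by (simp add: algebra_simps)
      qed
      also have "\<dots> \<le> (real \<nu> / 64) * real \<nu> ^ 2 * m"
      proof -
        have "28 + 2 * W \<le> real \<nu> / 64" using \<nu> W by simp
        then show ?thesis using m by (intro mult_right_mono) auto
      qed
      also have "\<dots> = real n / 64" by (simp add: n m_def power3_eq_cube power2_eq_square)
      finally show ?thesis .
    qed
    have "(63/64 :: real) ^ n \<le> exp (- 1/64) ^ n" using exp_ge_add_one_self[of "- 1/64 :: real"] by (intro power_mono) auto
    also have "\<dots> = exp (- (real n / 64))" by (simp add: exp_of_nat_mult[symmetric])
    also have "\<dots> < exp (- ((3 + a + (m + c)) + s * (4 + a + y)))" using lam by simp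
    also have "\<dots> = 1 / exp (3 + a + (m + c)) * (1 / exp (4 + a + y)) ^ s"
      by (rule exp_minus_add_mult)
    also have "\<dots> \<le> 1 / (8 * X * C) * (1 / (16 * X * Y)) ^ s"
      using XC XY X0 C0 Y0 by (intro mult_mono power_mono divide_left_mono) auto
    finally show ?thesis by (simp only: C_def Y_def)
  qed
  show ?thesis
    unfolding parameters_ok_def T_def[symmetric] r_def[symmetric] s_def[symmetric]
    using s(3) k one two by (simp add: X_def)
qed

section \<open>Choice of the tree, and the two ranges of the block size\<close>

lemma power4_le_imp_le: "x ^ 4 \<le> y ^ 4 \<Longrightarrow> 0 \<le> y \<Longrightarrow> x \<le> (y :: real)"
  using power_le_imp_le_base[of x 3 y] by (simp add: numeral_eq_Suc)

lemma log2_less_self: "0 < x \<Longrightarrow> log 2 x < x"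
proof -
  assume x: "0 < x"
  have "ln (x / 2) \<le> x / 2 - 1" using x by (intro ln_le_minus_one) simp
  then have "ln x \<le> x / 2 - 1 + ln 2" using x by (simp add: ln_div)
  also have "\<dots> < x / 2" using ln_2_less_1 by simp
  also have "\<dots> \<le> x * ln 2" using x ln2_ge_two_thirds by (simp add: field_simps)
  finally show "log 2 x < x" by (simp add: log_def divide_less_eq)
qed

text \<open>The keys lowered on one level add only \<open>2 * \<beta> ^ l / \<nu>\<close> to the
  length, where \<open>\<beta> = \<nu> ^ 4\<close>; multiplication by \<open>\<nu>\<close> keeps the
  induction in natural numbers.\<close>

lemma node_length_le:
  fixes \<nu> :: nat
  shows "\<nu> * node_length (\<nu> ^ 4) (\<lambda>l. \<nu> ^ 3 * (\<nu> ^ 4) ^ (l - 1)) l \<le> 2 * (\<nu> ^ 4) ^ l * (\<nu> + l)"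
proof (induction l)
  case (Suc l)
  define \<beta> where "\<beta> = \<nu> ^ 4"
  have e: "\<nu> * \<nu> ^ 3 = \<beta>" by (simp add: \<beta>_def power_numeral_reduce)
  have "\<nu> * node_length \<beta> (\<lambda>l. \<nu> ^ 3 * \<beta> ^ (l - 1)) (Suc l) =
      2 * (\<nu> * \<nu> ^ 3) * \<beta> ^ l + \<beta> * (\<nu> * node_length \<beta> (\<lambda>l. \<nu> ^ 3 * \<beta> ^ (l - 1)) l)"
    by (simp add: algebra_simps)
  also have "\<dots> \<le> 2 * \<beta> * \<beta> ^ l + \<beta> * (2 * \<beta> ^ l * (\<nu> + l))"
    unfolding e using Suc.IH by (intro add_mono mult_left_mono) (auto simp: \<beta>_def)
  also have "\<dots> = 2 * \<beta> ^ Suc l * (\<nu> + Suc l)" by (simp add: algebra_simps)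
  finally show ?case by (simp add: \<beta>_def)
qed simp

text \<open>\<open>\<beta> ^ H\<close> is \<open>N powr (2/5)\<close> up to a factor
  \<open>\<beta>\<close>, expressed in natural numbers.\<close>

lemma exists_height:
  fixes \<beta> N :: nat
  assumes "2 \<le> \<beta>" and "1 \<le> N"
  shows "\<exists>H. (\<beta> ^ H) ^ 5 \<le> N ^ 2 \<and> N ^ 2 < (\<beta> ^ Suc H) ^ 5"
proof -
  let ?P = "\<lambda>h. N ^ 2 < (\<beta> ^ h) ^ 5"
  have "N < \<beta> ^ N" using assms(1) by (intro power_gt_expt) simp
  then have "N ^ 2 < (\<beta> ^ N) ^ 2" by (intro power_strict_mono) auto
  also have "\<dots> \<le> (\<beta> ^ N) ^ 5" using assms(1) by (intro power_increasing) auto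
  finally have "?P N" .
  moreover have "\<not> ?P 0" using assms(2) by simp
  ultimately obtain H where "\<not> ?P H" "?P (Suc H)" using ex_least_nat_less[of ?P N] by blast
  then show ?thesis by (auto simp: not_less)
qed

text \<open>The usable levels range from about \<open>3/10 * L / g\<close>, where a child is sure to
  have \<open>M * w\<close> leaves, to \<open>H\<close>, about \<open>2/5 * L / g\<close>. Half of
  the difference absorbs the rounding, since \<open>L / g\<close> is at least
  \<open>40\<close>.\<close>

lemma card_levels_ge:
  fixes \<beta> H M w :: nat and L g K :: real
  assumes \<beta>: "2 \<le> \<beta>" and g: "g = log 2 \<beta>" "g \<le> 8 * K" and K: "0 < K" "320 * K \<le> L"
    and H: "2 * L < 5 * ((H + 1) * g)" and mem: "real (M * w) \<le> 2 powr (3/10 * L)"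
  shows "L / (160 * K) \<le> card {d. Suc d < H \<and> M * w \<le> \<beta> ^ (H - Suc d)}"
proof -
  define l0 where "l0 = nat \<lceil>3/10 * L / g\<rceil>"
  have g1: "1 \<le> g" unfolding g(1) using \<beta> by (simp add: le_log_iff)
  have L0: "0 < L" using K by linarith
  have l0: "3/10 * L / g \<le> l0" "l0 \<le> 3/10 * L / g + 1"
    using L0 g1 by (auto simp: l0_def)
  have "0 < 3/10 * L / g" using L0 g1 by simp
  then have l01: "1 \<le> l0" using l0 by linarith
  have sub: "{..<H - l0} \<subseteq> {d. Suc d < H \<and> M * w \<le> \<beta> ^ (H - Suc d)}"
  proof
    fix d assume d: "d \<in> {..<H - l0}"
    then have l: "l0 \<le> H - Suc d" by simp
    have "3/10 * L \<le> l0 * g" using l0(1) g1 by (simp add: divide_le_eq)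
    also have "\<dots> \<le> (H - Suc d) * g" using l g1 by (intro mult_right_mono) auto
    finally have "3/10 * L \<le> (H - Suc d) * g" .
    then have "2 powr (3/10 * L) \<le> 2 powr ((H - Suc d) * g)" by (intro powr_mono) auto
    also have "\<dots> = (2 powr g) ^ (H - Suc d)" by (simp add: powr_power mult.commute)
    also have "2 powr g = \<beta>" unfolding g(1) using \<beta> by simp
    finally have "real (M * w) \<le> real (\<beta> ^ (H - Suc d))" using mem by simp
    then have "M * w \<le> \<beta> ^ (H - Suc d)" by (simp only: of_nat_le_iff)
    moreover have "Suc d < H" using d l01 by simp
    ultimately show "d \<in> {d. Suc d < H \<and> M * w \<le> \<beta> ^ (H - Suc d)}" by blast
  qed
  have "finite {d. Suc d < H \<and> M * w \<le> \<beta> ^ (H - Suc d)}"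
    by (rule finite_subset[of _ "{..<H}"]) auto
  from card_mono[OF this sub] have c: "H - l0 \<le> card {d. Suc d < H \<and> M * w \<le> \<beta> ^ (H - Suc d)}" by simp
  have H': "2/5 * L / g \<le> H + 1" using H g1 by (simp add: divide_le_eq)
  have "L / (8 * K) \<le> L / g" using g g1 L0 K by (intro divide_left_mono) auto
  moreover have "40 \<le> L / (8 * K)" using K by (simp add: le_divide_eq)
  moreover have "3/10 * L / g = 3/10 * (L / g)" "2/5 * L / g = 2/5 * (L / g)" by simp_all
  ultimately have "1/20 * (L / (8 * K)) \<le> real H - real l0" using l0(2) H' by linarith
  moreover have "1/20 * (L / (8 * K)) = L / (160 * K)" by simp
  moreover have "real H - real l0 \<le> real (H - l0)" by linarith
  ultimately show ?thesis using c by linarith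
qed

text \<open>The estimates of \<open>parameters_ok_large\<close> enter through \<open>params\<close>,
  which separates the choice of the tree from the numerical inequalities. The condition on
  \<open>B\<close> makes its fourth root at least \<open>\<nu>\<close>.\<close>

lemma large_blocks:
  fixes N M B w kb pb :: nat and W \<omega> L tI tE tD :: real
  assumes L: "L = log 2 (real N)" and W: "1 \<le> W" "64 * (28 + 2 * W) + 60 * W \<le> L" "W * (2 * L + 2) \<le> 2 powr (L / 20)"
    and L2: "320 * log 2 L \<le> L"
    and B: "2 * B \<le> M" "real M ^ 4 \<le> real N" "(2 * nat \<lceil>L\<rceil>) ^ 4 \<le> B"
    and w: "0 < \<omega>" "\<omega> * L \<le> real w" "real w \<le> W * L"
    and bits: "2 * L \<le> real kb" "2 * L \<le> real pb"
    and lv: "las_vegas_pq N M B w kb pb A" and ea: "expected_amortized N kb pb A tI tE tD"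
    and params: "\<And>b h n k \<nu>. 1 \<le> w \<Longrightarrow> real w \<le> W * real \<nu> \<Longrightarrow> 2 \<le> B \<Longrightarrow> real B = b ^ 4 \<Longrightarrow> real \<nu> \<le> b \<Longrightarrow>
      log 2 (real B) \<le> 4 * b \<Longrightarrow> log 2 (real B) \<le> \<nu> \<Longrightarrow> M * w \<le> 2 * h \<Longrightarrow> B \<le> M \<Longrightarrow> 10 \<le> 2 * h \<Longrightarrow>
      64 * (28 + 2 * W) + 60 * W \<le> real \<nu> \<Longrightarrow> n = \<nu> ^ 3 * (2 * h) \<Longrightarrow> 2 * (2 * h + n) ^ 2 \<le> k \<Longrightarrow>
      parameters_ok M B w h n (nat \<lfloor>real (2 * h) * (log 2 (real B) / B)\<rfloor>)
        (nat \<lfloor>real (2 * h) * (log 2 (real B) / (24 * real B * real w))\<rfloor>) (nat \<lceil>4 * b\<rceil>) k"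
  shows "log 2 (real B) / (real B * log 2 L) \<le> 245760 * W * (1 + 1 / (24 * \<omega>)) * max tI (max tE tD)"
proof -
  define t where "t = max tI (max tE tD)"
  \<comment> \<open>Even, so that every child considered has an even number \<open>2 * h\<close> of
    leaves.\<close>
  define \<nu> where "\<nu> = 2 * nat \<lceil>L\<rceil>"
  define \<beta> where "\<beta> = \<nu> ^ 4"
  define nz where "nz = (\<lambda>l. \<nu> ^ 3 * \<beta> ^ (l - 1))"
  define K where "K = log 2 L"
  define g where "g = log 2 (real \<beta>)"
  define lgB where "lgB = log 2 (real B)"
  have L1: "1792 \<le> L" using W(1,2) by simp
  have N0: "0 < N"
  proof (rule ccontr)
    assume "\<not> 0 < N"
    then have "L = 0" unfolding L by (simp add: log_def)
    then show False using L1 by simp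
  qed
  have NL: "real N = 2 powr L" unfolding L using N0 by simp
  have \<nu>1: "2 * L \<le> \<nu>" "\<nu> \<le> 2 * L + 2" unfolding \<nu>_def using L1 by (auto intro: order_trans) linarith+
  have \<nu>2: "3584 \<le> \<nu>" using \<nu>1 L1 by linarith
  have \<beta>2: "\<nu> \<le> \<beta>" unfolding \<beta>_def using self_le_power[of \<nu> 4] \<nu>2 by simp
  have ev: "even \<beta>" by (simp add: \<beta>_def \<nu>_def)
  have K0: "0 < K" unfolding K_def using L1 by simp
  have gK: "g \<le> 8 * K"
  proof -
    have "real \<nu> \<le> L ^ 2"
    proof -
      have "3 * L \<le> L * L" using L1 by (intro mult_right_mono) auto
      then have "2 * L + 2 \<le> L * L" using L1 by linarith
      then show ?thesis using \<nu>1 by (simp add: power2_eq_square)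
    qed
    then have "log 2 \<nu> \<le> log 2 (L ^ 2)" using \<nu>2 L1 by simp
    also have "\<dots> = 2 * K" using L1 by (simp add: K_def log_nat_power)
    finally have "log 2 \<nu> \<le> 2 * K" .
    moreover have "g = 4 * log 2 \<nu>" unfolding g_def \<beta>_def using \<nu>2 by (simp add: log_nat_power)
    ultimately show ?thesis by simp
  qed
  have g1: "1 \<le> g" unfolding g_def using \<beta>2 \<nu>2 by (simp add: le_log_iff)
  obtain H where H: "(\<beta> ^ H) ^ 5 \<le> N ^ 2" "N ^ 2 < (\<beta> ^ Suc H) ^ 5"
    using exists_height[of \<beta> N] \<beta>2 \<nu>2 N0 by auto
  have logpow: "log 2 (real ((\<beta> ^ x) ^ 5)) = 5 * (x * g)" for x
    using \<beta>2 \<nu>2 by (simp add: g_def log_nat_power)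
  have logN: "log 2 (real (N ^ 2)) = 2 * L" using N0 by (simp add: L log_nat_power)
  have pos\<beta>: "0 < \<beta>" using \<beta>2 \<nu>2 by linarith
  have Hg: "5 * (H * g) \<le> 2 * L"
    unfolding logpow[symmetric] logN[symmetric] using H(1) pos\<beta> N0
    by (subst log_le_cancel_iff) (simp_all flip: of_nat_power)
  have Hg': "2 * L < 5 * ((H + 1) * g)"
  proof -
    have "log 2 (real (N ^ 2)) < log 2 (real ((\<beta> ^ Suc H) ^ 5))"
      using H(2) pos\<beta> N0 by (subst log_less_cancel_iff) (simp_all flip: of_nat_power)
    then show ?thesis unfolding logpow logN by (simp add: add.commute)
  qed
  have HL: "real H \<le> L"
  proof -
    have "real H * 1 \<le> real H * g" using g1 by (intro mult_left_mono) auto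
    then show ?thesis using Hg L1 by linarith
  qed
  have \<beta>H: "real (\<beta> ^ H) \<le> 2 powr (2/5 * L)"
  proof -
    have "real (\<beta> ^ H) = (2 powr g) ^ H" unfolding g_def using pos\<beta> by simp
    also have "\<dots> = 2 powr (H * g)" by (simp add: powr_power mult.commute)
    also have "\<dots> \<le> 2 powr (2/5 * L)" using Hg by (intro powr_mono) auto
    finally show ?thesis .
  qed
  define nl where "nl = node_length \<beta> nz H"
  have nl: "nl \<le> 4 * \<beta> ^ H"
  proof -
    have "\<nu> * nl \<le> 2 * \<beta> ^ H * (\<nu> + H)" using node_length_le[of \<nu> H] by (simp add: nl_def nz_def \<beta>_def)
    also have "\<dots> \<le> 2 * \<beta> ^ H * (2 * \<nu>)"
    proof -
      have "real H \<le> real \<nu>" using HL \<nu>1 L1 by linarith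
      then show ?thesis by (intro mult_left_mono) auto
    qed
    finally have "\<nu> * nl \<le> \<nu> * (4 * \<beta> ^ H)" by (simp add: mult_ac)
    then show ?thesis using \<nu>2 by simp
  qed
  \<comment> \<open>A tree takes at most \<open>4 * \<beta> ^ H\<close> requests, so all
    \<open>F\<close> trees take at most a quarter of the \<open>N\<close> requests; the rest are
    insertions.\<close>
  define F where "F = N div (16 * \<beta> ^ H)"
  have F1: "16 * (F * \<beta> ^ H) \<le> N" using div_times_less_eq_dividend[of N "16 * \<beta> ^ H"] by (simp add: F_def mult_ac)
  have F2: "real N / 32 \<le> F * \<beta> ^ H"
  proof -
    have "N < (F + 1) * (16 * \<beta> ^ H)" unfolding F_def using pos\<beta> dividend_less_div_times[of "16 * \<beta> ^ H" N] by simp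
    then have "real N < real ((F + 1) * (16 * \<beta> ^ H))" by (simp only: of_nat_less_iff)
    then have "real N < 16 * real (F * \<beta> ^ H) + 16 * real (\<beta> ^ H)" by (simp add: algebra_simps)
    moreover have "real (\<beta> ^ H) \<le> real N / 32"
    proof -
      have "2 powr (2/5 * L) \<le> 2 powr (L - 5)" using L1 by (intro powr_mono) auto
      also have "\<dots> = real N / 32" by (simp add: NL powr_diff)
      finally show ?thesis using \<beta>H by linarith
    qed
    ultimately show ?thesis by linarith
  qed
  have Fnl: "4 * (F * nl) \<le> N"
  proof -
    have "F * nl \<le> F * (4 * \<beta> ^ H)" using nl by (rule mult_le_mono2)
    then show ?thesis using F1 by linarith
  qed
  define u where "u = N - F * nl"
  have u: "u + F * nl = N" "3 * N \<le> 4 * u" using Fnl by (simp_all add: u_def)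
  have N2: "real N * real N \<le> 2 ^ x" if "2 * L \<le> real x" for x
  proof -
    have "real N * real N = 2 powr (2 * L)" unfolding NL by (simp flip: powr_add)
    also have "\<dots> \<le> 2 powr x" using that by (intro powr_mono) auto
    finally show ?thesis by (simp add: powr_realpow)
  qed
  have N3: "2 \<le> real N" "L < real N"
  proof -
    have "2 powr 1 \<le> 2 powr L" using L1 by (intro powr_mono) auto
    then show "2 \<le> real N" by (simp add: NL)
    show "L < real N" unfolding L using N0 by (intro log2_less_self) simp
  qed
  have kb: "u + N \<le> 2 ^ kb"
  proof -
    have "real (u + N) \<le> 2 * real N" using u by simp
    also have "\<dots> \<le> real N * real N" using N3 by (intro mult_right_mono) auto
    also have "\<dots> \<le> real (2 ^ kb)" using N2[OF bits(1)] by simp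
    finally show ?thesis by (simp only: of_nat_le_iff)
  qed
  have pb: "Suc H < 2 ^ pb"
  proof -
    have "real (Suc H) < 2 * real N" using HL N3 by simp
    also have "\<dots> \<le> real N * real N" using N3 by (intro mult_right_mono) auto
    also have "\<dots> \<le> real (2 ^ pb)" using N2[OF bits(2)] by simp
    finally show ?thesis by (simp only: of_nat_less_iff)
  qed
  interpret pq_tree \<beta> nz H F u kb pb using kb pb pos\<beta> by unfold_locales auto
  have slots: "8 * card slots \<le> N" using card_slots Fnl by (simp add: nl_def)
  define X where "X = {\<omega> \<in> slots \<rightarrow>\<^sub>E {..<u}. inj_on \<omega> slots}"
  have finX: "finite X" unfolding X_def
    by (rule finite_subset[of _ "slots \<rightarrow>\<^sub>E {..<u}"]) (auto simp: finite_slots intro!: finite_PiE)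
  have fullX: "length (full x) = N \<and> valid_requests kb pb {} (full x)" if "x \<in> X" for x
    using that u(1) full_valid[of x] by (auto simp: X_def length_full_tree nl_def)
  obtain r where r: "\<And>qs. length qs = N \<Longrightarrow> valid_requests kb pb {} qs \<Longrightarrow> \<exists>as c. seq_run (A r) 0 (initial (A r)) qs as c"
    "\<And>c. (\<forall>x\<in>X. \<exists>as. seq_run (A r) 0 (initial (A r)) (full x) as (c x)) \<Longrightarrow>
       (\<Sum>x\<in>X. real (c x)) \<le> card X * (N * t)"
    using exists_good_coins[where f = full, OF lv ea finX fullX] unfolding t_def by blast
  interpret pq_run \<beta> nz H F u kb pb "A r" M B w N
  proof unfold_locales
    show "wf_machine M B w (A r)" using lv by (simp add: las_vegas_pq_def)
    show "correct_answers {} qs as" if "length qs = N" "valid_requests kb pb {} qs"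
      "seq_run (A r) 0 (initial (A r)) qs as c" for qs as c
      using lv that unfolding las_vegas_pq_def by blast
    show "length (full (\<lambda>_. 0)) = N" using u(1) by (simp add: length_full_tree nl_def)
    show "2 * card slots \<le> u" using slots u by linarith
  qed (use r(1) kb in auto)
  have X: "configs = X" by (simp add: configs_def X_def)
  have "\<forall>x\<in>X. \<exists>as. seq_run (A r) 0 (initial (A r)) (full x) as (length (trace x))"
    using configs_trace seq_trace_imp_seq_run unfolding X by blast
  from r(2)[OF this] have cost: "(\<Sum>\<omega>\<in>configs. real (length (trace \<omega>))) \<le> card configs * (N * t)"
    unfolding X .
  have cX: "0 < card configs"
  proof -
    have "card slots \<le> card {..<u}" using slots u by simp
    from card_le_inj[OF finite_slots _ this] obtain f where f: "f ` slots \<subseteq> {..<u}" "inj_on f slots" by auto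
    then have "restrict f slots \<in> configs" by (auto simp: configs_def)
    then show ?thesis using finX X by (auto simp: card_gt_0_iff)
  qed
  have w1: "1 \<le> w"
  proof -
    have "0 < \<omega> * L" using w L1 by simp
    then have "0 < real w" using w by linarith
    then show ?thesis by simp
  qed
  have B2: "2 \<le> B"
  proof -
    have "2 \<le> \<beta>" using \<beta>2 \<nu>2 by linarith
    then show ?thesis using B(3) unfolding \<beta>_def \<nu>_def by linarith
  qed
  have Mle: "real M \<le> 2 powr (L / 4)"
  proof -
    have "real M ^ 4 \<le> (2 powr (L / 4)) ^ 4" using B(2) NL by (simp add: powr_power)
    then show ?thesis by (rule power4_le_imp_le) simp
  qed
  have mem: "real (M * w) \<le> 2 powr (3/10 * L)"
  proof -
    have "W * L \<le> W * (2 * L + 2)" using W(1) L1 by (intro mult_left_mono) auto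
    then have "real w \<le> 2 powr (L / 20)" using w W by linarith
    then have "real M * real w \<le> 2 powr (L / 4) * 2 powr (L / 20)" using Mle by (intro mult_mono) auto
    also have "\<dots> = 2 powr (3/10 * L)" by (simp flip: powr_add)
    finally show ?thesis by simp
  qed
  define Ds where "Ds = {d. Suc d < H \<and> M * w \<le> \<beta> ^ (H - Suc d)}"
  have Ds1: "L / (160 * K) \<le> card Ds"
    unfolding Ds_def
  proof (rule card_levels_ge)
    show "2 \<le> \<beta>" using \<beta>2 \<nu>2 by linarith
  qed (use gK K0 L2 Hg' mem in \<open>auto simp: g_def K_def\<close>)
  have Ds2: "real (card Ds) \<le> L"
  proof -
    have "card Ds \<le> card {..<H}" unfolding Ds_def by (intro card_mono) auto
    then show ?thesis using HL by simp
  qed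
  define b where "b = root 4 (real B)"
  have b: "real B = b ^ 4" "0 < b" using B2 by (auto simp: b_def)
  have b\<nu>: "real \<nu> \<le> b"
  proof -
    have "real (\<nu> ^ 4) \<le> real B" using B(3) by (simp only: \<nu>_def of_nat_le_iff)
    then have "real \<nu> ^ 4 \<le> b ^ 4" unfolding b(1) of_nat_power .
    then show ?thesis by (rule power4_le_imp_le) (use b(2) in simp)
  qed
  have lgb: "lgB \<le> 4 * b" unfolding lgB_def b(1) using b(2) less_imp_le[OF log2_less_self[OF b(2)]] by (simp add: log_nat_power)
  have lgpos: "0 < lgB" unfolding lgB_def using B2 by simp
  have lgL: "lgB \<le> \<nu>"
  proof -
    have "real B \<le> real M" using B(1) by simp
    also have "\<dots> \<le> 2 powr (L / 4)" by (rule Mle)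
    also have "\<dots> \<le> real N" unfolding NL using L1 by (intro powr_mono) auto
    finally have "lgB \<le> L" unfolding lgB_def L using B2 by simp
    then show ?thesis using \<nu>1 L1 by linarith
  qed
  define \<rho> where "\<rho> = lgB / (24 * real B * real w)"
  define \<tau> where "\<tau> = lgB / B"
  have pos: "0 < \<rho>" "0 < \<tau>" unfolding \<rho>_def \<tau>_def using lgpos B2 w1 by auto
  have main: "card configs * (card Ds * (F * \<beta> ^ H) * \<rho> / 2) \<le>
    (\<Sum>\<omega>\<in>configs. (1 + card Ds * (\<rho> / \<tau>)) * length (trace \<omega>))"
  proof (rule total_io_bound[OF pos _ ev, where s = "nat \<lceil>4 * b\<rceil>"])
    show "Ds \<subseteq> {..<H}" by (auto simp: Ds_def)
    show "Suc d < H" if "d \<in> Ds" for d using that by (simp add: Ds_def)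
    show "parameters_ok M B w (\<beta> ^ (H - Suc d) div 2) (nz (H - d)) (nat \<lfloor>\<beta> ^ (H - Suc d) * \<tau>\<rfloor>)
        (nat \<lfloor>\<beta> ^ (H - Suc d) * \<rho>\<rfloor>) (nat \<lceil>4 * b\<rceil>) k" if d: "d \<in> Ds" and k: "u - card slots \<le> k" for d k
    proof -
      define m where "m = \<beta> ^ (H - Suc d)"
      have dH: "Suc d < H" and Mm: "M * w \<le> m" using d by (auto simp: Ds_def m_def)
      have h: "2 * (m div 2) = m" unfolding m_def using dH ev by simp
      have m\<beta>: "\<beta> * m \<le> \<beta> ^ H"
      proof -
        have "\<beta> * m = \<beta> ^ (H - d)" using dH by (simp add: m_def Suc_diff_Suc flip: power_Suc)
        also have "\<dots> \<le> \<beta> ^ H" using pos\<beta> by (intro power_increasing) auto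
        finally show ?thesis .
      qed
      have n: "nz (H - d) = \<nu> ^ 3 * m" by (simp add: nz_def m_def)
      have "\<nu> ^ 3 \<le> \<beta>" unfolding \<beta>_def using \<nu>2 by (intro power_increasing) auto
      then have "nz (H - d) \<le> \<beta> ^ H" unfolding n using m\<beta> by (meson le_trans mult_le_mono1)
      moreover have "m \<le> \<beta> ^ H" using m\<beta> pos\<beta> by (metis Suc_leI le_trans mult_le_mono1 nat_mult_1 One_nat_def)
      ultimately have s: "m + nz (H - d) \<le> 2 * \<beta> ^ H" by simp
      have "2 * (m + nz (H - d)) ^ 2 \<le> 2 * (2 * \<beta> ^ H) ^ 2" using s by (intro mult_left_mono power_mono) auto
      also have "\<dots> \<le> k"
      proof -
        \<comment> \<open>The birthday condition: \<open>(\<beta> ^ H) ^ 2\<close> is at most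
          \<open>N powr (4/5)\<close>, while at least \<open>5/8 * N\<close> keys are free.\<close>
        have "real (\<beta> ^ H) ^ 2 \<le> (2 powr (2/5 * L)) ^ 2" using \<beta>H by (intro power_mono) auto
        also have "\<dots> = 2 powr (4/5 * L)" by (simp add: powr_power)
        also have "\<dots> \<le> 2 powr (L - 4)" using L1 by (intro powr_mono) auto
        also have "\<dots> = real N / 16" by (simp add: NL powr_diff)
        finally have "16 * real (\<beta> ^ H) ^ 2 \<le> real N" by simp
        then have "real (16 * (\<beta> ^ H) ^ 2) \<le> real N" by simp
        then have "16 * (\<beta> ^ H) ^ 2 \<le> N" by (simp only: of_nat_le_iff)
        then show ?thesis using k slots u by (simp add: power_mult_distrib)
      qed
      finally have kk: "2 * (2 * (m div 2) + nz (H - d)) ^ 2 \<le> k" by (simp only: h)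
      have "\<beta> \<le> m" unfolding m_def using dH pos\<beta> by (intro self_le_power) auto
      then have ten: "10 \<le> 2 * (m div 2)" unfolding h using \<beta>2 \<nu>2 by linarith
      have "W * L \<le> W * \<nu>" using W \<nu>1 L1 by (intro mult_left_mono) auto
      then have wW: "real w \<le> W * \<nu>" using w by linarith
      have "parameters_ok M B w (m div 2) (nz (H - d)) (nat \<lfloor>real (2 * (m div 2)) * (log 2 (real B) / B)\<rfloor>)
        (nat \<lfloor>real (2 * (m div 2)) * (log 2 (real B) / (24 * real B * real w))\<rfloor>) (nat \<lceil>4 * b\<rceil>) k"
      proof (rule params[OF w1 wW B2 b(1) b\<nu> lgb[unfolded lgB_def] lgL[unfolded lgB_def] _ _ ten _ _ kk])
        show "M * w \<le> 2 * (m div 2)" unfolding h by (rule Mm)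
        show "B \<le> M" using B(1) by simp
        show "64 * (28 + 2 * W) + 60 * W \<le> real \<nu>" using W \<nu>1 L1 by linarith
        show "nz (H - d) = \<nu> ^ 3 * (2 * (m div 2))" unfolding h by (rule n)
      qed
      from this[unfolded h, unfolded m_def] show ?thesis
        unfolding \<rho>_def \<tau>_def lgB_def by (simp only: of_nat_power)
    qed
  qed
  define Q where "Q = 1 + card Ds * (\<rho> / \<tau>)"
  have Q0: "0 \<le> Q" unfolding Q_def using pos by (simp add: add_nonneg_nonneg)
  have t0: "0 \<le> t" using ea by (auto simp: t_def expected_amortized_def)
  have "card configs * (card Ds * (F * \<beta> ^ H) * \<rho> / 2) \<le> Q * (\<Sum>\<omega>\<in>configs. real (length (trace \<omega>)))"
    using main by (simp add: Q_def sum_distrib_left)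
  also have "\<dots> \<le> Q * (card configs * (N * t))" using cost Q0 by (rule mult_left_mono)
  also have "\<dots> = card configs * (Q * N * t)" by simp
  finally have 1: "card Ds * (F * \<beta> ^ H) * \<rho> / 2 \<le> Q * N * t" using cX by simp
  have star: "real (card Ds) * (real N / 32) \<le> real (card Ds * (F * \<beta> ^ H))"
    unfolding of_nat_mult[of "card Ds"] using F2 by (rule mult_left_mono) simp
  have "real (card Ds) * (real N / 32) * \<rho> / 2 \<le> real (card Ds * (F * \<beta> ^ H)) * \<rho> / 2"
    using mult_right_mono[OF star less_imp_le[OF pos(1)]] by (rule divide_right_mono) simp
  with 1 have "real N * (card Ds * \<rho> / 64) \<le> real N * (Q * t)" by (simp add: mult_ac)
  then have 2: "card Ds * \<rho> / 64 \<le> Q * t" using N0 by simp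
  \<comment> \<open>Inner I/Os are counted on up to \<open>L\<close> levels, but with weight
    \<open>1 / (24 * w)\<close>; the lower bound \<open>\<omega> * L \<le> w\<close> keeps the sum
    bounded.\<close>
  have Q1: "Q \<le> 1 + 1 / (24 * \<omega>)"
  proof -
    have "\<rho> / \<tau> = 1 / (24 * real w)" unfolding \<rho>_def \<tau>_def using lgpos B2 by simp
    then have "card Ds * (\<rho> / \<tau>) \<le> L / (24 * real w)" using Ds2 by (simp add: divide_right_mono)
    also have "\<dots> \<le> L / (24 * (\<omega> * L))" using w L1 w1 by (intro divide_left_mono) auto
    also have "\<dots> = 1 / (24 * \<omega>)" using L1 by simp
    finally show ?thesis by (simp add: Q_def)
  qed
  have \<rho>1: "lgB / (24 * real B * (W * L)) \<le> \<rho>"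
    unfolding \<rho>_def using w w1 B2 lgpos W L1 by (intro divide_left_mono mult_left_mono) auto
  have "L / (160 * K) * (lgB / (24 * real B * (W * L))) \<le> card Ds * \<rho>"
    using Ds1 \<rho>1 lgpos W L1 B2 K0 by (intro mult_mono) auto
  \<comment> \<open>\<open>245760 = 64 * 160 * 24\<close>; the factor \<open>L\<close> in the number
    of levels cancels the one from the word size.\<close>
  moreover have "L / (160 * K) * (lgB / (24 * real B * (W * L))) = 64 * (lgB / (real B * K) / (245760 * W))"
    using L1 by (simp add: field_simps)
  ultimately have "lgB / (real B * K) / (245760 * W) \<le> Q * t" using 2 by linarith
  also have "\<dots> \<le> (1 + 1 / (24 * \<omega>)) * t" using Q1 t0 by (rule mult_right_mono)
  finally have "lgB / (real B * K) \<le> (1 + 1 / (24 * \<omega>)) * t * (245760 * W)"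
    by (rule pos_divide_le_eq[THEN iffD1, rotated]) (use W in simp)
  then show ?thesis by (simp add: lgB_def K_def t_def mult_ac)
qed

text \<open>The sorted priorities carry at least \<open>N * L / 2\<close> bits, the main memory
  holds at most \<open>N\<close> bits and a block at most \<open>B * W * L\<close>, so of order
  \<open>N / (W * B)\<close> blocks have to be read.\<close>

lemma small_blocks:
  fixes N M B w kb pb :: nat and W L tI tE tD :: real
  assumes L: "L = log 2 (real N)" and W: "1 \<le> W" "W * (2 * L + 2) \<le> 2 powr (L / 20)" and L1: "1792 \<le> L"
    and B: "2 * B \<le> M" "real M ^ 4 \<le> real N" "1 \<le> B"
    and w: "1 \<le> w" "real w \<le> W * L"
    and bits: "2 * L \<le> real kb" "2 * L \<le> real pb"
    and lv: "las_vegas_pq N M B w kb pb A" and ea: "expected_amortized N kb pb A tI tE tD"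
  shows "1 / (16 * W * real B) \<le> max tI (max tE tD)"
proof -
  define t where "t = max tI (max tE tD)"
  have N0: "0 < N"
  proof (rule ccontr)
    assume "\<not> 0 < N"
    then have "L = 0" unfolding L by (simp add: log_def)
    then show False using L1 by simp
  qed
  have NL: "real N = 2 powr L" unfolding L using N0 by simp
  have "2 powr 10 \<le> real N" unfolding NL using L1 by (intro powr_mono) auto
  then have N1: "1024 \<le> N" by simp
  have kb: "N \<le> 2 ^ kb"
  proof -
    have "real N \<le> 2 powr kb" unfolding NL using bits L1 by (intro powr_mono) auto
    then have "real N \<le> real (2 ^ kb)" by (simp add: powr_realpow)
    then show ?thesis by (simp only: of_nat_le_iff)
  qed
  define X where "X = ({..<N div 2} \<rightarrow>\<^sub>E {..<2 ^ pb :: nat})"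
  have finX: "finite X" by (simp add: X_def finite_PiE)
  have vX: "length (sorting N x) = N \<and> valid_requests kb pb {} (sorting N x)" if "x \<in> X" for x
    using that kb by (intro conjI length_sorting sorting_valid) (auto simp: X_def PiE_def)
  obtain r where r: "\<And>qs. length qs = N \<Longrightarrow> valid_requests kb pb {} qs \<Longrightarrow> \<exists>as c. seq_run (A r) 0 (initial (A r)) qs as c"
    "\<And>c. (\<forall>x\<in>X. \<exists>as. seq_run (A r) 0 (initial (A r)) (sorting N x) as (c x)) \<Longrightarrow>
       (\<Sum>x\<in>X. real (c x)) \<le> card X * (N * t)"
    using exists_good_coins[where f = "sorting N", OF lv ea finX vX] unfolding t_def by blast
  have "\<forall>x\<in>X. \<exists>c. \<exists>as. seq_run (A r) 0 (initial (A r)) (sorting N x) as c" using r(1) vX by blast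
  from bchoice[OF this] obtain c where c: "\<forall>x\<in>X. \<exists>as. seq_run (A r) 0 (initial (A r)) (sorting N x) as (c x)" by blast
  \<comment> \<open>So many reads yield at most half of the \<open>N * L / 2\<close> bits, and the
    other half exceeds the main memory.\<close>
  define thr where "thr = real N / (8 * W * B)"
  have "card X * (thr / 2) \<le> (\<Sum>x\<in>X. real (c x))"
    unfolding X_def
  proof (rule sorting_io_bound[where A = "A r" and kb = kb and M = M and B = B and w = w])
    show "wf_machine M B w (A r)" using lv by (simp add: las_vegas_pq_def)
    show "N \<le> 2 ^ kb" "2 \<le> N" using kb N1 by auto
    show "correct_answers {} qs as" if "length qs = N" "valid_requests kb pb {} qs"
      "seq_run (A r) 0 (initial (A r)) qs as c" for qs as c
      using lv that unfolding las_vegas_pq_def by blast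
    show "\<exists>as. seq_run (A r) 0 (initial (A r)) (sorting N x) as (c x)" if "x \<in> {..<N div 2} \<rightarrow>\<^sub>E {..<2 ^ pb}" for x
      using c that by (simp add: X_def)
    show thr0: "0 \<le> thr" using W by (simp add: thr_def)
    show "real (M * w) + real (B * w + 1) * thr + 1 < real (pb * (N div 2))"
    proof -
      have Mle: "real M \<le> 2 powr (L / 4)"
      proof -
        have "real M ^ 4 \<le> (2 powr (L / 4)) ^ 4" using B(2) NL by (simp add: powr_power)
        then show ?thesis by (rule power4_le_imp_le) simp
      qed
      have "W * L \<le> W * (2 * L + 2)" using W(1) L1 by (intro mult_left_mono) auto
      then have "real w \<le> 2 powr (L / 20)" using w W by linarith
      then have "real M * real w \<le> 2 powr (L / 4) * 2 powr (L / 20)" using Mle by (intro mult_mono) auto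
      also have "\<dots> = 2 powr (3/10 * L)" by (simp flip: powr_add)
      also have "\<dots> \<le> real N" unfolding NL using L1 by (intro powr_mono) auto
      finally have 1: "real (M * w) \<le> real N" by simp
      have "B * w + 1 \<le> 2 * (B * w)" using B(3) w(1) by (simp add: Suc_le_eq)
      then have "real (B * w + 1) \<le> real (2 * (B * w))" by (simp only: of_nat_le_iff)
      also have "\<dots> \<le> 2 * real B * (W * L)" using w by (simp add: mult_left_mono)
      finally have "real (B * w + 1) * thr \<le> 2 * real B * (W * L) * thr" using thr0 by (rule mult_right_mono)
      also have "\<dots> = real N * L / 4" unfolding thr_def using W B by (simp add: field_simps)
      finally have 2: "real (B * w + 1) * thr \<le> real N * L / 4" .
      have "real N / 2 - 1 \<le> real (N div 2)" by linarith
      then have "real N / 4 \<le> real (N div 2)" using N1 by linarith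
      then have "2 * L * (real N / 4) \<le> real pb * real (N div 2)" using bits L1 by (intro mult_mono) auto
      then have 3: "real N * L / 2 \<le> real (pb * (N div 2))" by (simp add: mult_ac)
      have "8 * real N \<le> L * real N" using L1 by (intro mult_right_mono) auto
      then have "real N + 1 < L * real N / 4" using N1 by linarith
      then have "real N + 1 < real N * L / 4" by (simp only: mult.commute)
      then show ?thesis using 1 2 3 by linarith
    qed
  qed
  also have "\<dots> \<le> card X * (N * t)" by (rule r(2)[OF c])
  finally have "thr / 2 \<le> N * t"
    using finX by (simp add: X_def card_PiE)
  then have "real N * (1 / (16 * W * real B)) \<le> real N * t" by (simp add: thr_def)
  then have "1 / (16 * W * real B) \<le> t" by (rule mult_left_le_imp_le) (use N0 in simp)
  then show ?thesis by (simp only: t_def)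
qed

text \<open>As \<open>2 powr (L / 20)\<close> is \<open>N powr (1/20)\<close>, the second condition
  fits the word size into the slack between \<open>M \<le> N powr (1/4)\<close> and
  \<open>M * w \<le> N powr (3/10)\<close>.\<close>

lemma eventually_sizes:
  fixes W :: real
  assumes "1 \<le> W"
  shows "\<forall>\<^sub>F L in at_top. 64 * (28 + 2 * W) + 60 * W \<le> L \<and> W * (2 * L + 2) \<le> 2 powr (L / 20) \<and> 320 * log 2 L \<le> L"
proof (intro eventually_conj)
  show "\<forall>\<^sub>F L in at_top. 64 * (28 + 2 * W) + 60 * W \<le> L" by (rule eventually_ge_at_top)
  show "\<forall>\<^sub>F L :: real in at_top. 320 * log 2 L \<le> L" by real_asymp
  have "\<forall>\<^sub>F L :: real in at_top. L * (2 * L + 2) \<le> 2 powr (L / 20)" by real_asymp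
  then show "\<forall>\<^sub>F L in at_top. W * (2 * L + 2) \<le> 2 powr (L / 20)"
    using eventually_ge_at_top[of W] eventually_ge_at_top[of 0]
  proof eventually_elim
    case (elim L)
    then have "W * (2 * L + 2) \<le> L * (2 * L + 2)" by (intro mult_right_mono) auto
    with elim show ?case by linarith
  qed
qed

theorem theorem1:
  "\<exists>\<kappa>::real. 0 < \<kappa> \<and>
    (\<forall>(\<epsilon>::real) (\<kappa>'::real) (\<omega>::real) (\<omega>'::real). 0 < \<epsilon> \<and> 0 < \<omega> \<longrightarrow>
      (\<exists>(c::real) (N\<^sub>0::nat). 0 < c \<and>
        (\<forall>(N::nat) (M::nat) (B::nat) (w::nat) (kb::nat) (pb::nat) A (tI::real) (tE::real) (tD::real).
           N\<^sub>0 \<le> N \<and> 1 \<le> B \<and> 2 * B \<le> M \<and> real M powr (4 + \<epsilon>) \<le> real N \<and>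
           \<omega> * log 2 (real N) \<le> real w \<and> real w \<le> \<omega>' * log 2 (real N) \<and>
           \<kappa> * log 2 (real N) \<le> real kb \<and> real kb \<le> \<kappa>' * log 2 (real N) \<and>
           \<kappa> * log 2 (real N) \<le> real pb \<and> real pb \<le> \<kappa>' * log 2 (real N) \<and>
           las_vegas_pq N M B w kb pb A \<and>
           expected_amortized N kb pb A tI tE tD
           \<longrightarrow> c * (1 / real B * log (log 2 (real N)) (real B)) \<le> max tI (max tE tD))))"
\<comment> \<open>With \<open>\<kappa> = 2\<close> there are at least \<open>N ^ 2\<close> keys,
  enough for the fewer than \<open>2 * N\<close> that may be issued, and the priorities to be sorted
  have at least \<open>2 * lg N\<close> bits.\<close>
proof (rule exI[of _ "2 :: real"], intro conjI allI impI)
  fix \<epsilon> \<kappa>' \<omega> \<omega>' :: real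
  assume \<epsilon>\<omega>: "0 < \<epsilon> \<and> 0 < \<omega>"
  define W where "W = max 1 \<omega>'"
  \<comment> \<open>The second entry is the constant for small blocks divided by \<open>8\<close>,
    because there the logarithm is at most \<open>8\<close>.\<close>
  define c where "c = min (1 / (245760 * W * (1 + 1 / (24 * \<omega>)))) (1 / (128 * W))"
  have W: "1 \<le> W" by (simp add: W_def)
  obtain L0 where L0: "\<And>L. L0 \<le> L \<Longrightarrow> 64 * (28 + 2 * W) + 60 * W \<le> L \<and> W * (2 * L + 2) \<le> 2 powr (L / 20) \<and> 320 * log 2 L \<le> L"
    using eventually_sizes[OF W] unfolding eventually_at_top_linorder by blast
  define N0 where "N0 = nat \<lceil>2 powr L0\<rceil>"
  have bound: "c * (1 / real B * log (log 2 (real N)) (real B)) \<le> max tI (max tE tD)"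
    if a: "N0 \<le> N" "1 \<le> B" "2 * B \<le> M" "real M powr (4 + \<epsilon>) \<le> real N"
      "\<omega> * log 2 (real N) \<le> real w" "real w \<le> \<omega>' * log 2 (real N)"
      "2 * log 2 (real N) \<le> real kb" "2 * log 2 (real N) \<le> real pb"
      and lv: "las_vegas_pq N M B w kb pb A" and ea: "expected_amortized N kb pb A tI tE tD"
    for N M B w kb pb A tI tE tD
  proof -
    define L where "L = log 2 (real N)"
    define t where "t = max tI (max tE tD)"
    define \<nu> where "\<nu> = 2 * nat \<lceil>L\<rceil>"
    have "2 powr L0 \<le> real N"
      using a(1) unfolding N0_def by linarith
    then have "L0 \<le> L" unfolding L_def using less_le_trans[of 0 "2 powr L0" "real N"] by (simp add: le_log_iff)
    note big = L0[OF this]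
    have b1: "64 * (28 + 2 * W) + 60 * W \<le> L" and b2: "W * (2 * L + 2) \<le> 2 powr (L / 20)" and b3: "320 * log 2 L \<le> L"
      using big by blast+
    have L1: "1792 \<le> L" using b1 W by simp
    have M1: "1 \<le> real M" using a(2,3) by simp
    have M4: "real M ^ 4 \<le> real N"
    proof -
      have "real M ^ 4 = real M powr 4" using M1 by simp
      also have "\<dots> \<le> real M powr (4 + \<epsilon>)" using \<epsilon>\<omega> M1 by (intro powr_mono) auto
      finally show ?thesis using a(4) by linarith
    qed
    have "\<omega>' * L \<le> W * L" using L1 by (intro mult_right_mono) (auto simp: W_def)
    then have w: "real w \<le> W * L" using a(6) unfolding L_def by linarith
    have "0 < \<omega> * L" using \<epsilon>\<omega> L1 by simp
    then have "0 < real w" using a(5) unfolding L_def by linarith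
    then have w1: "1 \<le> w" by simp
    have t0: "0 \<le> t" using ea by (auto simp: expected_amortized_def t_def)
    have logs: "log L (real B) = log 2 (real B) / log 2 L"
      using L1 by (intro log_base_change) auto
    have K0: "0 < log 2 L" using L1 by simp
    have B0: "0 < real B" using a(2) by simp
    have lgB0: "0 \<le> log 2 (real B)" using a(2) by simp
    show ?thesis
    \<comment> \<open>Below this threshold \<open>B \<le> L ^ 8\<close>, so the logarithm of
      \<open>B\<close> to base \<open>L\<close> is bounded and a bound of order \<open>1 / B\<close>
      suffices.\<close>
    proof (cases "\<nu> ^ 4 \<le> B")
      case True
      define Z where "Z = 245760 * W * (1 + 1 / (24 * \<omega>))"
      have Z: "0 < Z" unfolding Z_def using W \<epsilon>\<omega> by (intro mult_pos_pos add_pos_pos) auto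
      have "log 2 (real B) / (real B * log 2 L) \<le> Z * t"
        unfolding Z_def t_def
        by (rule large_blocks[OF L_def W b1 b2 b3 a(3) M4 True[unfolded \<nu>_def] conjunct2[OF \<epsilon>\<omega>] a(5)[folded L_def] w
              a(7,8)[folded L_def] lv ea parameters_ok_large[OF refl _ _ W]])
      then have "log 2 (real B) / (real B * log 2 L) \<le> t * Z" by (simp only: mult.commute)
      then have "log 2 (real B) / (real B * log 2 L) / Z \<le> t" by (rule pos_divide_le_eq[OF Z, THEN iffD2])
      then have "1 / Z * (log 2 (real B) / (real B * log 2 L)) \<le> t" by (simp add: mult.commute)
      moreover have "c * (log 2 (real B) / (real B * log 2 L)) \<le> 1 / Z * (log 2 (real B) / (real B * log 2 L))"
        using lgB0 B0 K0 by (intro mult_right_mono) (auto simp: c_def Z_def)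
      ultimately show ?thesis unfolding L_def[symmetric] logs t_def[symmetric] by simp
    next
      case False
      have s: "1 / (16 * W * real B) \<le> t"
        unfolding t_def by (rule small_blocks[OF L_def W b2 L1 a(3) M4 a(2) w1 w a(7,8)[folded L_def] lv ea])
      have "real \<nu> \<le> L ^ 2"
      proof -
        have "3 * L \<le> L * L" using L1 by (intro mult_right_mono) auto
        moreover have "real \<nu> \<le> 2 * L + 2" unfolding \<nu>_def using L1 by linarith
        ultimately show ?thesis using L1 unfolding power2_eq_square by linarith
      qed
      then have "real \<nu> ^ 4 \<le> (L ^ 2) ^ 4" by (intro power_mono) auto
      moreover have "(L ^ 2) ^ 4 = L ^ 8" by (simp flip: power_mult)
      moreover have "real B \<le> real (\<nu> ^ 4)" using False by (simp only: of_nat_le_iff)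
      then have "real B \<le> real \<nu> ^ 4" by (simp only: of_nat_power)
      ultimately have "real B \<le> L ^ 8" by linarith
      then have "log 2 (real B) \<le> log 2 (L ^ 8)" using B0 L1 by simp
      also have "\<dots> = 8 * log 2 L" using L1 by (simp add: log_nat_power)
      finally have "log L (real B) \<le> 8" unfolding logs using K0 by (simp add: divide_le_eq)
      then have "c * (1 / real B * log L (real B)) \<le> 1 / (128 * W) * (1 / real B * 8)"
        using B0 W lgB0 K0 by (intro mult_mono) (auto simp: c_def logs)
      also have "\<dots> = 1 / (16 * W * real B)" by simp
      finally show ?thesis using s by (simp add: L_def t_def)
    qed
  qed
  have c: "0 < c" unfolding c_def using W \<epsilon>\<omega> by (auto intro!: mult_pos_pos add_pos_pos divide_pos_pos)
  show "\<exists>c N\<^sub>0. 0 < c \<and>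
        (\<forall>(N::nat) (M::nat) (B::nat) (w::nat) (kb::nat) (pb::nat) A (tI::real) (tE::real) (tD::real).
           N\<^sub>0 \<le> N \<and> 1 \<le> B \<and> 2 * B \<le> M \<and> real M powr (4 + \<epsilon>) \<le> real N \<and>
           \<omega> * log 2 (real N) \<le> real w \<and> real w \<le> \<omega>' * log 2 (real N) \<and>
           2 * log 2 (real N) \<le> real kb \<and> real kb \<le> \<kappa>' * log 2 (real N) \<and>
           2 * log 2 (real N) \<le> real pb \<and> real pb \<le> \<kappa>' * log 2 (real N) \<and>
           las_vegas_pq N M B w kb pb A \<and>
           expected_amortized N kb pb A tI tE tD
           \<longrightarrow> c * (1 / real B * log (log 2 (real N)) (real B)) \<le> max tI (max tE tD))"
    by (intro exI[of _ c] exI[of _ N0] conjI allI impI c) (elim conjE, rule bound)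
qed simp

end
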